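(* Let $d\ge 1$, let $\Sigma$ be a positive definite Hermitian $d\times d$ matrix and let $Z\sim C\mathcal{N}_d(0,\Sigma)$. Let $F=(F_1,\dots,F_d)$ be a complex random vector whose components are elements of $\mathcal{A}_0$. Then $$d_W(F,Z)\le 2\,\|\Sigma^{-1}\|_{\mathrm{op}}\,\|\Sigma\|_{\mathrm{op}}^{1/2}\left(\int_E\big\|\Gamma(\overline{F},-L^{-1}F)\big\|_{\mathrm{HS}}^2\,d\mu+\int_E\big\|\Gamma(F,-L^{-1}F)-\Sigma\big\|_{\mathrm{HS}}^2\,d\mu\right)^{1/2}.$$
   Context: Setting. $E$ is a good measurable space (e.g. a Polish space) equipped with a probability measure $\mu$. $L$ is a complex symmetric Markov diffusion generator acting on $L^2(E,\mathbb{C},\mu)$ with invariant measure $\mu$; equivalently, it is the complexification $LF=L\,\mathrm{Re}(F)+\mathrm{i}\,L\,\mathrm{Im}(F)$ of a real symmetric Markov diffusion generator. Thus $-L$ is a positive self-adjoint linear operator, $L1=0$, $L\overline{F}=\overline{LF}$, and $L$ has discrete spectrum $\{-\lambda_k\}_{k\ge 0}$ with $0=\lambda_0<\lambda_1<\cdots$. The associated carré du champ operator $\Gamma$ acts on a set $\mathcal{A}_0$ of complex-valued functions on $E$, assumed dense in $L^p(E,\mathbb{C},\mu)$ for all $p\ge1$. It is the sesquilinear (conjugate-linear in the second argument), Hermitian, positive form $$2\Gamma(F,G)=L(F\overline{G})-F\,L\overline{G}-\overline{G}\,LF .$$ It satisfies $\int_E\Gamma(F,G)\,d\mu=-\int_E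 F\,L\overline{G}\,d\mu$ and, for smooth $\varphi:\mathbb{C}^d\to\mathbb{C}$, the chain rule (equivalent to the diffusion property of $L$) $$\Gamma(\varphi(F_1,\dots,F_d),G)=\sum_{j=1}^d\big(\partial_{z_j}\varphi(F)\,\Gamma(F_j,G)+\partial_{\overline{z}_j}\varphi(F)\,\Gamma(\overline{F}_j,G)\big),$$ where $\partial_{z}=\tfrac12(\partial_x-\mathrm{i}\partial_y)$ and $\partial_{\overline{z}}=\tfrac12(\partial_x+\mathrm{i}\partial_y)$ are the Wirtinger derivatives, $z=x+\mathrm{i}y$. $L^{-1}$ denotes the inverse of $L$ (so $L^{-1}F=-\lambda_k^{-1}F$ if $LF=-\lambda_kF$ with $\lambda_k>0$). For vectors $F=(F_1,\dots,F_d)$, $G=(G_1,\dots,G_d)$, $\Gamma(F,-L^{-1}G)$ denotes the matrix $\big(\Gamma(F_j,-L^{-1}G_k)\big)_{1\le j,k\le d}$, and $\overline{F}=(\overline{F}_1,\dots,\overline{F}_d)$. The law of $F$ is taken under $\mu$. Complex normal distribution. $Z\sim C\mathcal{N}_d(0,\Sigma)$ means that $Z$ has density $f(z)=\frac{1}{\pi^d|\det\Sigma|}\exp(-\overline{z}^T\Sigma^{-1}z)$ on $\mathbb{C}^d\cong\mathbb{R}^{2d}$; this is the circularly symmetric Gaussian, with $\mathrm{E}[Z\overline{Z}^T]=\Sigma$, $\mathrm{E}[ZZ^T]=0$. Norms. $\|A\|_{\mathrm{HS}}^2=\operatorname{tr}(A\overline{A}^T)$; $\|\cdot\|_{\mathrm{op}}$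 is the operator norm. The Wasserstein distance is $d_W(F,G)=\sup_h|\mathrm{E}[h(F)]-\mathrm{E}[h(G)]|$, the supremum being over all $h:\mathbb{C}^d\to\mathbb{C}$ with Lipschitz constant at most $1$ with respect to the Euclidean norm $\|z\|_2=(\sum_j|z_j|^2)^{1/2}$.
   Formalization: Each component F_k is additionally assumed to lie in the domain of L^{-1} (in particular to be centred) with L^{-1}F_k in A_0, so that Γ(F_j, -L^{-1}F_k) is defined; for constant F the bound would otherwise be undefined or false. *)

theory Defs
  imports "HOL-Probability.Probability"
begin

section \<open>Operators on \<open>L\<^sup>2(M)\<close>\<close>

text \<open>
  Elements of \<open>L\<^sup>p\<close> are represented by measurable functions; equalities between them, and all
  identities for operators acting on them, are understood almost everywhere.
\<close>

definition Lp :: "'a measure \<Rightarrow> real \<Rightarrow> ('a \<Rightarrow> complex) set" where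
  "Lp M p = {f \<in> borel_measurable M. integrable M (\<lambda>x. cmod (f x) powr p)}"

abbreviation L2 :: "'a measure \<Rightarrow> ('a \<Rightarrow> complex) set" where
  "L2 M \<equiv> Lp M 2"

definition ip :: "'a measure \<Rightarrow> ('a \<Rightarrow> complex) \<Rightarrow> ('a \<Rightarrow> complex) \<Rightarrow> complex" where
  "ip M F G = (\<integral>x. F x * cnj (G x) \<partial>M)"

definition norm2 :: "'a measure \<Rightarrow> ('a \<Rightarrow> complex) \<Rightarrow> real" where
  "norm2 M F = sqrt (\<integral>x. (cmod (F x))\<^sup>2 \<partial>M)"

definition dense_in_Lp :: "'a measure \<Rightarrow> real \<Rightarrow> ('a \<Rightarrow> complex) set \<Rightarrow> bool" where
  "dense_in_Lp M p A \<longleftrightarrow> A \<subseteq> Lp M p \<and>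
     (\<forall>f\<in>Lp M p. \<forall>\<epsilon>>0. \<exists>g\<in>A. (\<integral>x. cmod (f x - g x) powr p \<partial>M) < \<epsilon>)"

text \<open>A subspace of \<open>L\<^sup>p\<close>-classes: closed under linear combinations and under changing representatives.\<close>

definition fun_subspace :: "'a measure \<Rightarrow> ('a \<Rightarrow> complex) set \<Rightarrow> bool" where
  "fun_subspace M A \<longleftrightarrow> A \<subseteq> borel_measurable M \<and> (\<lambda>x. 0) \<in> A \<and>
     (\<forall>F\<in>A. \<forall>G\<in>A. \<forall>a b. (\<lambda>x. a * F x + b * G x) \<in> A) \<and>
     (\<forall>F\<in>A. \<forall>G\<in>borel_measurable M. (AE x in M. F x = G x) \<longrightarrow> G \<in> A)"

definition linear_operator ::
  "'a measure \<Rightarrow> ('a \<Rightarrow> complex) set \<Rightarrow> (('a \<Rightarrow> complex) \<Rightarrow> 'a \<Rightarrow> complex) \<Rightarrow> bool" where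
  "linear_operator M D T \<longleftrightarrow> D \<subseteq> L2 M \<and> fun_subspace M D \<and> T ` D \<subseteq> L2 M \<and>
     (\<forall>F\<in>D. \<forall>G\<in>D. (AE x in M. F x = G x) \<longrightarrow> (AE x in M. T F x = T G x)) \<and>
     (\<forall>F\<in>D. \<forall>G\<in>D. \<forall>a b.
        AE x in M. T (\<lambda>x. a * F x + b * G x) x = a * T F x + b * T G x)"

text \<open>The second conjunct says that the operator is symmetric, the third one that the domain
  of its adjoint is not larger than its own domain.\<close>

definition self_adjoint ::
  "'a measure \<Rightarrow> ('a \<Rightarrow> complex) set \<Rightarrow> (('a \<Rightarrow> complex) \<Rightarrow> 'a \<Rightarrow> complex) \<Rightarrow> bool" where
  "self_adjoint M D T \<longleftrightarrow> dense_in_Lp M 2 D \<and>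
     (\<forall>F\<in>D. \<forall>G\<in>D. ip M (T F) G = ip M F (T G)) \<and>
     (\<forall>G\<in>L2 M. (\<exists>H\<in>L2 M. \<forall>F\<in>D. ip M (T F) G = ip M F H) \<longrightarrow> G \<in> D)"

definition resolvent_set ::
  "'a measure \<Rightarrow> ('a \<Rightarrow> complex) set \<Rightarrow> (('a \<Rightarrow> complex) \<Rightarrow> 'a \<Rightarrow> complex) \<Rightarrow> complex set" where
  "resolvent_set M D T = {z.
     (\<forall>H\<in>L2 M. \<exists>F\<in>D. AE x in M. z * F x - T F x = H x) \<and>
     (\<exists>C. \<forall>F\<in>D. norm2 M F \<le> C * norm2 M (\<lambda>x. z * F x - T F x))}"

definition spectrum ::
  "'a measure \<Rightarrow> ('a \<Rightarrow> complex) set \<Rightarrow> (('a \<Rightarrow> complex) \<Rightarrow> 'a \<Rightarrow> complex) \<Rightarrow> complex set" where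
  "spectrum M D T = - resolvent_set M D T"

text \<open>
  The inverse of \<open>T\<close>, that is, of the injective restriction of \<open>T\<close> to the orthogonal complement
  of its kernel: \<open>op_inv M D T F\<close> is the (a.e. unique) \<open>U\<close> orthogonal to \<open>ker T\<close> with \<open>T U = F\<close>,
  and is meaningful for \<open>F\<close> in \<open>op_inv_dom M D T\<close> only. For a self-adjoint \<open>T\<close> with \<open>T 1 = 0\<close>
  such an \<open>F\<close> is centred.
\<close>

definition is_op_inv :: "'a measure \<Rightarrow> ('a \<Rightarrow> complex) set \<Rightarrow>
    (('a \<Rightarrow> complex) \<Rightarrow> 'a \<Rightarrow> complex) \<Rightarrow> ('a \<Rightarrow> complex) \<Rightarrow> ('a \<Rightarrow> complex) \<Rightarrow> bool" where
  "is_op_inv M D T F U \<longleftrightarrow> U \<in> D \<and> (AE x in M. T U x = F x) \<and>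
     (\<forall>K\<in>D. (AE x in M. T K x = 0) \<longrightarrow> ip M U K = 0)"

definition op_inv_dom :: "'a measure \<Rightarrow> ('a \<Rightarrow> complex) set \<Rightarrow>
    (('a \<Rightarrow> complex) \<Rightarrow> 'a \<Rightarrow> complex) \<Rightarrow> ('a \<Rightarrow> complex) set" where
  "op_inv_dom M D T = {F \<in> L2 M. \<exists>U. is_op_inv M D T F U}"

definition op_inv :: "'a measure \<Rightarrow> ('a \<Rightarrow> complex) set \<Rightarrow>
    (('a \<Rightarrow> complex) \<Rightarrow> 'a \<Rightarrow> complex) \<Rightarrow> ('a \<Rightarrow> complex) \<Rightarrow> 'a \<Rightarrow> complex" where
  "op_inv M D T F = (SOME U. is_op_inv M D T F U)"


section \<open>Symmetric Markov semigroups and their generators\<close>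

definition symmetric_markov_semigroup ::
  "'a measure \<Rightarrow> (real \<Rightarrow> ('a \<Rightarrow> complex) \<Rightarrow> 'a \<Rightarrow> complex) \<Rightarrow> bool" where
  "symmetric_markov_semigroup M P \<longleftrightarrow>
     (\<forall>t\<ge>0. linear_operator M (L2 M) (P t)) \<and>
     (\<forall>F\<in>L2 M. AE x in M. P 0 F x = F x) \<and>
     (\<forall>s\<ge>0. \<forall>t\<ge>0. \<forall>F\<in>L2 M. AE x in M. P (s + t) F x = P s (P t F) x) \<and>
     (\<forall>F\<in>L2 M. ((\<lambda>t. norm2 M (\<lambda>x. P t F x - F x)) \<longlongrightarrow> 0) (at_right 0)) \<and>
     (\<forall>t\<ge>0. AE x in M. P t (\<lambda>x. 1) x = 1) \<and>
     (\<forall>t\<ge>0. \<forall>F\<in>L2 M. (AE x in M. F x \<in> \<real>\<^sub>\<ge>\<^sub>0) \<longrightarrow> (AE x in M. P t F x \<in> \<real>\<^sub>\<ge>\<^sub>0)) \<and>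
     (\<forall>t\<ge>0. \<forall>F\<in>L2 M. \<forall>G\<in>L2 M. ip M (P t F) G = ip M F (P t G))"

definition generator_of :: "'a measure \<Rightarrow> (real \<Rightarrow> ('a \<Rightarrow> complex) \<Rightarrow> 'a \<Rightarrow> complex) \<Rightarrow>
    ('a \<Rightarrow> complex) set \<Rightarrow> (('a \<Rightarrow> complex) \<Rightarrow> 'a \<Rightarrow> complex) \<Rightarrow> bool" where
  "generator_of M P D L \<longleftrightarrow>
     D = {F \<in> L2 M. \<exists>G\<in>L2 M.
            ((\<lambda>t. norm2 M (\<lambda>x. (P t F x - F x) / of_real t - G x)) \<longlongrightarrow> 0) (at_right 0)} \<and>
     (\<forall>F\<in>D. L F \<in> L2 M \<and>
        ((\<lambda>t. norm2 M (\<lambda>x. (P t F x - F x) / of_real t - L F x)) \<longlongrightarrow> 0) (at_right 0))"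


section \<open>Smooth functions on \<open>\<complex>\<^sup>d\<close> and Wirtinger derivatives\<close>

text \<open>All derivatives below are real (Frechet) derivatives on \<open>\<complex>\<^sup>d\<close> viewed as \<open>\<real>\<^sup>2\<^sup>d\<close>.\<close>

fun iter_deriv :: "(complex ^ 'n \<Rightarrow> complex) \<Rightarrow> (complex ^ 'n) list \<Rightarrow> complex ^ 'n \<Rightarrow> complex" where
  "iter_deriv \<phi> [] = \<phi>"
| "iter_deriv \<phi> (v # vs) = (\<lambda>z. frechet_derivative (iter_deriv \<phi> vs) (at z) v)"

definition smooth :: "(complex ^ 'n \<Rightarrow> complex) \<Rightarrow> bool" where
  "smooth \<phi> \<longleftrightarrow> (\<forall>vs z. iter_deriv \<phi> vs differentiable (at z))"

definition smooth_bounded :: "(complex ^ 'n \<Rightarrow> complex) \<Rightarrow> bool" where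
  "smooth_bounded \<phi> \<longleftrightarrow> smooth \<phi> \<and> (\<forall>vs. bounded (range (iter_deriv \<phi> vs)))"

definition wirtinger :: "'n \<Rightarrow> (complex ^ 'n \<Rightarrow> complex) \<Rightarrow> complex ^ 'n \<Rightarrow> complex" where
  "wirtinger j \<phi> z = (frechet_derivative \<phi> (at z) (axis j 1)
      - \<i> * frechet_derivative \<phi> (at z) (axis j \<i>)) / 2"

definition wirtinger_bar :: "'n \<Rightarrow> (complex ^ 'n \<Rightarrow> complex) \<Rightarrow> complex ^ 'n \<Rightarrow> complex" where
  "wirtinger_bar j \<phi> z = (frechet_derivative \<phi> (at z) (axis j 1)
      + \<i> * frechet_derivative \<phi> (at z) (axis j \<i>)) / 2"

definition rvec :: "('n \<Rightarrow> 'a \<Rightarrow> complex) \<Rightarrow> 'a \<Rightarrow> complex ^ 'n" where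
  "rvec F x = (\<chi> j. F j x)"

definition cconj :: "('a \<Rightarrow> complex) \<Rightarrow> 'a \<Rightarrow> complex" where
  "cconj F x = cnj (F x)"


section \<open>Complex symmetric Markov diffusion generators\<close>

definition carre_du_champ :: "(('a \<Rightarrow> complex) \<Rightarrow> 'a \<Rightarrow> complex) \<Rightarrow>
    ('a \<Rightarrow> complex) \<Rightarrow> ('a \<Rightarrow> complex) \<Rightarrow> 'a \<Rightarrow> complex" where
  "carre_du_champ L F G x =
     (L (\<lambda>y. F y * cnj (G y)) x - F x * L (cconj G) x - cnj (G x) * L F x) / 2"

text \<open>
  The chain rule is demanded for every smooth \<open>\<phi>\<close> for which its left-hand side makes sense, i.e.
  \<open>\<phi>(F\<^sub>1,\<dots>,F\<^sub>d)\<close> belongs to \<open>A0\<close>. Composites with all smooth \<open>\<phi>\<close> cannot be required to be in \<open>A0\<close>: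
  they need not be integrable, unless \<open>A0\<close> consists of bounded functions only. Stability of \<open>A0\<close>
  is therefore required just for those \<open>\<phi>\<close> that are bounded together with all their derivatives.
  The dimension \<open>d\<close> is the cardinality of the index type \<open>'n\<close>.
\<close>

locale complex_markov_diffusion = prob_space M
  for M :: "'a measure" +
  fixes dimtype :: "'n::finite itself"
    and D :: "('a \<Rightarrow> complex) set"
    and L :: "('a \<Rightarrow> complex) \<Rightarrow> 'a \<Rightarrow> complex"
    and ev :: "nat \<Rightarrow> real"
    and A0 :: "('a \<Rightarrow> complex) set"
  assumes linear: "linear_operator M D L"
    and self_adjoint: "self_adjoint M D L"
    and positive: "F \<in> D \<Longrightarrow> Re (ip M (\<lambda>x. - L F x) F) \<ge> 0"
    and markov: "\<exists>P. symmetric_markov_semigroup M P \<and> generator_of M P D L"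
    and one: "(\<lambda>x. 1) \<in> D" "AE x in M. L (\<lambda>x. 1) x = 0"
    and real_operator: "F \<in> D \<Longrightarrow> cconj F \<in> D"
      "F \<in> D \<Longrightarrow> AE x in M. L (cconj F) x = cnj (L F x)"
    and eigenvalues: "ev 0 = 0" "strict_mono ev"
    and discrete_spectrum: "spectrum M D L = range (\<lambda>k. complex_of_real (- ev k))"
    and A0_subspace: "fun_subspace M A0"
    and A0_dense: "p \<ge> 1 \<Longrightarrow> dense_in_Lp M p A0"
    and A0_cnj: "F \<in> A0 \<Longrightarrow> cconj F \<in> A0"
    and A0_domain: "A0 \<subseteq> D" "F \<in> A0 \<Longrightarrow> G \<in> A0 \<Longrightarrow> (\<lambda>x. F x * cnj (G x)) \<in> D"
    and A0_smooth: "smooth_bounded (\<phi> :: complex ^ 'n \<Rightarrow> complex) \<Longrightarrow> (\<And>j. H j \<in> A0) \<Longrightarrow>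
      (\<lambda>x. \<phi> (rvec H x)) \<in> A0"
    and chain_rule: "smooth (\<phi> :: complex ^ 'n \<Rightarrow> complex) \<Longrightarrow> (\<And>j. H j \<in> A0) \<Longrightarrow> G \<in> A0 \<Longrightarrow>
      (\<lambda>x. \<phi> (rvec H x)) \<in> A0 \<Longrightarrow>
      AE x in M. carre_du_champ L (\<lambda>y. \<phi> (rvec H y)) G x =
        (\<Sum>j\<in>UNIV. wirtinger j \<phi> (rvec H x) * carre_du_champ L (H j) G x
                 + wirtinger_bar j \<phi> (rvec H x) * carre_du_champ L (cconj (H j)) G x)"

text \<open>
  The matrix \<open>\<Gamma>(F, -L\<^sup>-\<^sup>1 G)\<close>. Since \<open>\<Gamma>\<close> acts on \<open>A0\<close>, it is meaningful only if each \<open>G\<^sub>k\<close> is in the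
  domain of \<open>L\<^sup>-\<^sup>1\<close> and \<open>L\<^sup>-\<^sup>1 G\<^sub>k\<close> is in \<open>A0\<close>.
\<close>

definition Gamma_inv :: "'a measure \<Rightarrow> ('a \<Rightarrow> complex) set \<Rightarrow>
    (('a \<Rightarrow> complex) \<Rightarrow> 'a \<Rightarrow> complex) \<Rightarrow>
    ('n \<Rightarrow> 'a \<Rightarrow> complex) \<Rightarrow> ('n \<Rightarrow> 'a \<Rightarrow> complex) \<Rightarrow> 'a \<Rightarrow> complex ^ 'n ^ 'n" where
  "Gamma_inv M D L F G x =
     (\<chi> j k. carre_du_champ L (F j) (\<lambda>y. - op_inv M D L (G k) y) x)"


section \<open>Matrices, complex normal law, Wasserstein distance\<close>

definition conj_transpose :: "complex ^ 'n ^ 'm \<Rightarrow> complex ^ 'm ^ 'n" where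
  "conj_transpose A = (\<chi> i j. cnj (A $ j $ i))"

definition hs_norm :: "complex ^ 'n ^ 'n \<Rightarrow> real" where
  "hs_norm A = sqrt (Re (trace (A ** conj_transpose A)))"

definition op_norm :: "complex ^ 'n ^ 'n \<Rightarrow> real" where
  "op_norm A = onorm (\<lambda>v. A *v v)"

definition sesq_form :: "complex ^ 'n ^ 'n \<Rightarrow> complex ^ 'n \<Rightarrow> complex" where
  "sesq_form A z = (\<Sum>j\<in>UNIV. cnj (z $ j) * (A *v z) $ j)"

definition hermitian_pos_def :: "complex ^ 'n ^ 'n \<Rightarrow> bool" where
  "hermitian_pos_def A \<longleftrightarrow> conj_transpose A = A \<and> (\<forall>z. z \<noteq> 0 \<longrightarrow> Re (sesq_form A z) > 0)"

text \<open>The quadratic form in the exponent is real for Hermitian \<open>\<Sigma>\<close>, so taking \<open>Re\<close> only changes its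
  type.\<close>

definition complex_normal_density :: "complex ^ 'n ^ 'n \<Rightarrow> complex ^ 'n \<Rightarrow> real" where
  "complex_normal_density \<Sigma> z =
     exp (- Re (sesq_form (matrix_inv \<Sigma>) z)) / (pi ^ CARD('n) * cmod (det \<Sigma>))"

definition complex_normal :: "'b measure \<Rightarrow> ('b \<Rightarrow> complex ^ 'n) \<Rightarrow> complex ^ 'n ^ 'n \<Rightarrow> bool" where
  "complex_normal N Z \<Sigma> \<longleftrightarrow> distributed N lborel Z (\<lambda>z. ennreal (complex_normal_density \<Sigma> z))"

text \<open>The distance of \<open>complex ^ 'n\<close> is the Euclidean one.\<close>

definition wasserstein :: "'a measure \<Rightarrow> ('a \<Rightarrow> complex ^ 'n) \<Rightarrow>
    'b measure \<Rightarrow> ('b \<Rightarrow> complex ^ 'n) \<Rightarrow> ennreal" where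
  "wasserstein M X N Y =
     (SUP h \<in> {h :: complex ^ 'n \<Rightarrow> complex. 1-lipschitz_on UNIV h}.
        ennreal (cmod ((\<integral>x. h (X x) \<partial>M) - (\<integral>y. h (Y y) \<partial>N))))"

definition ennsqrt :: "ennreal \<Rightarrow> ennreal" where
  "ennsqrt x = (if x = \<infinity> then \<infinity> else ennreal (sqrt (enn2real x)))"

end

(*
  Let G be Gaussian with covariance \<Sigma> and independent of F. For a smooth 1-Lipschitz real test
  function h, E h(F) and E h(Z) are the values at 0 and \<pi>/2 of

    \<theta> \<mapsto> E h(cos \<theta> F + sin \<theta> G).

  Write \<zeta> = \<Sigma>\<^sup>-\<^sup>1 G. In the derivative, G is a linear image of \<zeta>, and F is removed by
  the integration by parts E[\<phi>(F) cnj F\<^sub>k] = \<Sum>\<^sub>j E[\<partial>\<^sub>j\<phi>(F) \<Gamma>(F\<^sub>j, -L\<^sup>-\<^sup>1F\<^sub>k) + ...],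
  applied to the average \<phi> over G of a component of the gradient of h. For sin \<theta> \<noteq> 0 this
  \<phi> is smooth, as its derivatives can be put on the Gaussian density; they are Gaussian moments of
  the gradient against \<zeta> again. What remains is

    cos \<theta> E[\<nabla>h(cos \<theta> F + sin \<theta> G) \<cdot> w],

  where w is linear in \<zeta> with coefficients \<Sigma> - \<Gamma>(F, -L\<^sup>-\<^sup>1F) and
  \<Gamma>(cnj F, -L\<^sup>-\<^sup>1F). As \<zeta> has covariance \<Sigma>\<^sup>-\<^sup>1, the Cauchy-Schwarz inequality bounds
  this without any regularity of h beyond |\<nabla>h| \<le> 1. The resulting constant
  sqrt (2 ||\<Sigma>\<^sup>-\<^sup>1||) is below the stated one because ||\<Sigma>\<^sup>-\<^sup>1|| ||\<Sigma>|| \<ge> 1. General Lipschitz h are truncated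
  and mollified by a small multiple of G.
*)

theory Submission
  imports Defs
begin

section \<open>Differentiation under the integral sign\<close>

text \<open>The obstacle is regularity: \<open>A0\<close> is stable only under functions that are
  bounded with all their derivatives, while h offers a single bounded derivative. Smoothing by the
  Gaussian repairs this, but differentiating the average costs a factor cos \<theta> / sin \<theta>,
  which blows up at \<theta> = 0. The velocity of the path is cos \<theta> G - sin \<theta> F, so F
  enters with exactly the factor that cancels the singularity. The slope is then at most a constant
  times cos \<theta>, whose integral over [0, \<pi>/2] is 1. No Stein equation is solved and no
  second derivative of a solution has to be estimated.

  The 2 under the square root comes from |a - b|^2 \<le> 2 |a|^2 + 2 |b|^2 for the two parts of w,
  which belong to the two \<Gamma> matrices.

  No Gaussian integral is computed. Total mass one is inherited from the law of Z, and the second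
  moments follow from translation invariance of Lebesgue measure. The independence of F and G is
  expressed by iterated integrals.\<close>

lemma has_derivative_integral_dominated:
  fixes f :: "'x::real_normed_vector \<Rightarrow> 'a \<Rightarrow> 'b::{banach, second_countable_topology}"
  assumes int: "\<And>x. integrable M (f x)"
    and deriv: "\<And>a. ((\<lambda>x. f x a) has_derivative f' a) (at x0)"
    and lip: "\<And>x a. norm (x - x0) \<le> 1 \<Longrightarrow> norm (f x a - f x0 a) \<le> norm (x - x0) * w a"
    and w: "integrable M w"
  shows "integrable M (\<lambda>a. f' a v)"
    and "((\<lambda>x. \<integral>a. f x a \<partial>M) has_derivative (\<lambda>v. \<integral>a. f' a v \<partial>M)) (at x0)"
proof -
  have bl: "bounded_linear (f' a)" for a
    using deriv has_derivative_bounded_linear by blast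
  have quot: "((\<lambda>h. norm (f (x0 + h) a - f x0 a - f' a h) / norm h) \<longlongrightarrow> 0) (at 0)" for a
    using deriv[of a] unfolding has_derivative_at by simp
  have seq: "(\<lambda>n. norm (f (x0 + X n) a - f x0 a - f' a (X n)) / norm (X n)) \<longlonglongrightarrow> 0"
    if "\<And>i. X i \<noteq> 0" "X \<longlonglongrightarrow> 0" for X :: "nat \<Rightarrow> 'x" and a
    using quot[of a] that unfolding tendsto_at_iff_sequentially comp_def by simp
  \<comment> \<open>Measurability of the derivative in \<open>a\<close> is not assumed. It is
    inherited from the difference quotients \<open>s n\<close>, and their limit also keeps the bound
    by norm v times w.\<close>
  have main: "(\<lambda>a. f' a v) \<in> borel_measurable M \<and> (\<forall>a. norm (f' a v) \<le> norm v * w a)" for v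
  proof (cases "v = 0")
    case True
    then show ?thesis using bl by (simp add: linear_0 bounded_linear.linear)
  next
    case False
    \<comment> \<open>The increment \<open>t n *\<^sub>R v\<close> has norm 1 / (n + 1), so it stays
      in the unit ball where \<open>lip\<close> applies.\<close>
    define t where "t n = inverse (real (Suc n)) / norm v" for n
    have tpos: "t n > 0" for n using False by (simp add: t_def)
    have tnorm: "norm (t n *\<^sub>R v) \<le> 1" for n
    proof -
      have "norm (t n *\<^sub>R v) = inverse (real (Suc n))" using False by (simp add: t_def)
      also have "\<dots> \<le> 1" by (simp add: field_simps)
      finally show ?thesis .
    qed
    have "t \<longlonglongrightarrow> 0"
      unfolding t_def using LIMSEQ_inverse_real_of_nat tendsto_divide_zero by blast
    then have tv: "(\<lambda>n. t n *\<^sub>R v) \<longlonglongrightarrow> 0"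
      using tendsto_scaleR[OF _ tendsto_const, of t 0 sequentially v] by simp
    define s where "s n a = (f (x0 + t n *\<^sub>R v) a - f x0 a) /\<^sub>R t n" for n a
    have sb: "norm (s n a) \<le> norm v * w a" for n a
    proof -
      have "norm (f (x0 + t n *\<^sub>R v) a - f x0 a) \<le> norm (t n *\<^sub>R v) * w a"
        using lip[of "x0 + t n *\<^sub>R v" a] tnorm by simp
      then have "norm (f (x0 + t n *\<^sub>R v) a - f x0 a) / t n \<le> norm v * w a"
        using tpos[of n] by (simp add: pos_divide_le_eq mult_ac)
      then show ?thesis
        using tpos[of n] by (simp add: s_def divide_inverse mult.commute)
    qed
    have sl: "(\<lambda>n. s n a) \<longlonglongrightarrow> f' a v" for a
    proof -
      have nz: "t n *\<^sub>R v \<noteq> 0" for n using tpos[of n] False by simp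
      have "(\<lambda>n. norm (f (x0 + t n *\<^sub>R v) a - f x0 a - f' a (t n *\<^sub>R v)) / norm (t n *\<^sub>R v)) \<longlonglongrightarrow> 0"
        using nz tv by (rule seq)
      then have "(\<lambda>n. norm (f (x0 + t n *\<^sub>R v) a - f x0 a - f' a (t n *\<^sub>R v)) / norm (t n *\<^sub>R v) * norm v) \<longlonglongrightarrow> 0"
        by (rule tendsto_mult_left_zero)
      also have "(\<lambda>n. norm (f (x0 + t n *\<^sub>R v) a - f x0 a - f' a (t n *\<^sub>R v)) / norm (t n *\<^sub>R v) * norm v)
        = (\<lambda>n. norm (s n a - f' a v))"
      proof
        fix n
        have "s n a - f' a v = (f (x0 + t n *\<^sub>R v) a - f x0 a - f' a (t n *\<^sub>R v)) /\<^sub>R t n"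
          using tpos[of n] bl[of a]
          by (simp add: s_def linear_cmul bounded_linear.linear scaleR_diff_right)
        then show "norm (f (x0 + t n *\<^sub>R v) a - f x0 a - f' a (t n *\<^sub>R v)) / norm (t n *\<^sub>R v) * norm v
          = norm (s n a - f' a v)"
          using tpos[of n] False by (simp add: divide_inverse mult_ac)
      qed
      finally show ?thesis using LIM_zero_iff tendsto_norm_zero_iff by blast
    qed
    have "(\<lambda>a. s n a) \<in> borel_measurable M" for n
      unfolding s_def using int by (intro borel_measurable_scaleR borel_measurable_diff) auto
    then have "(\<lambda>a. f' a v) \<in> borel_measurable M"
      by (rule borel_measurable_LIMSEQ_metric) (rule sl)
    moreover have "norm (f' a v) \<le> norm v * w a" for a
      using Lim_bounded[OF tendsto_norm[OF sl[of a]], of 0] sb by blast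
    ultimately show ?thesis by blast
  qed
  have int': "integrable M (\<lambda>a. f' a v)" for v
  proof (rule Bochner_Integration.integrable_bound[of M "\<lambda>a. norm v * w a"])
    show "AE a in M. norm (f' a v) \<le> norm (norm v * w a)"
      using main[of v] by (intro AE_I2) (metis abs_ge_self order_trans real_norm_def)
  qed (use main w in auto)
  then show "integrable M (\<lambda>a. f' a v)" .
  show "((\<lambda>x. \<integral>a. f x a \<partial>M) has_derivative (\<lambda>v. \<integral>a. f' a v \<partial>M)) (at x0)"
    unfolding has_derivative_at
  proof
    show "bounded_linear (\<lambda>v. \<integral>a. f' a v \<partial>M)"
    proof (rule bounded_linear_intro[where K="\<integral>a. w a \<partial>M"])
      fix x y
      have "f' a (x + y) = f' a x + f' a y" for a
        using bl by (simp add: linear_add bounded_linear.linear)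
      then show "(\<integral>a. f' a (x + y) \<partial>M) = (\<integral>a. f' a x \<partial>M) + (\<integral>a. f' a y \<partial>M)"
        using int' by simp
    next
      fix r x
      have "f' a (r *\<^sub>R x) = r *\<^sub>R f' a x" for a
        using bl by (simp add: linear_cmul bounded_linear.linear)
      then show "(\<integral>a. f' a (r *\<^sub>R x) \<partial>M) = r *\<^sub>R (\<integral>a. f' a x \<partial>M)"
        by simp
    next
      fix x
      have "norm (\<integral>a. f' a x \<partial>M) \<le> (\<integral>a. norm (f' a x) \<partial>M)" by (rule integral_norm_bound)
      also have "\<dots> \<le> (\<integral>a. norm x * w a \<partial>M)"
        using main w int' by (intro integral_mono) auto
      finally show "norm (\<integral>a. f' a x \<partial>M) \<le> norm x * (\<integral>a. w a \<partial>M)" by simp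
    qed
    \<comment> \<open>The Frechet remainder divided by norm h. It is dominated by 2 w, one w for the
      increment and one for the derivative, so dominated convergence applies along every sequence
      tending to 0.\<close>
    define q where "q h a = (f (x0 + h) a - f x0 a - f' a h) /\<^sub>R norm h" for h a
    have "((\<lambda>h. \<integral>a. q h a \<partial>M) \<longlongrightarrow> 0) (at 0)"
      unfolding tendsto_at_iff_sequentially comp_def
    proof (intro allI impI)
      fix X :: "nat \<Rightarrow> 'x" assume X0: "\<forall>i. X i \<in> UNIV - {0}" and X: "X \<longlonglongrightarrow> 0"
      have "\<forall>\<^sub>F n in sequentially. dist (X n) 0 < 1"
        using X by (rule tendstoD) simp
      then obtain n0 where n0: "\<And>n. n \<ge> n0 \<Longrightarrow> norm (X n) \<le> 1"
        unfolding eventually_sequentially dist_0_norm dist_norm by (metis diff_zero less_imp_le)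
      \<comment> \<open>The bound \<open>lip\<close> holds only within distance 1, hence the first
        \<open>n0\<close> terms are skipped.\<close>
      have "(\<lambda>n. \<integral>a. q (X (n + n0)) a \<partial>M) \<longlonglongrightarrow> (\<integral>a. 0 \<partial>M)"
      proof (rule integral_dominated_convergence[where w="\<lambda>a. 2 * w a"])
        show "(\<lambda>a. 0) \<in> borel_measurable M" by simp
        show "(\<lambda>a. q (X (n + n0)) a) \<in> borel_measurable M" for n
          unfolding q_def using int main by (intro borel_measurable_scaleR borel_measurable_diff) auto
        show "integrable M (\<lambda>a. 2 * w a)" using w by simp
        show "AE a in M. (\<lambda>n. q (X (n + n0)) a) \<longlonglongrightarrow> 0"
        proof (intro AE_I2)
          fix a
          have "(\<lambda>n. norm (q (X n) a)) \<longlonglongrightarrow> 0"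
            using seq[OF _ X, of a] X0 by (simp add: q_def divide_inverse mult.commute)
          then show "(\<lambda>n. q (X (n + n0)) a) \<longlonglongrightarrow> 0"
            using LIMSEQ_ignore_initial_segment tendsto_norm_zero_iff by blast
        qed
        show "AE a in M. norm (q (X (n + n0)) a) \<le> 2 * w a" for n
        proof (intro AE_I2)
          fix a
          let ?h = "X (n + n0)"
          have h0: "norm ?h > 0" using X0 by simp
          have "norm (f (x0 + ?h) a - f x0 a - f' a ?h) \<le> norm ?h * w a + norm ?h * w a"
            using lip[of "x0 + ?h" a] n0[of "n + n0"] main[of ?h]
            by (intro order_trans[OF norm_triangle_ineq4[of "f (x0 + ?h) a - f x0 a"]] add_mono) auto
          then have "norm (f (x0 + ?h) a - f x0 a - f' a ?h) / norm ?h \<le> 2 * w a"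
            using h0 by (simp only: pos_divide_le_eq) (simp add: mult_ac)
          then show "norm (q ?h a) \<le> 2 * w a"
            using h0 by (simp add: q_def divide_inverse mult_ac)
        qed
      qed
      then show "(\<lambda>n. \<integral>a. q (X n) a \<partial>M) \<longlonglongrightarrow> 0"
        by (simp add: LIMSEQ_offset[of _ n0])
    qed
    then have "((\<lambda>h. norm (\<integral>a. q h a \<partial>M)) \<longlongrightarrow> 0) (at 0)"
      by (rule tendsto_norm_zero)
    moreover have "norm (\<integral>a. q h a \<partial>M) =
       norm ((\<integral>a. f (x0 + h) a \<partial>M) - (\<integral>a. f x0 a \<partial>M) - (\<integral>a. f' a h \<partial>M)) / norm h" for h
    proof -
      have "(\<integral>a. q h a \<partial>M) = (\<integral>a. f (x0 + h) a - f x0 a - f' a h \<partial>M) /\<^sub>R norm h"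
        unfolding q_def by (rule integral_scaleR_right)
      also have "(\<integral>a. f (x0 + h) a - f x0 a - f' a h \<partial>M) =
          (\<integral>a. f (x0 + h) a \<partial>M) - (\<integral>a. f x0 a \<partial>M) - (\<integral>a. f' a h \<partial>M)"
        using int int' by simp
      finally show ?thesis by (simp add: divide_inverse mult.commute)
    qed
    ultimately show "((\<lambda>h. norm ((\<integral>a. f (x0 + h) a \<partial>M) - (\<integral>a. f x0 a \<partial>M) - (\<integral>a. f' a h \<partial>M)) / norm h) \<longlongrightarrow> 0) (at 0)"
      by simp
  qed
qed

section \<open>Polynomials: derivatives and growth against a Gaussian\<close>

lemma real_polynomial_function_has_derivative:
  assumes "real_polynomial_function p"
  obtains p' where "\<And>v. real_polynomial_function (\<lambda>x. p' x v)" "\<And>x. (p has_derivative p' x) (at x)"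
proof -
  have "\<exists>p'. (\<forall>v. real_polynomial_function (\<lambda>x. p' x v)) \<and> (\<forall>x. (p has_derivative p' x) (at x))"
    using assms
  proof induction
    case (linear f)
    then show ?case
      by (intro exI[of _ "\<lambda>x. f"] conjI allI real_polynomial_function.intros(2) bounded_linear_imp_has_derivative)
  next
    case (const c)
    show ?case by (intro exI[of _ "\<lambda>x v. 0"] conjI allI real_polynomial_function.intros(2) has_derivative_const)
  next
    case (add f g)
    then obtain f' g' where
      "\<And>v. real_polynomial_function (\<lambda>x. f' x v)" "\<And>x. (f has_derivative f' x) (at x)"
      "\<And>v. real_polynomial_function (\<lambda>x. g' x v)" "\<And>x. (g has_derivative g' x) (at x)"
      by blast
    note d = this
    show ?case
    proof (intro exI[of _ "\<lambda>x v. f' x v + g' x v"] conjI allI)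
      show "real_polynomial_function (\<lambda>x. f' x v + g' x v)" for v
        by (intro real_polynomial_function.intros(3) d)
      show "((\<lambda>x. f x + g x) has_derivative (\<lambda>v. f' x v + g' x v)) (at x)" for x
        by (intro has_derivative_add d)
    qed
  next
    case (mult f g)
    then obtain f' g' where
      "\<And>v. real_polynomial_function (\<lambda>x. f' x v)" "\<And>x. (f has_derivative f' x) (at x)"
      "\<And>v. real_polynomial_function (\<lambda>x. g' x v)" "\<And>x. (g has_derivative g' x) (at x)"
      by blast
    note d = this
    show ?case
    proof (intro exI[of _ "\<lambda>x v. f x * g' x v + f' x v * g x"] conjI allI)
      show "real_polynomial_function (\<lambda>x. f x * g' x v + f' x v * g x)" for v
        by (intro real_polynomial_function.intros(3) real_polynomial_function.intros(4) mult.hyps d)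
      show "((\<lambda>x. f x * g x) has_derivative (\<lambda>v. f x * g' x v + f' x v * g x)) (at x)" for x
        by (intro has_derivative_mult d)
    qed
  qed
  then show ?thesis using that by blast
qed

text \<open>The rate \<open>b\<close> stays arbitrary in the induction, since a product spends b / 2
  on each factor.\<close>

lemma real_polynomial_function_bound:
  assumes "real_polynomial_function p" "b > 0"
  obtains C where "C \<ge> 0" "\<And>x. \<bar>p x\<bar> \<le> C * exp (b * (norm x)\<^sup>2)"
proof -
  have "\<exists>C\<ge>0. \<forall>x. \<bar>p x\<bar> \<le> C * exp (b * (norm x)\<^sup>2)"
    using assms
  proof (induction arbitrary: b)
    case (linear f)
    obtain K where K: "\<And>x. norm (f x) \<le> norm x * K" "K \<ge> 0"
      using bounded_linear.nonneg_bounded[OF linear(1)] by blast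
    \<comment> \<open>The constant comes from |x| \<le> 1 + |x|^2 \<le> (1 + 1/b) (1 + b |x|^2)
      together with 1 + t \<le> exp t.\<close>
    have "\<bar>f x\<bar> \<le> (K * (1 + 1 / b)) * exp (b * (norm x)\<^sup>2)" for x
    proof -
      have "2 * norm x \<le> (norm x)\<^sup>2 + 1"
        using sum_squares_bound[of "norm x" 1] by simp
      then have "norm x \<le> 1 + (norm x)\<^sup>2"
        using norm_ge_zero[of x] by linarith
      also have "\<dots> \<le> (1 + 1 / b) * (1 + b * (norm x)\<^sup>2)"
        using linear(2) by (simp add: field_simps)
      also have "\<dots> \<le> (1 + 1 / b) * exp (b * (norm x)\<^sup>2)"
        using linear(2) by (intro mult_left_mono exp_ge_add_one_self) auto
      finally have "norm x * K \<le> (1 + 1 / b) * exp (b * (norm x)\<^sup>2) * K"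
        using K(2) by (rule mult_right_mono)
      then show ?thesis using K(1)[of x] by (simp add: mult_ac)
    qed
    then show ?case using K(2) linear(2) by (intro exI[of _ "K * (1 + 1 / b)"]) auto
  next
    case (const c)
    then show ?case
      by (intro exI[of _ "\<bar>c\<bar>"]) (auto intro!: mult_left_mono[of 1 _ "\<bar>c\<bar>", simplified])
  next
    case (add f g)
    obtain C1 C2 where "C1 \<ge> 0" "C2 \<ge> 0" "\<And>x. \<bar>f x\<bar> \<le> C1 * exp (b * (norm x)\<^sup>2)"
        "\<And>x. \<bar>g x\<bar> \<le> C2 * exp (b * (norm x)\<^sup>2)"
      using add.IH(1)[OF add.prems] add.IH(2)[OF add.prems] by blast
    then show ?case
      by (intro exI[of _ "C1 + C2"])
        (auto simp: distrib_right intro!: order_trans[OF abs_triangle_ineq] add_mono)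
  next
    case (mult f g)
    have "b / 2 > 0" using mult.prems by simp
    then obtain C1 C2 where C: "C1 \<ge> 0" "C2 \<ge> 0" "\<And>x. \<bar>f x\<bar> \<le> C1 * exp (b / 2 * (norm x)\<^sup>2)"
        "\<And>x. \<bar>g x\<bar> \<le> C2 * exp (b / 2 * (norm x)\<^sup>2)"
      using mult.IH by blast
    have "\<bar>f x * g x\<bar> \<le> (C1 * C2) * exp (b * (norm x)\<^sup>2)" for x
    proof -
      have "\<bar>f x * g x\<bar> \<le> (C1 * exp (b / 2 * (norm x)\<^sup>2)) * (C2 * exp (b / 2 * (norm x)\<^sup>2))"
        unfolding abs_mult using C by (intro mult_mono) auto
      also have "\<dots> = (C1 * C2) * exp (b * (norm x)\<^sup>2)"
        by (simp add: mult_exp_exp flip: distrib_right)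
      finally show ?thesis .
    qed
    then show ?case using C by (intro exI[of _ "C1 * C2"]) auto
  qed
  then show ?thesis using that by blast
qed

section \<open>Gaussian kernels\<close>

lemma lborel_shift:
  fixes c :: "'a::euclidean_space" and f :: "'a \<Rightarrow> 'b::{banach, second_countable_topology}"
  assumes "f \<in> borel_measurable borel"
  shows "integrable lborel (\<lambda>x. f (c + x)) \<longleftrightarrow> integrable lborel f"
    and "(\<integral>x. f (c + x) \<partial>lborel) = (\<integral>x. f x \<partial>lborel)"
  using assms integrable_distr_eq[of "(+) c" lborel borel f] integral_distr[of "(+) c" lborel borel f]
  by (simp_all add: lborel_distr_plus)

lemma lborel_integrable_scale:
  fixes f :: "'a::euclidean_space \<Rightarrow> 'b::{banach, second_countable_topology}"
  assumes f: "integrable lborel f" and c: "c \<noteq> 0"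
  shows "integrable lborel (\<lambda>x. f (c *\<^sub>R x))"
proof -
  have [measurable]: "f \<in> borel_measurable borel"
    using borel_measurable_integrable[OF f] by simp
  have "integrable (density (distr lborel borel (\<lambda>x::'a. c *\<^sub>R x)) (\<lambda>_. ennreal (\<bar>c\<bar>^DIM('a)))) f"
    using f lborel_affine[OF c, of "0::'a"] by (simp add: ennreal_power)
  then have "integrable (distr lborel borel (\<lambda>x::'a. c *\<^sub>R x)) (\<lambda>x. \<bar>c\<bar>^DIM('a) *\<^sub>R f x)"
    by (subst (asm) integrable_density) auto
  then have "integrable lborel (\<lambda>x. \<bar>c\<bar>^DIM('a) *\<^sub>R f (c *\<^sub>R x))"
    by (simp add: integrable_distr_eq)
  then have "integrable lborel (\<lambda>x. inverse (\<bar>c\<bar>^DIM('a)) *\<^sub>R \<bar>c\<bar>^DIM('a) *\<^sub>R f (c *\<^sub>R x))"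
    by (rule integrable_scaleR_right)
  then show ?thesis
    using c by simp
qed

text \<open>The exponent carries no factor 1/2, as in the complex normal density; the real
  covariance is therefore half the inverse of \<open>A\<close>. \<open>total\<close> is an
  assumption so that the normalising constant need not be computed: it will come from the existence
  of Z.\<close>

locale gaussian_density =
  fixes A :: "'a::euclidean_space \<Rightarrow> 'a" and \<kappa> :: real
  assumes lin: "linear A"
    and symm: "A x \<bullet> y = x \<bullet> A y"
    and pos: "x \<noteq> 0 \<Longrightarrow> x \<bullet> A x > 0"
    and const_pos: "\<kappa> > 0"
    and total: "has_bochner_integral lborel (\<lambda>y. \<kappa> * exp (- (y \<bullet> A y))) 1"
begin

definition dens :: "'a \<Rightarrow> real" where
  "dens y = \<kappa> * exp (- (y \<bullet> A y))"

lemma bounded_linear_A: "bounded_linear A"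
  using lin linear_conv_bounded_linear by blast

lemma continuous_on_A [continuous_intros]: "continuous_on S g \<Longrightarrow> continuous_on S (\<lambda>x. A (g x))"
  using bounded_linear_A bounded_linear.continuous_on by blast

lemma dens_pos: "dens y > 0"
  using const_pos by (simp add: dens_def)

lemma continuous_on_dens: "continuous_on UNIV dens"
  unfolding dens_def by (intro continuous_intros)

lemma measurable_dens [measurable]: "dens \<in> borel_measurable borel"
  using continuous_on_dens by (rule borel_measurable_continuous_onI)

text \<open>The quadratic form attains a positive minimum on the compact unit sphere. The factor 2
  splits the decay: one half of it absorbs polynomial growth, the other half remains.\<close>

lemma coercive: "\<exists>a>0. \<forall>y. 2 * a * (norm y)\<^sup>2 \<le> y \<bullet> A y"
proof -
  obtain x where x: "x \<in> sphere 0 1" "\<And>y. y \<in> sphere 0 1 \<Longrightarrow> x \<bullet> A x \<le> y \<bullet> A y"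
  proof -
    have "continuous_on (sphere (0::'a) 1) (\<lambda>y. y \<bullet> A y)"
      by (intro continuous_intros)
    then show ?thesis
      using continuous_attains_inf[of "sphere (0::'a) 1" "\<lambda>y. y \<bullet> A y"] that by auto
  qed
  have "2 * (x \<bullet> A x / 2) * (norm y)\<^sup>2 \<le> y \<bullet> A y" for y
  proof (cases "y = 0")
    case False
    have "x \<bullet> A x \<le> sgn y \<bullet> A (sgn y)"
      using x(2)[of "sgn y"] False by (simp add: norm_sgn)
    also have "\<dots> = (y \<bullet> A y) / (norm y)\<^sup>2"
      using lin by (simp add: sgn_div_norm linear_cmul power2_eq_square divide_inverse)
    finally show ?thesis
      using False by (simp add: pos_le_divide_eq)
  qed simp
  moreover have "x \<bullet> A x / 2 > 0"
    using x(1) pos[of x] by fastforce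
  ultimately show ?thesis by blast
qed

lemma integrable_dens: "integrable lborel dens"
  using total unfolding dens_def[abs_def] has_bochner_integral_iff by blast

lemma integral_dens: "(\<integral>y. dens y \<partial>lborel) = 1"
  using total unfolding dens_def[abs_def] has_bochner_integral_iff by blast

text \<open>The only Gaussian known to be integrable is \<open>dens\<close>. It dominates the radial
  Gaussian of rate \<open>B\<close>, where \<open>B\<close> exceeds the norm of \<open>A\<close>,
  and rescaling the variable leads from the rate \<open>B\<close> to any rate
  \<open>b\<close>.\<close>

lemma integrable_exp_norm2:
  assumes b: "b > 0"
  shows "integrable lborel (\<lambda>y::'a. exp (- b * (norm y)\<^sup>2))"
proof -
  define B where "B = onorm A + 1"
  have B: "B > 0" using onorm_pos_le[OF bounded_linear_A] by (simp add: B_def)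
  have "y \<bullet> A y \<le> B * (norm y)\<^sup>2" for y
  proof -
    have "y \<bullet> A y \<le> norm y * norm (A y)" by (rule norm_cauchy_schwarz)
    also have "\<dots> \<le> norm y * (onorm A * norm y)"
      by (intro mult_left_mono onorm bounded_linear_A) simp
    also have "\<dots> \<le> B * (norm y)\<^sup>2" by (simp add: B_def power2_eq_square algebra_simps)
    finally show ?thesis .
  qed
  then have le: "exp (- B * (norm y)\<^sup>2) \<le> dens y / \<kappa>" for y
    using const_pos by (simp add: dens_def)
  have "integrable lborel (\<lambda>y::'a. exp (- B * (norm y)\<^sup>2))"
  proof (rule Bochner_Integration.integrable_bound)
    show "integrable lborel (\<lambda>y. dens y / \<kappa>)" using integrable_dens by simp
    show "AE y in lborel. norm (exp (- B * (norm (y::'a))\<^sup>2)) \<le> norm (dens y / \<kappa>)"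
      using le dens_pos const_pos by (intro AE_I2) (simp add: less_imp_le)
  qed simp
  then have "integrable lborel (\<lambda>y::'a. exp (- B * (norm (sqrt (b / B) *\<^sub>R y))\<^sup>2))"
    using b B by (intro lborel_integrable_scale[of "\<lambda>y::'a. exp (- B * (norm y)\<^sup>2)"]) auto
  moreover have "B * (norm (sqrt (b / B) *\<^sub>R y))\<^sup>2 = b * (norm y)\<^sup>2" for y :: 'a
    using b B by (simp add: power_mult_distrib)
  ultimately show ?thesis by (simp only: mult_minus_left)
qed

text \<open>A single rate \<open>a\<close> serves all polynomials, so the kernels for all basis
  directions can be bounded by the same Gaussian in \<open>conv_has_derivative\<close>.\<close>

lemma polynomial_dens_bound:
  "\<exists>a>0. \<forall>p. real_polynomial_function p \<longrightarrow>
     (\<exists>C\<ge>0. \<forall>y. \<bar>p y * dens y\<bar> \<le> C * exp (- a * (norm y)\<^sup>2))"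
proof -
  obtain a where a: "a > 0" "\<And>y. 2 * a * (norm y)\<^sup>2 \<le> y \<bullet> A y" using coercive by metis
  have "\<exists>C\<ge>0. \<forall>y. \<bar>p y * dens y\<bar> \<le> C * exp (- a * (norm y)\<^sup>2)" if p: "real_polynomial_function p" for p
  proof -
    obtain C where C: "C \<ge> 0" "\<And>x. \<bar>p x\<bar> \<le> C * exp (a * (norm x)\<^sup>2)"
      using real_polynomial_function_bound[OF p a(1)] by blast
    have "\<bar>p y * dens y\<bar> \<le> (C * \<kappa>) * exp (- a * (norm y)\<^sup>2)" for y
    proof -
      have "dens y \<le> \<kappa> * exp (- (2 * a * (norm y)\<^sup>2))"
        using a(2)[of y] const_pos by (simp add: dens_def)
      then have "\<bar>p y * dens y\<bar> \<le> (C * exp (a * (norm y)\<^sup>2)) * (\<kappa> * exp (- (2 * a * (norm y)\<^sup>2)))"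
        unfolding abs_mult using C dens_pos[of y] by (intro mult_mono) auto
      also have "\<dots> = (C * \<kappa>) * exp (- a * (norm y)\<^sup>2)"
        by (simp add: mult_exp_exp)
      finally show ?thesis .
    qed
    then show ?thesis using C(1) const_pos by (intro exI[of _ "C * \<kappa>"]) auto
  qed
  with a(1) show ?thesis by blast
qed

lemma measurable_polynomial:
  "real_polynomial_function p \<Longrightarrow> p \<in> borel_measurable borel" for p :: "'a \<Rightarrow> real"
  by (intro borel_measurable_continuous_onI)
    (simp add: continuous_on_polymonial_function real_polynomial_function_eq)

lemma integrable_polynomial_dens:
  assumes p: "real_polynomial_function p"
  shows "integrable lborel (\<lambda>y. p y * dens y)"
proof -
  obtain a C where a: "a > 0" and C: "C \<ge> 0" "\<And>y. \<bar>p y * dens y\<bar> \<le> C * exp (- a * (norm y)\<^sup>2)"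
    using polynomial_dens_bound p by metis
  show ?thesis
  proof (rule Bochner_Integration.integrable_bound)
    show "integrable lborel (\<lambda>y. C * exp (- a * (norm (y::'a))\<^sup>2))"
      using integrable_exp_norm2[OF a] by simp
    show "AE y in lborel. norm (p y * dens y) \<le> norm (C * exp (- a * (norm y)\<^sup>2))"
      using C by (intro AE_I2) simp
  qed (use measurable_polynomial[OF p] in measurable)
qed

lemma has_derivative_dens:
  "(dens has_derivative (\<lambda>v. - 2 * (y \<bullet> A v) * dens y)) (at y)"
proof -
  have "(A has_derivative A) (at y)"
    by (rule bounded_linear_imp_has_derivative[OF bounded_linear_A])
  then have q: "((\<lambda>y. y \<bullet> A y) has_derivative (\<lambda>v. y \<bullet> A v + v \<bullet> A y)) (at y)"
    by (intro has_derivative_inner has_derivative_ident)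
  have "((\<lambda>t. \<kappa> * exp (- t)) has_real_derivative (- dens y)) (at (y \<bullet> A y))"
    by (auto intro!: derivative_eq_intros simp: dens_def)
  from DERIV_compose_FDERIV[OF this q]
  have "(dens has_derivative (\<lambda>v. (y \<bullet> A v + v \<bullet> A y) * - dens y)) (at y)"
    unfolding dens_def[abs_def] .
  moreover have "v \<bullet> A y = y \<bullet> A v" for v by (metis inner_commute symm)
  ultimately have "(dens has_derivative (\<lambda>v. (y \<bullet> A v + y \<bullet> A v) * - dens y)) (at y)"
    by simp
  then show ?thesis by (rule has_derivative_eq_rhs) (simp add: fun_eq_iff)
qed

section \<open>Convolution with polynomial Gaussian kernels\<close>

lemma polynomial_dens_deriv:
  assumes p: "\<And>y. (p has_derivative p' y) (at y)"
  shows "((\<lambda>y. p y * dens y) has_derivative (\<lambda>v. (p' y v - 2 * p y * (y \<bullet> A v)) * dens y)) (at y)"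
  using has_derivative_mult[OF p[of y] has_derivative_dens[of y]]
  by (rule has_derivative_eq_rhs) (simp add: fun_eq_iff algebra_simps)

lemma linear_polynomial: "real_polynomial_function (\<lambda>y. y \<bullet> v)"
  by (intro real_polynomial_function.intros(1) bounded_linear_inner_left)

lemma polynomial_dens_deriv_polynomial:
  assumes "real_polynomial_function p" "\<And>v. real_polynomial_function (\<lambda>y. p' y v)"
  shows "real_polynomial_function (\<lambda>y. p' y v - 2 * p y * (y \<bullet> A v))"
  by (intro real_polynomial_function_diff real_polynomial_function.intros(2-4) linear_polynomial assms)

text \<open>All derivatives of this convolution fall on the kernel, so that \<open>\<phi>\<close> need only be bounded and
  measurable. The kernels, polynomials times \<open>dens\<close>, are closed under differentiation.\<close>

definition conv :: "('a \<Rightarrow> 'b::{banach, second_countable_topology}) \<Rightarrow> real \<Rightarrow> ('a \<Rightarrow> real) \<Rightarrow> 'a \<Rightarrow> 'b" where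
  "conv \<phi> r p x = (\<integral>y. (p (y - r *\<^sub>R x) * dens (y - r *\<^sub>R x)) *\<^sub>R \<phi> y \<partial>lborel)"

lemma integrable_shifted_kernel:
  fixes \<phi> :: "'a \<Rightarrow> 'b::{banach, second_countable_topology}"
  assumes \<phi>[measurable]: "\<phi> \<in> borel_measurable borel" and B: "\<And>y. norm (\<phi> y) \<le> B"
    and p: "real_polynomial_function p"
  shows "integrable lborel (\<lambda>y. (p (y - z) * dens (y - z)) *\<^sub>R \<phi> y)"
proof (rule Bochner_Integration.integrable_bound)
  have [measurable]: "p \<in> borel_measurable borel"
    using p by (rule measurable_polynomial)
  show "(\<lambda>y. (p (y - z) * dens (y - z)) *\<^sub>R \<phi> y) \<in> borel_measurable lborel" by measurable
  have "integrable lborel (\<lambda>y. p (- z + y) * dens (- z + y))"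
    using integrable_polynomial_dens[OF p] by (subst lborel_shift(1)) auto
  then show "integrable lborel (\<lambda>y. B * (p (y - z) * dens (y - z)))" by simp
  show "AE y in lborel. norm ((p (y - z) * dens (y - z)) *\<^sub>R \<phi> y) \<le> norm (B * (p (y - z) * dens (y - z)))"
  proof (intro AE_I2)
    fix y
    have "norm (\<phi> y) \<le> \<bar>B\<bar>" using B[of y] by simp
    from mult_left_mono[OF this, of "\<bar>p (y - z) * dens (y - z)\<bar>"]
    show "norm ((p (y - z) * dens (y - z)) *\<^sub>R \<phi> y) \<le> norm (B * (p (y - z) * dens (y - z)))"
      by (simp add: abs_mult mult_ac)
  qed
qed

text \<open>Translation by r x. With x in the kernel the integral can be differentiated for rough
  \<phi>; with x in the argument of \<phi> it is an average over the Gaussian variable.\<close>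

lemma conv_eq:
  fixes \<phi> :: "'a \<Rightarrow> 'b::{banach, second_countable_topology}"
  assumes [measurable]: "\<phi> \<in> borel_measurable borel" and p: "real_polynomial_function p"
  shows "conv \<phi> r p x = (\<integral>y. (p y * dens y) *\<^sub>R \<phi> (r *\<^sub>R x + y) \<partial>lborel)"
proof -
  have [measurable]: "p \<in> borel_measurable borel"
    using p by (rule measurable_polynomial)
  show ?thesis
    unfolding conv_def
    by (subst lborel_shift(2)[symmetric, where c="r *\<^sub>R x"]) auto
qed

lemma conv_bounded:
  fixes \<phi> :: "'a \<Rightarrow> 'b::{banach, second_countable_topology}"
  assumes \<phi>[measurable]: "\<phi> \<in> borel_measurable borel" and B: "\<And>y. norm (\<phi> y) \<le> B"
    and p: "real_polynomial_function p"
  shows "bounded (range (conv \<phi> r p))"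
proof -
  have "norm (conv \<phi> r p x) \<le> (\<integral>y. B * \<bar>p y * dens y\<bar> \<partial>lborel)" for x
  proof -
    have "norm (conv \<phi> r p x) \<le> (\<integral>y. norm ((p y * dens y) *\<^sub>R \<phi> (r *\<^sub>R x + y)) \<partial>lborel)"
      unfolding conv_eq[OF \<phi> p] by (rule integral_norm_bound)
    also have "\<dots> \<le> (\<integral>y. B * \<bar>p y * dens y\<bar> \<partial>lborel)"
    proof (rule integral_mono')
      show "integrable lborel (\<lambda>y. B * \<bar>p y * dens y\<bar>)"
        using integrable_polynomial_dens[OF p] by simp
      show "norm ((p y * dens y) *\<^sub>R \<phi> (r *\<^sub>R x + y)) \<le> B * \<bar>p y * dens y\<bar>" for y
        using mult_left_mono[OF B[of "r *\<^sub>R x + y"], of "\<bar>p y * dens y\<bar>"] by (simp add: mult_ac)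
      show "0 \<le> B * \<bar>p y * dens y\<bar>" for y
        using order_trans[OF norm_ge_zero B] by simp
    qed
    finally show ?thesis .
  qed
  then show ?thesis by (auto simp: bounded_iff)
qed

text \<open>The domination comes from the mean value inequality for the kernel, whose derivative has
  a Gaussian bound uniform over unit perturbations of x. The factor - r is the inner derivative of y
  - r x.\<close>

lemma conv_has_derivative:
  fixes \<phi> :: "'a \<Rightarrow> 'b::{banach, second_countable_topology}"
  assumes \<phi>[measurable]: "\<phi> \<in> borel_measurable borel" and B: "\<And>y. norm (\<phi> y) \<le> B"
    and p: "real_polynomial_function p"
    and q: "\<And>v. real_polynomial_function (\<lambda>y. q y v)"
    and der: "\<And>y. ((\<lambda>y. p y * dens y) has_derivative (\<lambda>v. q y v * dens y)) (at y)"
  shows "(conv \<phi> r p has_derivative (\<lambda>v. conv \<phi> r (\<lambda>y. - r * q y v) x)) (at x)"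
proof -
  have lin_q: "linear (\<lambda>v. q y v * dens y)" for y
    using der[of y] has_derivative_linear by blast
  obtain a where a: "a > 0"
    "\<And>p. real_polynomial_function p \<Longrightarrow> \<exists>C\<ge>0. \<forall>y. \<bar>p y * dens y\<bar> \<le> C * exp (- a * (norm y)\<^sup>2)"
    using polynomial_dens_bound by metis
  have "\<forall>b. \<exists>C\<ge>0. \<forall>y. \<bar>q y b * dens y\<bar> \<le> C * exp (- a * (norm y)\<^sup>2)"
    using a(2)[OF q] by blast
  then obtain C where C: "\<And>b. C b \<ge> 0" "\<And>b y. \<bar>q y b * dens y\<bar> \<le> C b * exp (- a * (norm y)\<^sup>2)"
    by metis
  define K where "K = (\<Sum>b\<in>Basis. C b)"
  have K0: "K \<ge> 0" using C(1) by (simp add: K_def sum_nonneg)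
  have q_bound: "norm (q y v * dens y) \<le> K * exp (- a * (norm y)\<^sup>2) * norm v" for y v
  proof -
    have "q y v * dens y = (\<lambda>v. q y v * dens y) (\<Sum>b\<in>Basis. (v \<bullet> b) *\<^sub>R b)"
      by (simp add: euclidean_representation)
    also have "\<dots> = (\<Sum>b\<in>Basis. (v \<bullet> b) *\<^sub>R (q y b * dens y))"
      by (subst linear_sum[OF lin_q]) (simp add: linear_cmul[OF lin_q])
    finally have "norm (q y v * dens y) \<le> (\<Sum>b\<in>Basis. norm ((v \<bullet> b) *\<^sub>R (q y b * dens y)))"
      using norm_sum by metis
    also have "\<dots> \<le> (\<Sum>b\<in>Basis. norm v * (C b * exp (- a * (norm y)\<^sup>2)))"
    proof (rule sum_mono)
      fix b :: 'a assume b: "b \<in> Basis"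
      have "\<bar>v \<bullet> b\<bar> * \<bar>q y b * dens y\<bar> \<le> norm v * (C b * exp (- a * (norm y)\<^sup>2))"
        using Basis_le_norm[OF b, of v] C by (intro mult_mono) auto
      then show "norm ((v \<bullet> b) *\<^sub>R (q y b * dens y)) \<le> norm v * (C b * exp (- a * (norm y)\<^sup>2))"
        by (simp add: abs_mult)
    qed
    finally show ?thesis
      by (simp add: K_def sum_distrib_left sum_distrib_right mult_ac)
  qed
  define w where "w y = \<bar>r\<bar> * B * K * exp (a * r\<^sup>2) * exp (- (a / 2) * (norm (- (r *\<^sub>R x) + y))\<^sup>2)" for y
  have B0: "B \<ge> 0" using order_trans[OF norm_ge_zero B] by blast
  have kernel_lip: "\<bar>p (y - r *\<^sub>R u) * dens (y - r *\<^sub>R u) - p (y - r *\<^sub>R x) * dens (y - r *\<^sub>R x)\<bar>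
      \<le> (K * exp (a * r\<^sup>2) * exp (- (a / 2) * (norm (y - r *\<^sub>R x))\<^sup>2)) * (\<bar>r\<bar> * norm (u - x))"
    if u: "norm (u - x) \<le> 1" for u y
  proof -
    \<comment> \<open>While |u - x| \<le> 1, the point y - r u stays in this ball.\<close>
    let ?S = "cball (y - r *\<^sub>R x) \<bar>r\<bar>"
    have "norm (p (y - r *\<^sub>R u) * dens (y - r *\<^sub>R u) - p (y - r *\<^sub>R x) * dens (y - r *\<^sub>R x))
      \<le> (K * exp (a * r\<^sup>2) * exp (- (a / 2) * (norm (y - r *\<^sub>R x))\<^sup>2)) * norm ((y - r *\<^sub>R u) - (y - r *\<^sub>R x))"
    proof (rule differentiable_bound[where S="?S" and f'="\<lambda>y v. q y v * dens y"])
      show "convex ?S" by simp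
      show "((\<lambda>y. p y * dens y) has_derivative (\<lambda>v. q z v * dens z)) (at z within ?S)" for z
        using der by (rule has_derivative_at_withinI)
      show "y - r *\<^sub>R x \<in> ?S" by simp
      have "dist (y - r *\<^sub>R x) (y - r *\<^sub>R u) = \<bar>r\<bar> * norm (u - x)"
        by (simp add: dist_norm flip: scaleR_diff_right)
      also have "\<dots> \<le> \<bar>r\<bar>" using u by (simp add: mult_left_le)
      finally show "y - r *\<^sub>R u \<in> ?S" by simp
      \<comment> \<open>Since |y - r x|^2 \<le> 2 |z|^2 + 2 r^2 on the ball, the Gaussian at z is
        controlled by the one at the centre with half the rate, at the price of exp (a r^2).\<close>
      fix z assume z: "z \<in> ?S"
      have "norm (y - r *\<^sub>R x) \<le> norm z + \<bar>r\<bar>"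
        using z norm_triangle_ineq2[of "y - r *\<^sub>R x" z] by (simp add: dist_norm)
      then have "(norm (y - r *\<^sub>R x))\<^sup>2 \<le> (norm z + \<bar>r\<bar>)\<^sup>2"
        by (intro power_mono) auto
      also have "\<dots> \<le> 2 * (norm z)\<^sup>2 + 2 * r\<^sup>2"
        using sum_squares_bound[of "norm z" "\<bar>r\<bar>"] by (simp add: power2_sum)
      finally have "a * (norm (y - r *\<^sub>R x))\<^sup>2 \<le> a * (2 * (norm z)\<^sup>2 + 2 * r\<^sup>2)"
        using a(1) by (intro mult_left_mono) auto
      then have "- a * (norm z)\<^sup>2 \<le> a * r\<^sup>2 + - (a / 2) * (norm (y - r *\<^sub>R x))\<^sup>2"
        by (simp add: algebra_simps)
      then have "exp (- a * (norm z)\<^sup>2) \<le> exp (a * r\<^sup>2) * exp (- (a / 2) * (norm (y - r *\<^sub>R x))\<^sup>2)"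
        unfolding mult_exp_exp exp_le_cancel_iff .
      then have le: "K * exp (- a * (norm z)\<^sup>2) \<le> K * exp (a * r\<^sup>2) * exp (- (a / 2) * (norm (y - r *\<^sub>R x))\<^sup>2)"
        using K0 by (simp only: mult.assoc mult_left_mono)
      have "onorm (\<lambda>v. q z v * dens z) \<le> K * exp (- a * (norm z)\<^sup>2)"
        using q_bound by (intro onorm_le)
      with le show "onorm (\<lambda>v. q z v * dens z) \<le> K * exp (a * r\<^sup>2) * exp (- (a / 2) * (norm (y - r *\<^sub>R x))\<^sup>2)"
        by simp
    qed
    also have "norm ((y - r *\<^sub>R u) - (y - r *\<^sub>R x)) = \<bar>r\<bar> * norm (u - x)"
      by (simp add: norm_minus_commute flip: scaleR_diff_right)
    finally show ?thesis by simp
  qed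
  have "((\<lambda>x. \<integral>y. (p (y - r *\<^sub>R x) * dens (y - r *\<^sub>R x)) *\<^sub>R \<phi> y \<partial>lborel) has_derivative
     (\<lambda>v. \<integral>y. (q (y - r *\<^sub>R x) (- (r *\<^sub>R v)) * dens (y - r *\<^sub>R x)) *\<^sub>R \<phi> y \<partial>lborel)) (at x)"
  proof (rule has_derivative_integral_dominated(2))
    show "integrable lborel (\<lambda>y. (p (y - r *\<^sub>R u) * dens (y - r *\<^sub>R u)) *\<^sub>R \<phi> y)" for u
      by (rule integrable_shifted_kernel[OF \<phi> B p])
    show "((\<lambda>x. (p (y - r *\<^sub>R x) * dens (y - r *\<^sub>R x)) *\<^sub>R \<phi> y) has_derivative
        (\<lambda>v. (q (y - r *\<^sub>R x) (- (r *\<^sub>R v)) * dens (y - r *\<^sub>R x)) *\<^sub>R \<phi> y)) (at x)" for y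
    proof -
      have "((\<lambda>x. y - r *\<^sub>R x) has_derivative (\<lambda>v. - (r *\<^sub>R v))) (at x)"
        by (auto intro!: derivative_eq_intros)
      from has_derivative_compose[OF this der]
      show ?thesis by (intro has_derivative_scaleR_left) simp
    qed
    have "integrable lborel (\<lambda>y. exp (- (a / 2) * (norm (- (r *\<^sub>R x) + y))\<^sup>2))"
      using integrable_exp_norm2[of "a / 2"] a(1)
      by (subst lborel_shift(1)[where f="\<lambda>y. exp (- (a / 2) * (norm y)\<^sup>2)"]) auto
    then show "integrable lborel w"
      unfolding w_def by (rule integrable_mult_right)
    fix u y assume u: "norm (u - x) \<le> 1"
    have "norm ((p (y - r *\<^sub>R u) * dens (y - r *\<^sub>R u)) *\<^sub>R \<phi> y - (p (y - r *\<^sub>R x) * dens (y - r *\<^sub>R x)) *\<^sub>R \<phi> y)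
      = \<bar>p (y - r *\<^sub>R u) * dens (y - r *\<^sub>R u) - p (y - r *\<^sub>R x) * dens (y - r *\<^sub>R x)\<bar> * norm (\<phi> y)"
      by (simp flip: scaleR_diff_left)
    also have "\<dots> \<le> ((K * exp (a * r\<^sup>2) * exp (- (a / 2) * (norm (y - r *\<^sub>R x))\<^sup>2)) * (\<bar>r\<bar> * norm (u - x))) * B"
      using kernel_lip[OF u, of y] B[of y] K0 by (intro mult_mono) auto
    also have "\<dots> = norm (u - x) * w y"
      by (simp add: w_def mult_ac)
    finally show "norm ((p (y - r *\<^sub>R u) * dens (y - r *\<^sub>R u)) *\<^sub>R \<phi> y - (p (y - r *\<^sub>R x) * dens (y - r *\<^sub>R x)) *\<^sub>R \<phi> y)
      \<le> norm (u - x) * w y" .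
  qed
  \<comment> \<open>Linearity in the direction is available for q times \<open>dens\<close>, so the
    factor - r is extracted from this product.\<close>
  moreover have "q y (- (r *\<^sub>R v)) * dens y = - r * q y v * dens y" for y v
    using linear_cmul[OF lin_q[of y], of "- r" v] by simp
  ultimately show ?thesis
    unfolding conv_def[abs_def] by simp
qed

text \<open>The explicit new kernel is forgotten; that it is again polynomial is what lets
  differentiation be iterated.\<close>

lemma conv_kernel_derivative:
  fixes \<phi> :: "'a \<Rightarrow> 'b::{banach, second_countable_topology}"
  assumes \<phi>: "\<phi> \<in> borel_measurable borel" "bounded (range \<phi>)"
    and p: "real_polynomial_function p"
  shows "\<exists>q. (\<forall>v. real_polynomial_function (q v)) \<and>
    (\<forall>x. (conv \<phi> r p has_derivative (\<lambda>v. conv \<phi> r (q v) x)) (at x))"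
proof -
  obtain B where B: "\<And>y. norm (\<phi> y) \<le> B"
    using \<phi>(2) by (auto simp: bounded_iff)
  obtain p' where p': "\<And>v. real_polynomial_function (\<lambda>y. p' y v)" "\<And>y. (p has_derivative p' y) (at y)"
    using real_polynomial_function_has_derivative[OF p] by metis
  define q where "q y v = p' y v - 2 * p y * (y \<bullet> A v)" for y v
  have q: "real_polynomial_function (\<lambda>y. q y v)" for v
    unfolding q_def using p p'(1) by (rule polynomial_dens_deriv_polynomial)
  have "((\<lambda>y. p y * dens y) has_derivative (\<lambda>v. q y v * dens y)) (at y)" for y
    unfolding q_def using p'(2) by (rule polynomial_dens_deriv)
  from conv_has_derivative[OF \<phi>(1) B p q this]
  have "\<forall>x. (conv \<phi> r p has_derivative (\<lambda>v. conv \<phi> r (\<lambda>y. - r * q y v) x)) (at x)" by blast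
  moreover have "real_polynomial_function (\<lambda>y. - r * q y v)" for v
    by (intro real_polynomial_function.intros(2,4) q)
  ultimately show ?thesis by (intro exI[of _ "\<lambda>v y. - r * q y v"]) simp
qed

lemma continuous_on_conv:
  fixes \<phi> :: "'a \<Rightarrow> 'b::{banach, second_countable_topology}"
  assumes "\<phi> \<in> borel_measurable borel" "bounded (range \<phi>)" "real_polynomial_function p"
  shows "continuous_on UNIV (conv \<phi> r p)"
  using conv_kernel_derivative[OF assms, of r] has_derivative_continuous
  by (metis continuous_at_imp_continuous_on)

section \<open>The Gaussian measure and its moments\<close>

definition gauss :: "'a measure" where
  "gauss = density lborel (\<lambda>y. ennreal (dens y))"

lemma sets_gauss [measurable_cong, simp]: "sets gauss = sets borel"
  by (simp add: gauss_def)

lemma space_gauss [simp]: "space gauss = UNIV"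
  by (simp add: gauss_def)

lemma borel_measurable_gauss [simp]: "borel_measurable gauss = borel_measurable borel"
  by (simp add: measurable_def)

lemma integral_gauss:
  fixes \<phi> :: "'a \<Rightarrow> 'b::{banach, second_countable_topology}"
  assumes [measurable]: "\<phi> \<in> borel_measurable borel"
  shows "(\<integral>y. \<phi> y \<partial>gauss) = (\<integral>y. dens y *\<^sub>R \<phi> y \<partial>lborel)"
  unfolding gauss_def using dens_pos by (intro integral_density) (auto simp: less_imp_le)

lemma integrable_gauss:
  fixes \<phi> :: "'a \<Rightarrow> 'b::{banach, second_countable_topology}"
  assumes [measurable]: "\<phi> \<in> borel_measurable borel"
  shows "integrable gauss \<phi> \<longleftrightarrow> integrable lborel (\<lambda>y. dens y *\<^sub>R \<phi> y)"
  unfolding gauss_def using dens_pos by (intro integrable_density) (auto simp: less_imp_le)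

lemma prob_space_gauss: "prob_space gauss"
proof
  have "emeasure gauss (space gauss) = (\<integral>\<^sup>+y. ennreal (dens y) \<partial>lborel)"
    by (simp add: gauss_def emeasure_density)
  also have "\<dots> = ennreal (\<integral>y. dens y \<partial>lborel)"
    using dens_pos by (intro nn_integral_eq_integral integrable_dens AE_I2) (simp add: less_imp_le)
  finally show "emeasure gauss (space gauss) = 1" by (simp add: integral_dens)
qed

lemma integrable_gauss_polynomial: "real_polynomial_function p \<Longrightarrow> integrable gauss p"
  using integrable_polynomial_dens measurable_polynomial
  by (subst integrable_gauss) (auto simp: mult.commute)

lemma integrable_gauss_inner: "integrable gauss (\<lambda>y. y \<bullet> v)"
  by (intro integrable_gauss_polynomial linear_polynomial)

lemma integrable_gauss_inner_power2: "integrable gauss (\<lambda>y. (y \<bullet> v)\<^sup>2)"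
  unfolding power2_eq_square
  by (intro integrable_gauss_polynomial real_polynomial_function.intros(4) linear_polynomial)

lemma integrable_gauss_norm: "integrable gauss (\<lambda>y. norm y)"
proof (rule Bochner_Integration.integrable_bound)
  show "integrable gauss (\<lambda>y. \<Sum>b\<in>Basis. \<bar>y \<bullet> b\<bar>)"
    using integrable_gauss_inner by auto
  show "AE y in gauss. norm (norm y) \<le> norm (\<Sum>b\<in>Basis. \<bar>y \<bullet> b\<bar>)"
    using norm_le_l1 by (intro AE_I2) (auto intro: order_trans)
qed simp

text \<open>Translation invariance replaces integration by parts: the Lebesgue integral of (y
  \<bullet> A v) \<open>dens y\<close> does not change when the kernel is shifted, so its derivative
  in direction v vanishes. Up to sign, this derivative is the integral of v \<bullet> A v - 2 (y
  \<bullet> A v)^2 against \<open>dens\<close>.\<close>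

lemma integral_gauss_inner_power2: "(\<integral>y. (y \<bullet> A v)\<^sup>2 \<partial>gauss) = (v \<bullet> A v) / 2"
proof -
  let ?p = "\<lambda>y. y \<bullet> A v" and ?q = "\<lambda>y w. w \<bullet> A v - 2 * (y \<bullet> A v) * (y \<bullet> A w)"
  have p: "real_polynomial_function ?p" by (rule linear_polynomial)
  have q: "real_polynomial_function (\<lambda>y. ?q y w)" for w
    using p real_polynomial_function.intros(2) by (rule polynomial_dens_deriv_polynomial)
  have "(?p has_derivative (\<lambda>w. w \<bullet> A v)) (at y)" for y
    by (intro bounded_linear_imp_has_derivative bounded_linear_inner_left)
  from polynomial_dens_deriv[OF this]
  have der: "(conv (\<lambda>_. 1::real) 1 ?p has_derivative (\<lambda>w. conv (\<lambda>_. 1) 1 (\<lambda>y. - 1 * ?q y w) 0)) (at 0)"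
    using p q by (intro conv_has_derivative[where B=1]) auto
  have "conv (\<lambda>_. 1::real) 1 ?p = (\<lambda>_. \<integral>y. ?p y * dens y \<partial>lborel)"
    using p by (intro ext) (simp add: conv_eq)
  then have "(conv (\<lambda>_. 1::real) 1 ?p has_derivative (\<lambda>w. 0)) (at 0)"
    by (simp only: has_derivative_const)
  from fun_cong[OF has_derivative_unique[OF der this], of v]
  have "conv (\<lambda>_. 1::real) 1 (\<lambda>y. - 1 * ?q y v) 0 = 0" .
  moreover have "real_polynomial_function (\<lambda>y. - 1 * ?q y v)"
    by (intro real_polynomial_function.intros(2,4) q)
  ultimately have "(\<integral>y. (2 * (y \<bullet> A v)\<^sup>2 - v \<bullet> A v) * dens y \<partial>lborel) = 0"
    by (simp add: conv_eq power2_eq_square mult.assoc)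
  then have "(\<integral>y. 2 * (y \<bullet> A v)\<^sup>2 - v \<bullet> A v \<partial>gauss) = 0"
    by (subst integral_gauss) (auto simp: mult.commute)
  moreover have "(\<integral>y. 2 * (y \<bullet> A v)\<^sup>2 - v \<bullet> A v \<partial>gauss) = 2 * (\<integral>y. (y \<bullet> A v)\<^sup>2 \<partial>gauss) - v \<bullet> A v"
  proof -
    interpret prob_space gauss by (rule prob_space_gauss)
    show ?thesis
      using integrable_gauss_inner_power2[of "A v"] prob_space by simp
  qed
  ultimately show ?thesis by simp
qed

text \<open>As c x + s z = s ((c / s) x + z), the scale s can be absorbed into \<phi>. This is why
  the interpolation needs sin \<theta> \<noteq> 0: for s = 0 nothing is smoothed.\<close>

lemma mean_eq_conv:
  fixes \<phi> :: "'a \<Rightarrow> 'b::{banach, second_countable_topology}"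
  assumes [measurable]: "\<phi> \<in> borel_measurable borel" and s: "s \<noteq> 0"
  shows "(\<lambda>x. \<integral>z. \<phi> (c *\<^sub>R x + s *\<^sub>R z) \<partial>gauss) = conv (\<lambda>w. \<phi> (s *\<^sub>R w)) (c / s) (\<lambda>_. 1)"
proof
  fix x
  show "(\<integral>z. \<phi> (c *\<^sub>R x + s *\<^sub>R z) \<partial>gauss) = conv (\<lambda>w. \<phi> (s *\<^sub>R w)) (c / s) (\<lambda>_. 1) x"
    using s by (subst conv_eq)
      (auto simp: integral_gauss scaleR_add_right intro: real_polynomial_function.intros)
qed

text \<open>Minus the logarithmic gradient of \<open>dens\<close> at z is 2 A z, and c / s is the
  shift ratio of the convolution; no derivative of \<phi> appears.\<close>

lemma mean_has_derivative:
  fixes \<phi> :: "'a \<Rightarrow> 'b::{banach, second_countable_topology}"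
  assumes [measurable]: "\<phi> \<in> borel_measurable borel" and B: "\<And>y. norm (\<phi> y) \<le> B" and s: "s \<noteq> 0"
  shows "((\<lambda>x. \<integral>z. \<phi> (c *\<^sub>R x + s *\<^sub>R z) \<partial>gauss) has_derivative
    (\<lambda>v. \<integral>z. (2 * c / s * (A z \<bullet> v)) *\<^sub>R \<phi> (c *\<^sub>R x + s *\<^sub>R z) \<partial>gauss)) (at x)"
proof -
  \<comment> \<open>Left unsimplified to match \<open>polynomial_dens_deriv\<close> for the constant
    polynomial 1 with derivative 0.\<close>
  let ?q = "\<lambda>y v. 0 - 2 * 1 * (y \<bullet> A v)"
  have q: "real_polynomial_function (\<lambda>y. ?q y w)" for w
    using real_polynomial_function.intros(2) real_polynomial_function.intros(2)
    by (rule polynomial_dens_deriv_polynomial)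
  have der: "(conv (\<lambda>w. \<phi> (s *\<^sub>R w)) (c / s) (\<lambda>_. 1) has_derivative
      (\<lambda>v. conv (\<lambda>w. \<phi> (s *\<^sub>R w)) (c / s) (\<lambda>y. - (c / s) * ?q y v) x)) (at x)"
    by (rule conv_has_derivative[where B=B, OF _ B _ q polynomial_dens_deriv])
      (auto intro: real_polynomial_function.intros)
  have "conv (\<lambda>w. \<phi> (s *\<^sub>R w)) (c / s) (\<lambda>y. - (c / s) * ?q y v) x =
      (\<integral>z. (2 * c / s * (A z \<bullet> v)) *\<^sub>R \<phi> (c *\<^sub>R x + s *\<^sub>R z) \<partial>gauss)" for v
  proof -
    have pol: "real_polynomial_function (\<lambda>y. - (c / s) * ?q y v)"
      by (intro real_polynomial_function.intros(2,4) q)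
    have [measurable]: "A \<in> borel_measurable borel"
      by (intro borel_measurable_continuous_onI continuous_on_A continuous_intros)
    show ?thesis
      using s by (subst conv_eq[OF _ pol])
        (auto simp: integral_gauss scaleR_add_right symm mult_ac intro!: Bochner_Integration.integral_cong)
  qed
  with der show ?thesis using s by (simp add: mean_eq_conv)
qed

end

text \<open>Every iterated derivative is again a convolution of the same \<phi> with some polynomial
  kernel, hence differentiable and bounded.\<close>

lemma smooth_bounded_conv:
  fixes A :: "complex ^ 'n \<Rightarrow> complex ^ 'n"
  assumes "gaussian_density A \<kappa>"
    and \<phi>: "\<phi> \<in> borel_measurable borel" "bounded (range \<phi>)"
    and p: "real_polynomial_function p"
  shows "smooth_bounded (gaussian_density.conv A \<kappa> \<phi> r p)"
proof -
  interpret gaussian_density A \<kappa> by fact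
  have iter: "\<exists>q. real_polynomial_function q \<and> iter_deriv (conv \<phi> r p) vs = conv \<phi> r q" for vs
  proof (induction vs)
    case Nil
    then show ?case using p by auto
  next
    case (Cons v vs)
    then obtain q where q: "real_polynomial_function q" "iter_deriv (conv \<phi> r p) vs = conv \<phi> r q" by blast
    obtain q' where q': "\<And>v. real_polynomial_function (q' v)"
      "\<And>x. (conv \<phi> r q has_derivative (\<lambda>v. conv \<phi> r (q' v) x)) (at x)"
      using conv_kernel_derivative[OF \<phi> q(1)] by metis
    have "iter_deriv (conv \<phi> r p) (v # vs) = conv \<phi> r (q' v)"
      by (simp add: q(2) fun_eq_iff flip: frechet_derivative_at[OF q'(2)])
    with q'(1) show ?case by blast
  qed
  obtain B where B: "\<And>y. norm (\<phi> y) \<le> B"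
    using \<phi>(2) by (auto simp: bounded_iff)
  show ?thesis
    unfolding smooth_bounded_def smooth_def
  proof (intro conjI allI)
    fix vs
    obtain q where q: "real_polynomial_function q" "iter_deriv (conv \<phi> r p) vs = conv \<phi> r q"
      using iter by blast
    show "iter_deriv (conv \<phi> r p) vs differentiable at z" for z
      using conv_kernel_derivative[OF \<phi> q(1)] q(2) by (metis differentiable_def)
    show "bounded (range (iter_deriv (conv \<phi> r p) vs))"
      using conv_bounded[OF \<phi>(1) B q(1)] q(2) by metis
  qed
qed

section \<open>Integration by parts for the generator\<close>

lemma L2_iff: "f \<in> L2 M \<longleftrightarrow> f \<in> borel_measurable M \<and> integrable M (\<lambda>x. (cmod (f x))\<^sup>2)"
  by (simp add: Lp_def)

lemma L2_mult_integrable: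
  assumes "f \<in> L2 M" "g \<in> L2 M"
  shows "integrable M (\<lambda>x. f x * g x)"
proof (rule Bochner_Integration.integrable_bound)
  show "integrable M (\<lambda>x. (cmod (f x))\<^sup>2 + (cmod (g x))\<^sup>2)"
    using assms by (auto simp: L2_iff)
  show "(\<lambda>x. f x * g x) \<in> borel_measurable M"
    using assms by (auto simp: L2_iff)
  show "AE x in M. cmod (f x * g x) \<le> norm ((cmod (f x))\<^sup>2 + (cmod (g x))\<^sup>2)"
  proof (intro AE_I2)
    fix x
    have "2 * (cmod (f x) * cmod (g x)) \<le> (cmod (f x))\<^sup>2 + (cmod (g x))\<^sup>2"
      using sum_squares_bound[of "cmod (f x)" "cmod (g x)"] by (simp add: mult.assoc)
    then have "cmod (f x) * cmod (g x) \<le> (cmod (f x))\<^sup>2 + (cmod (g x))\<^sup>2"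
      using mult_nonneg_nonneg[OF norm_ge_zero[of "f x"] norm_ge_zero[of "g x"]] by linarith
    then show "cmod (f x * g x) \<le> norm ((cmod (f x))\<^sup>2 + (cmod (g x))\<^sup>2)"
      by (simp add: norm_mult)
  qed
qed

lemma L2_cnj: "f \<in> L2 M \<Longrightarrow> (\<lambda>x. cnj (f x)) \<in> L2 M"
  by (auto simp: L2_iff intro: borel_measurable_continuous_on[where f=cnj])

lemma smooth_bounded_imp_continuous_bounded:
  assumes "smooth_bounded \<phi>"
  shows "continuous_on UNIV \<phi>" "bounded (range \<phi>)"
proof -
  have "\<forall>z. iter_deriv \<phi> [] differentiable (at z)" "bounded (range (iter_deriv \<phi> []))"
    using assms unfolding smooth_bounded_def smooth_def by blast+
  then show "continuous_on UNIV \<phi>" "bounded (range \<phi>)"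
    by (auto simp: continuous_on_eq_continuous_at differentiable_imp_continuous_within)
qed

lemma smooth_bounded_frechet:
  assumes "smooth_bounded \<phi>"
  shows "continuous_on UNIV (\<lambda>z. frechet_derivative \<phi> (at z) v)"
    and "bounded (range (\<lambda>z. frechet_derivative \<phi> (at z) v))"
proof -
  have "\<forall>z. iter_deriv \<phi> [v] differentiable (at z)" "bounded (range (iter_deriv \<phi> [v]))"
    using assms unfolding smooth_bounded_def smooth_def by blast+
  then show "continuous_on UNIV (\<lambda>z. frechet_derivative \<phi> (at z) v)"
    and "bounded (range (\<lambda>z. frechet_derivative \<phi> (at z) v))"
    by (auto simp: continuous_on_eq_continuous_at differentiable_imp_continuous_within)
qed

lemma smooth_bounded_wirtinger:
  assumes "smooth_bounded \<phi>"
  shows "continuous_on UNIV (wirtinger j \<phi>)" "bounded (range (wirtinger j \<phi>))"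
    and "continuous_on UNIV (wirtinger_bar j \<phi>)" "bounded (range (wirtinger_bar j \<phi>))"
proof -
  note d = smooth_bounded_frechet[OF assms]
  show "continuous_on UNIV (wirtinger j \<phi>)" "continuous_on UNIV (wirtinger_bar j \<phi>)"
    unfolding wirtinger_def[abs_def] wirtinger_bar_def[abs_def] by (intro continuous_intros d(1) | simp)+
  obtain B where B: "\<And>z. cmod (frechet_derivative \<phi> (at z) (axis j 1)) \<le> B"
    using d(2)[of "axis j 1"] by (auto simp: bounded_iff)
  obtain C where C: "\<And>z. cmod (frechet_derivative \<phi> (at z) (axis j \<i>)) \<le> C"
    using d(2)[of "axis j \<i>"] by (auto simp: bounded_iff)
  have "cmod (wirtinger j \<phi> z) \<le> B + C" "cmod (wirtinger_bar j \<phi> z) \<le> B + C" for z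
  proof -
    let ?a = "frechet_derivative \<phi> (at z) (axis j 1)" and ?b = "frechet_derivative \<phi> (at z) (axis j \<i>)"
    have "cmod (?a - \<i> * ?b) \<le> B + C" "cmod (?a + \<i> * ?b) \<le> B + C"
      using norm_triangle_ineq4[of ?a "\<i> * ?b"] norm_triangle_ineq[of ?a "\<i> * ?b"] B[of z] C[of z]
      by (simp_all add: norm_mult)
    moreover have "0 \<le> B + C"
      using order_trans[OF norm_ge_zero B[of z]] order_trans[OF norm_ge_zero C[of z]] by simp
    ultimately show "cmod (wirtinger j \<phi> z) \<le> B + C" "cmod (wirtinger_bar j \<phi> z) \<le> B + C"
      by (simp_all add: wirtinger_def wirtinger_bar_def norm_divide)
  qed
  then show "bounded (range (wirtinger j \<phi>))" "bounded (range (wirtinger_bar j \<phi>))"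
    by (auto simp: bounded_iff)
qed

lemma bounded_mult_integrable:
  fixes g :: "'a \<Rightarrow> complex"
  assumes w: "continuous_on UNIV w" "bounded (range w)" and X: "X \<in> borel_measurable M" and g: "integrable M g"
  shows "integrable M (\<lambda>x. w (X x) * g x)"
proof -
  obtain B where B: "\<And>z. cmod (w z) \<le> B"
    using w(2) by (auto simp: bounded_iff)
  show ?thesis
  proof (rule Bochner_Integration.integrable_bound)
    show "integrable M (\<lambda>x. B * cmod (g x))" using g by simp
    have [measurable]: "(\<lambda>x. w (X x)) \<in> borel_measurable M" "g \<in> borel_measurable M"
      using borel_measurable_continuous_on[OF w(1) X] g by auto
    show "(\<lambda>x. w (X x) * g x) \<in> borel_measurable M" by measurable
    show "AE x in M. cmod (w (X x) * g x) \<le> norm (B * cmod (g x))"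
    proof (intro AE_I2)
      fix x
      have "cmod (w (X x)) * cmod (g x) \<le> \<bar>B\<bar> * cmod (g x)"
        using B[of "X x"] by (intro mult_right_mono) auto
      then show "cmod (w (X x) * g x) \<le> norm (B * cmod (g x))"
        by (simp add: norm_mult abs_mult)
    qed
  qed
qed

lemma measurable_rvec:
  fixes F :: "'n::finite \<Rightarrow> 'a \<Rightarrow> complex"
  assumes [measurable]: "\<And>j. F j \<in> borel_measurable M"
  shows "rvec F \<in> borel_measurable M"
  unfolding rvec_def[abs_def] borel_measurable_euclidean_space[of "\<lambda>x. \<chi> j. F j x"]
  by (auto simp: Basis_vec_def inner_axis)

context complex_markov_diffusion
begin

lemma one_L2: "(\<lambda>x. 1) \<in> L2 M"
  by (simp add: L2_iff)

lemma L2_integrable: "f \<in> L2 M \<Longrightarrow> integrable M f"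
  using L2_mult_integrable[OF _ one_L2] by simp

lemma D_L2: "F \<in> D \<Longrightarrow> F \<in> L2 M"
  using linear by (auto simp: linear_operator_def)

lemma L_L2: "F \<in> D \<Longrightarrow> L F \<in> L2 M"
  using linear by (auto simp: linear_operator_def)

lemma A0_D: "F \<in> A0 \<Longrightarrow> F \<in> D"
  using A0_domain(1) by blast

lemma A0_measurable: "F \<in> A0 \<Longrightarrow> F \<in> borel_measurable M"
  using D_L2[OF A0_D] by (simp add: L2_iff)

lemma symmetric: "F \<in> D \<Longrightarrow> G \<in> D \<Longrightarrow> ip M (L F) G = ip M F (L G)"
  using self_adjoint unfolding self_adjoint_def by blast

text \<open>Invariance of the measure: symmetry moves L onto the constant 1, which it
  annihilates.\<close>

lemma integral_L:
  assumes "F \<in> D"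
  shows "(\<integral>x. L F x \<partial>M) = 0"
proof -
  have "(\<integral>x. L F x \<partial>M) = ip M F (L (\<lambda>x. 1))"
    using symmetric[OF assms one(1)] by (simp add: ip_def)
  also have "\<dots> = (\<integral>x. 0 \<partial>M)"
    unfolding ip_def
  proof (rule integral_cong_AE)
    show "(\<lambda>x. F x * cnj (L (\<lambda>x. 1) x)) \<in> borel_measurable M"
      by (intro borel_measurable_integrable L2_mult_integrable L2_cnj L_L2 D_L2 assms one)
    show "AE x in M. F x * cnj (L (\<lambda>x. 1) x) = 0"
      using one(2) by eventually_elim simp
  qed simp
  finally show ?thesis by simp
qed

lemma carre_du_champ_integrable:
  assumes "F \<in> A0" "G \<in> A0"
  shows "integrable M (carre_du_champ L F G)"
proof -
  have "integrable M (L (\<lambda>y. F y * cnj (G y)))" "integrable M (\<lambda>x. F x * L (cconj G) x)"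
    "integrable M (\<lambda>x. cnj (G x) * L F x)"
    using L2_integrable[OF L_L2[OF A0_domain(2)[OF assms]]]
      L2_mult_integrable[OF D_L2[OF A0_D] L_L2[OF A0_D[OF A0_cnj]], OF assms]
      L2_mult_integrable[OF L2_cnj[OF D_L2[OF A0_D]] L_L2[OF A0_D], OF assms(2,1)]
      L2_mult_integrable[OF D_L2[OF A0_D] L2_cnj[OF L_L2[OF A0_D]], OF assms] by auto
  then show ?thesis
    unfolding carre_du_champ_def[abs_def] by simp
qed

text \<open>The term L (F cnj G) integrates to 0. The other two have equal integrals, one because L
  commutes with conjugation and one by symmetry, and this cancels the factor 1/2.\<close>

lemma carre_du_champ_integral:
  assumes F: "F \<in> A0" and G: "G \<in> A0"
  shows "(\<integral>x. carre_du_champ L F G x \<partial>M) = - (\<integral>x. F x * cnj (L G x) \<partial>M)"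
proof -
  have int: "integrable M (L (\<lambda>y. F y * cnj (G y)))" "integrable M (\<lambda>x. F x * L (cconj G) x)"
    "integrable M (\<lambda>x. cnj (G x) * L F x)" "integrable M (\<lambda>x. F x * cnj (L G x))"
    using L2_integrable[OF L_L2[OF A0_domain(2)[OF assms]]]
      L2_mult_integrable[OF D_L2[OF A0_D] L_L2[OF A0_D[OF A0_cnj]], OF assms]
      L2_mult_integrable[OF L2_cnj[OF D_L2[OF A0_D]] L_L2[OF A0_D], OF assms(2,1)]
      L2_mult_integrable[OF D_L2[OF A0_D] L2_cnj[OF L_L2[OF A0_D]], OF assms] by auto
  have "(\<integral>x. F x * L (cconj G) x \<partial>M) = (\<integral>x. F x * cnj (L G x) \<partial>M)"
  proof (rule integral_cong_AE)
    show "AE x in M. F x * L (cconj G) x = F x * cnj (L G x)"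
      using real_operator(2)[OF A0_D[OF G]] by eventually_elim simp
  qed (use int in \<open>auto intro: borel_measurable_integrable\<close>)
  moreover have "(\<integral>x. cnj (G x) * L F x \<partial>M) = (\<integral>x. F x * cnj (L G x) \<partial>M)"
    using symmetric[OF A0_D[OF F] A0_D[OF G]] by (simp add: ip_def mult.commute)
  ultimately show ?thesis
    unfolding carre_du_champ_def using int integral_L[OF A0_domain(2)[OF F G]] by simp
qed

lemma A0_uminus: "F \<in> A0 \<Longrightarrow> (\<lambda>x. - F x) \<in> A0"
proof -
  assume F: "F \<in> A0"
  have "(\<lambda>x. (- 1) * F x + 0 * F x) \<in> A0"
    using A0_subspace F unfolding fun_subspace_def by blast
  then show ?thesis by simp
qed

text \<open>With -L^{-1} F in the second slot of the previous identity, L cancels its inverse and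
  the two signs cancel each other.\<close>

lemma carre_du_champ_inverse:
  assumes P: "P \<in> A0" and F: "F \<in> op_inv_dom M D L" "op_inv M D L F \<in> A0"
  shows "(\<integral>x. carre_du_champ L P (\<lambda>y. - op_inv M D L F y) x \<partial>M) = (\<integral>x. P x * cnj (F x) \<partial>M)"
proof -
  let ?V = "op_inv M D L F"
  \<comment> \<open>\<open>op_inv\<close> is a choice; membership in \<open>op_inv_dom\<close>
    supplies a witness, so the chosen function has the defining property.\<close>
  have V: "?V \<in> D" "AE x in M. L ?V x = F x"
    using F(1) someI_ex[of "is_op_inv M D L F"]
    unfolding op_inv_dom_def op_inv_def is_op_inv_def by auto
  have "AE x in M. L (\<lambda>x. (- 1) * ?V x + 0 * ?V x) x = (- 1) * L ?V x + 0 * L ?V x"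
    using linear V(1) unfolding linear_operator_def by blast
  then have LU: "AE x in M. L (\<lambda>y. - ?V y) x = - F x"
    using V(2) by (simp, eventually_elim) simp
  have U: "(\<lambda>y. - ?V y) \<in> A0" using F(2) by (rule A0_uminus)
  have "(\<integral>x. carre_du_champ L P (\<lambda>y. - ?V y) x \<partial>M) = - (\<integral>x. P x * cnj (L (\<lambda>y. - ?V y) x) \<partial>M)"
    using P U by (rule carre_du_champ_integral)
  also have "(\<integral>x. P x * cnj (L (\<lambda>y. - ?V y) x) \<partial>M) = (\<integral>x. - (P x * cnj (F x)) \<partial>M)"
  proof (rule integral_cong_AE)
    show "AE x in M. P x * cnj (L (\<lambda>y. - ?V y) x) = - (P x * cnj (F x))"
      using LU by eventually_elim simp
    show "(\<lambda>x. P x * cnj (L (\<lambda>y. - ?V y) x)) \<in> borel_measurable M"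
      by (intro borel_measurable_integrable L2_mult_integrable L2_cnj L_L2 D_L2 A0_D P U)
    have "F \<in> L2 M" using F(1) by (simp add: op_inv_dom_def)
    then have "integrable M (\<lambda>x. P x * cnj (F x))"
      by (intro L2_mult_integrable L2_cnj D_L2[OF A0_D[OF P]])
    then show "(\<lambda>x. - (P x * cnj (F x))) \<in> borel_measurable M"
      by (intro borel_measurable_uminus borel_measurable_integrable)
  qed
  finally show ?thesis by simp
qed

lemma Gamma_inv_integrable:
  assumes "\<And>j. H j \<in> A0" "\<And>k. op_inv M D L (F k) \<in> A0"
  shows "integrable M (\<lambda>x. Gamma_inv M D L H F x $ j $ k)"
  unfolding Gamma_inv_def using carre_du_champ_integrable[OF assms(1) A0_uminus[OF assms(2)]] by simp

text \<open>The integral of \<Gamma>(\<phi>(F), -L^{-1} F_k) is evaluated twice, by cancelling L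
  against its inverse and by the chain rule. Boundedness of \<phi> and its derivatives places
  \<phi>(F) in \<open>A0\<close> and makes every term of the chain rule integrable.\<close>

lemma integration_by_parts:
  fixes \<phi> :: "complex ^ 'n \<Rightarrow> complex"
  assumes \<phi>: "smooth_bounded \<phi>"
    and F: "\<And>j. F j \<in> A0" "\<And>j. F j \<in> op_inv_dom M D L" "\<And>j. op_inv M D L (F j) \<in> A0"
  shows "(\<integral>x. \<phi> (rvec F x) * cnj (F k x) \<partial>M) =
    (\<integral>x. (\<Sum>j\<in>UNIV. wirtinger j \<phi> (rvec F x) * Gamma_inv M D L F F x $ j $ k
        + wirtinger_bar j \<phi> (rvec F x) * Gamma_inv M D L (\<lambda>j. cconj (F j)) F x $ j $ k) \<partial>M)"
proof -
  have P: "(\<lambda>x. \<phi> (rvec F x)) \<in> A0"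
    using A0_smooth[OF \<phi> F(1)] by simp
  have U: "(\<lambda>y. - op_inv M D L (F k) y) \<in> A0"
    by (rule A0_uminus[OF F(3)])
  have "smooth \<phi>" using \<phi> by (simp add: smooth_bounded_def)
  from chain_rule[OF this F(1) U P]
  have "AE x in M. carre_du_champ L (\<lambda>y. \<phi> (rvec F y)) (\<lambda>y. - op_inv M D L (F k) y) x =
    (\<Sum>j\<in>UNIV. wirtinger j \<phi> (rvec F x) * Gamma_inv M D L F F x $ j $ k
        + wirtinger_bar j \<phi> (rvec F x) * Gamma_inv M D L (\<lambda>j. cconj (F j)) F x $ j $ k)"
    by (simp add: Gamma_inv_def)
  then have "(\<integral>x. carre_du_champ L (\<lambda>y. \<phi> (rvec F y)) (\<lambda>y. - op_inv M D L (F k) y) x \<partial>M) =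
    (\<integral>x. (\<Sum>j\<in>UNIV. wirtinger j \<phi> (rvec F x) * Gamma_inv M D L F F x $ j $ k
        + wirtinger_bar j \<phi> (rvec F x) * Gamma_inv M D L (\<lambda>j. cconj (F j)) F x $ j $ k) \<partial>M)"
    by (intro integral_cong_AE borel_measurable_integrable carre_du_champ_integrable P U
        Bochner_Integration.integrable_sum Bochner_Integration.integrable_add bounded_mult_integrable
        smooth_bounded_wirtinger \<phi> measurable_rvec A0_measurable
        Gamma_inv_integrable F A0_cnj)
  then show ?thesis
    using carre_du_champ_inverse[OF P F(2,3), of k] by simp
qed

end

section \<open>Interpolation between the law and the Gaussian\<close>

lemma hs_norm_power2: "(hs_norm A)\<^sup>2 = (\<Sum>j\<in>UNIV. \<Sum>k\<in>UNIV. (cmod (A $ j $ k))\<^sup>2)"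
proof -
  have "Re (trace (A ** conj_transpose A)) = (\<Sum>j\<in>UNIV. \<Sum>k\<in>UNIV. (cmod (A $ j $ k))\<^sup>2)"
    by (simp add: trace_def matrix_matrix_mult_def conj_transpose_def complex_mult_cnj cmod_power2)
  then show ?thesis
    by (simp add: hs_norm_def sum_nonneg)
qed

lemma norm_vec_power2: "(norm v)\<^sup>2 = (\<Sum>k\<in>UNIV. (cmod (v $ k))\<^sup>2)" for v :: "complex ^ 'n"
  by (simp add: norm_vec_def L2_set_def sum_nonneg)

section \<open>Moments of linear images of the Gaussian variable\<close>

locale complex_gaussian = gaussian_density A \<kappa>
  for A :: "complex ^ 'n \<Rightarrow> complex ^ 'n" and \<kappa> +
  fixes K :: real
  assumes form_bound: "v \<bullet> A v \<le> K * (norm v)\<^sup>2"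
begin

lemma K_nonneg: "K \<ge> 0"
proof -
  \<comment> \<open>\<open>undefined\<close> stands for an arbitrary index; the vector is just some
    nonzero one.\<close>
  have "0 < axis undefined 1 \<bullet> A (axis undefined 1)"
    by (rule pos) (simp add: axis_eq_0_iff)
  also have "\<dots> \<le> K * (norm (axis undefined 1 :: complex ^ 'n))\<^sup>2" by (rule form_bound)
  finally show ?thesis by (simp add: zero_less_mult_iff)
qed

lemma measurable_A [measurable]: "A \<in> borel_measurable borel"
  by (intro borel_measurable_continuous_onI continuous_on_A continuous_intros)

lemma measurable_vec_nth [measurable]: "(\<lambda>z. z $ j) \<in> borel_measurable borel" for j :: "'m::finite"
  by (intro borel_measurable_continuous_onI continuous_intros)

text \<open>Real and imaginary part are the real linear forms z \<bullet> A v and z \<bullet> A u,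
  where v is the conjugate of b and u is \<i> times it. Each contributes half of a quadratic form of
  \<open>A\<close>, and together they give the full constant K.\<close>

lemma bilinear_moment:
  fixes b :: "complex ^ 'n"
  shows "integrable gauss (\<lambda>z. (cmod (\<Sum>j\<in>UNIV. A z $ j * b $ j))\<^sup>2)"
    and "(\<integral>z. (cmod (\<Sum>j\<in>UNIV. A z $ j * b $ j))\<^sup>2 \<partial>gauss) \<le> K * (norm b)\<^sup>2"
proof -
  define v where "v = (\<chi> j. cnj (b $ j))"
  define u where "u = (\<chi> j. \<i> * cnj (b $ j))"
  have norms: "norm v = norm b" "norm u = norm b"
    by (simp_all add: v_def u_def norm_vec_def norm_mult)
  have eq: "(cmod (\<Sum>j\<in>UNIV. A z $ j * b $ j))\<^sup>2 = (z \<bullet> A v)\<^sup>2 + (z \<bullet> A u)\<^sup>2" for z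
  proof -
    have "z \<bullet> A v = Re (\<Sum>j\<in>UNIV. A z $ j * b $ j)"
      unfolding symm[symmetric] by (simp add: v_def inner_vec_def inner_complex_def)
    moreover have "z \<bullet> A u = Im (\<Sum>j\<in>UNIV. A z $ j * b $ j)"
      unfolding symm[symmetric] by (simp add: u_def inner_vec_def inner_complex_def add.commute)
    ultimately show ?thesis by (simp add: cmod_power2)
  qed
  show "integrable gauss (\<lambda>z. (cmod (\<Sum>j\<in>UNIV. A z $ j * b $ j))\<^sup>2)"
    unfolding eq using integrable_gauss_inner_power2 by simp
  have "(\<integral>z. (cmod (\<Sum>j\<in>UNIV. A z $ j * b $ j))\<^sup>2 \<partial>gauss) = (v \<bullet> A v) / 2 + (u \<bullet> A u) / 2"
    unfolding eq using integrable_gauss_inner_power2 by (simp add: integral_gauss_inner_power2)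
  also have "\<dots> \<le> K * (norm b)\<^sup>2"
    using form_bound[of v] form_bound[of u] by (simp add: norms)
  finally show "(\<integral>z. (cmod (\<Sum>j\<in>UNIV. A z $ j * b $ j))\<^sup>2 \<partial>gauss) \<le> K * (norm b)\<^sup>2" .
qed

text \<open>With \<zeta> = A z, P = S - G x and Q = G' x this is the componentwise conjugate of the
  vector w against which the gradient of h is finally tested.\<close>

definition stein_vec :: "complex ^ 'n ^ 'n \<Rightarrow> complex ^ 'n ^ 'n \<Rightarrow> complex ^ 'n \<Rightarrow> complex ^ 'n" where
  "stein_vec P Q z = (\<chi> k. \<Sum>j\<in>UNIV. cnj (A z $ j) * P $ j $ k - A z $ j * Q $ j $ k)"

text \<open>\<open>A\<close> is only real linear here, so the cross terms between the P and the Q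
  part are not known to vanish in mean. They are estimated by (a + b)^2 \<le> 2 a^2 + 2 b^2, which
  produces the factor 2 K.\<close>

lemma stein_vec_moment:
  "integrable gauss (\<lambda>z. norm (stein_vec P Q z))"
  "(\<integral>z. norm (stein_vec P Q z) \<partial>gauss) \<le> sqrt (2 * K) * sqrt ((hs_norm Q)\<^sup>2 + (hs_norm P)\<^sup>2)"
proof -
  interpret prob_space gauss by (rule prob_space_gauss)
  define a where "a k z = (cmod (\<Sum>j\<in>UNIV. A z $ j * (\<chi> j. cnj (P $ j $ k)) $ j))\<^sup>2" for k z
  define b where "b k z = (cmod (\<Sum>j\<in>UNIV. A z $ j * (\<chi> j. Q $ j $ k) $ j))\<^sup>2" for k z
  have ab: "integrable gauss (a k)" "(\<integral>z. a k z \<partial>gauss) \<le> K * (\<Sum>j\<in>UNIV. (cmod (P $ j $ k))\<^sup>2)"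
    "integrable gauss (b k)" "(\<integral>z. b k z \<partial>gauss) \<le> K * (\<Sum>j\<in>UNIV. (cmod (Q $ j $ k))\<^sup>2)" for k
    unfolding a_def b_def
    using bilinear_moment[of "\<chi> j. cnj (P $ j $ k)"] bilinear_moment[of "\<chi> j. Q $ j $ k"]
    by (simp_all add: norm_vec_power2)
  have le: "(norm (stein_vec P Q z))\<^sup>2 \<le> (\<Sum>k\<in>UNIV. 2 * a k z + 2 * b k z)" for z
    unfolding norm_vec_power2
  proof (rule sum_mono)
    fix k
    let ?p = "\<Sum>j\<in>UNIV. cnj (A z $ j) * P $ j $ k" and ?q = "\<Sum>j\<in>UNIV. A z $ j * Q $ j $ k"
    have "cmod (stein_vec P Q z $ k) \<le> cmod ?p + cmod ?q"
      unfolding stein_vec_def by (simp add: sum_subtractf norm_triangle_ineq4)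
    then have "(cmod (stein_vec P Q z $ k))\<^sup>2 \<le> (cmod ?p + cmod ?q)\<^sup>2"
      by (intro power_mono) auto
    also have "\<dots> \<le> 2 * (cmod ?p)\<^sup>2 + 2 * (cmod ?q)\<^sup>2"
      using sum_squares_bound[of "cmod ?p" "cmod ?q"] by (simp add: power2_sum)
    \<comment> \<open>\<open>bilinear_moment\<close> speaks of A z without conjugation, so the
      conjugate passes to the column of P.\<close>
    also have "cmod ?p = cmod (cnj ?p)" by (rule complex_mod_cnj[symmetric])
    also have "cnj ?p = (\<Sum>j\<in>UNIV. A z $ j * cnj (P $ j $ k))" by simp
    finally show "(cmod (stein_vec P Q z $ k))\<^sup>2 \<le> 2 * a k z + 2 * b k z"
      by (simp add: a_def b_def)
  qed
  have meas[measurable]: "stein_vec P Q \<in> borel_measurable borel"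
    unfolding stein_vec_def[abs_def]
    by (intro borel_measurable_continuous_onI continuous_intros)
  have int_ab: "integrable gauss (\<lambda>z. \<Sum>k\<in>UNIV. 2 * a k z + 2 * b k z)"
    using ab by simp
  have int2: "integrable gauss (\<lambda>z. (norm (stein_vec P Q z))\<^sup>2)"
  proof (rule Bochner_Integration.integrable_bound[OF int_ab])
    show "AE z in gauss. norm ((norm (stein_vec P Q z))\<^sup>2) \<le> norm (\<Sum>k\<in>UNIV. 2 * a k z + 2 * b k z)"
      using order_trans[OF le abs_ge_self] by (intro AE_I2) simp
  qed simp
  have "(\<integral>z. (norm (stein_vec P Q z))\<^sup>2 \<partial>gauss) \<le> (\<integral>z. (\<Sum>k\<in>UNIV. 2 * a k z + 2 * b k z) \<partial>gauss)"
    using int2 int_ab le by (intro integral_mono) auto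
  also have "\<dots> = (\<Sum>k\<in>UNIV. 2 * (\<integral>z. a k z \<partial>gauss) + 2 * (\<integral>z. b k z \<partial>gauss))"
    using ab by simp
  also have "\<dots> \<le> (\<Sum>k\<in>UNIV. 2 * (K * (\<Sum>j\<in>UNIV. (cmod (P $ j $ k))\<^sup>2)) + 2 * (K * (\<Sum>j\<in>UNIV. (cmod (Q $ j $ k))\<^sup>2)))"
    using ab by (intro sum_mono add_mono mult_left_mono) auto
  also have "\<dots> = 2 * K * ((\<Sum>k\<in>UNIV. \<Sum>j\<in>UNIV. (cmod (Q $ j $ k))\<^sup>2) + (\<Sum>k\<in>UNIV. \<Sum>j\<in>UNIV. (cmod (P $ j $ k))\<^sup>2))"
    by (simp add: sum.distrib sum_distrib_left algebra_simps)
  also have "\<dots> = 2 * K * ((hs_norm Q)\<^sup>2 + (hs_norm P)\<^sup>2)"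
    unfolding hs_norm_power2
    by (intro arg_cong2[where f="(*)"] arg_cong2[where f="(+)"] refl sum.swap)
  finally have sq: "(\<integral>z. (norm (stein_vec P Q z))\<^sup>2 \<partial>gauss) \<le> 2 * K * ((hs_norm Q)\<^sup>2 + (hs_norm P)\<^sup>2)" .
  show int1: "integrable gauss (\<lambda>z. norm (stein_vec P Q z))"
    by (rule square_integrable_imp_integrable[OF _ int2]) measurable
  \<comment> \<open>The Cauchy-Schwarz inequality, in the form that a variance is
    nonnegative.\<close>
  have "(\<integral>z. norm (stein_vec P Q z) \<partial>gauss)\<^sup>2 \<le> (\<integral>z. (norm (stein_vec P Q z))\<^sup>2 \<partial>gauss)"
    using variance_positive[of "\<lambda>z. norm (stein_vec P Q z)"] variance_eq[OF int1 int2] by simp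
  then have "(\<integral>z. norm (stein_vec P Q z) \<partial>gauss) \<le> sqrt (2 * K * ((hs_norm Q)\<^sup>2 + (hs_norm P)\<^sup>2))"
    using sq by (intro real_le_rsqrt) simp
  then show "(\<integral>z. norm (stein_vec P Q z) \<partial>gauss) \<le> sqrt (2 * K) * sqrt ((hs_norm Q)\<^sup>2 + (hs_norm P)\<^sup>2)"
    by (simp add: real_sqrt_mult)
qed

end

lemma abs_cos_diff_le: "\<bar>cos a - cos b\<bar> \<le> \<bar>a - b\<bar>" for a b :: real
proof -
  have "norm (cos a - cos b) \<le> 1 * norm (a - b)"
    by (rule field_differentiable_bound[of UNIV cos "\<lambda>x. - sin x"]) (auto intro!: derivative_eq_intros)
  then show ?thesis by simp
qed

lemma abs_sin_diff_le: "\<bar>sin a - sin b\<bar> \<le> \<bar>a - b\<bar>" for a b :: real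
proof -
  have "norm (sin a - sin b) \<le> 1 * norm (a - b)"
    by (rule field_differentiable_bound[of UNIV sin cos]) (auto intro!: derivative_eq_intros)
  then show ?thesis by simp
qed

text \<open>Jensen's inequality for the square root, from the nonnegative variance of sqrt
  T.\<close>

lemma (in prob_space) integral_sqrt_le:
  assumes T: "integrable M T" "\<And>x. T x \<ge> 0"
  shows "integrable M (\<lambda>x. sqrt (T x))" "(\<integral>x. sqrt (T x) \<partial>M) \<le> sqrt (\<integral>x. T x \<partial>M)"
proof -
  have [measurable]: "T \<in> borel_measurable M" using T(1) by auto
  have sq: "(\<lambda>x. (sqrt (T x))\<^sup>2) = T" using T(2) by auto
  show int: "integrable M (\<lambda>x. sqrt (T x))"
    by (rule square_integrable_imp_integrable) (simp_all add: sq T(1))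
  have "(\<integral>x. sqrt (T x) \<partial>M)\<^sup>2 \<le> (\<integral>x. T x \<partial>M)"
    using variance_positive[of "\<lambda>x. sqrt (T x)"] variance_eq[OF int] T(1) sq by simp
  then show "(\<integral>x. sqrt (T x) \<partial>M) \<le> sqrt (\<integral>x. T x \<partial>M)"
    by (rule real_le_rsqrt)
qed

text \<open>The vector \<open>F\<close> enters the argument only through \<open>X = F\<close>, \<open>S = \<Sigma>\<close>, \<open>G = \<Gamma>(F, -L\<^sup>-\<^sup>1F)\<close> and
  \<open>G' = \<Gamma>(cnj F, -L\<^sup>-\<^sup>1F)\<close>. The last assumption says that \<open>A\<close> inverts the Hermitian matrix \<open>S\<close>.\<close>

locale stein_setting = complex_gaussian A \<kappa> K + prob_space M
  for A :: "complex ^ 'n \<Rightarrow> complex ^ 'n" and \<kappa> K and M :: "'a measure" +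
  fixes X :: "'a \<Rightarrow> complex ^ 'n" and S :: "complex ^ 'n ^ 'n" and G G' :: "'a \<Rightarrow> complex ^ 'n ^ 'n"
  assumes X_measurable [measurable]: "X \<in> borel_measurable M"
    and X_integrable: "integrable M (\<lambda>x. norm (X x))"
    and G_integrable: "\<And>j k. integrable M (\<lambda>x. G x $ j $ k)" "\<And>j k. integrable M (\<lambda>x. G' x $ j $ k)"
    and by_parts: "\<And>\<phi> k. smooth_bounded \<phi> \<Longrightarrow> (\<integral>x. \<phi> (X x) * cnj (X x $ k) \<partial>M) =
      (\<integral>x. (\<Sum>j\<in>UNIV. wirtinger j \<phi> (X x) * G x $ j $ k + wirtinger_bar j \<phi> (X x) * G' x $ j $ k) \<partial>M)"
    and cnj_component: "\<And>z k. cnj (z $ k) = (\<Sum>j\<in>UNIV. cnj (A z $ j) * S $ j $ k)"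
begin

definition discrepancy :: "'a \<Rightarrow> real" where
  "discrepancy x = (hs_norm (G' x))\<^sup>2 + (hs_norm (G x - S))\<^sup>2"

end

text \<open>One continuous derivative suffices, because all further derivatives fall on the Gaussian
  kernel. The Lipschitz bound will give |h' y v| \<le> |v|.\<close>

locale stein_test = stein_setting A \<kappa> K M X S G G'
  for A :: "complex ^ 'n \<Rightarrow> complex ^ 'n" and \<kappa> K and M :: "'a measure" and X S G G' +
  fixes h :: "complex ^ 'n \<Rightarrow> real" and h'
  assumes h_deriv: "\<And>y. (h has_derivative h' y) (at y)"
    and h'_cont: "\<And>v. continuous_on UNIV (\<lambda>y. h' y v)"
    and h_lip: "\<And>y z. \<bar>h y - h z\<bar> \<le> norm (y - z)"
begin

lemma h'_linear: "linear (h' y)"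
  using h_deriv has_derivative_linear by blast

lemma h_cont: "continuous_on UNIV h"
  using h_deriv by (meson continuous_at_imp_continuous_on has_derivative_continuous)

lemma measurable_h [measurable]: "h \<in> borel_measurable borel"
  using h_cont by (rule borel_measurable_continuous_onI)

lemma h'_bound: "\<bar>h' y v\<bar> \<le> norm v"
proof -
  have "((\<lambda>t. y + t *\<^sub>R v) has_derivative (\<lambda>t. t *\<^sub>R v)) (at 0)"
    by (auto intro!: derivative_eq_intros)
  from has_derivative_compose[OF this h_deriv]
  have "((\<lambda>t. h (y + t *\<^sub>R v)) has_real_derivative h' y v) (at 0)"
    by (simp add: has_field_derivative_def linear_cmul[OF h'_linear] mult.commute[of _ "h' y v"])
  then have lim: "((\<lambda>t. \<bar>(h (y + t *\<^sub>R v) - h y) / t\<bar>) \<longlongrightarrow> \<bar>h' y v\<bar>) (at 0)"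
    unfolding DERIV_def by (intro tendsto_rabs) simp
  have "\<bar>(h (y + t *\<^sub>R v) - h y) / t\<bar> \<le> norm v" if "t \<noteq> 0" for t
    using h_lip[of "y + t *\<^sub>R v" y] that by (simp add: pos_divide_le_eq mult.commute)
  then show ?thesis
    by (intro tendsto_upperbound[OF lim]) (auto simp: eventually_at intro!: exI[of _ 1])
qed

section \<open>Differentiating along the interpolation\<close>

definition interp :: "real \<Rightarrow> complex ^ 'n \<Rightarrow> complex ^ 'n \<Rightarrow> complex ^ 'n" where
  "interp \<theta> x z = cos \<theta> *\<^sub>R x + sin \<theta> *\<^sub>R z"

definition velocity :: "real \<Rightarrow> complex ^ 'n \<Rightarrow> complex ^ 'n \<Rightarrow> complex ^ 'n" where
  "velocity \<theta> x z = cos \<theta> *\<^sub>R z - sin \<theta> *\<^sub>R x"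

lemma interp_lip: "norm (interp \<theta> x z - interp \<tau> x z) \<le> \<bar>\<theta> - \<tau>\<bar> * (norm x + norm z)"
proof -
  have "interp \<theta> x z - interp \<tau> x z = (cos \<theta> - cos \<tau>) *\<^sub>R x + (sin \<theta> - sin \<tau>) *\<^sub>R z"
    by (simp add: interp_def algebra_simps)
  also have "norm \<dots> \<le> \<bar>cos \<theta> - cos \<tau>\<bar> * norm x + \<bar>sin \<theta> - sin \<tau>\<bar> * norm z"
    by (rule norm_triangle_le) simp
  also have "\<dots> \<le> \<bar>\<theta> - \<tau>\<bar> * norm x + \<bar>\<theta> - \<tau>\<bar> * norm z"
    by (intro add_mono mult_right_mono abs_cos_diff_le abs_sin_diff_le) auto
  finally show ?thesis by (simp add: distrib_left)
qed

lemma h_interp_integrable: "integrable gauss (\<lambda>z. h (interp \<theta> x z))"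
proof (rule Bochner_Integration.integrable_bound)
  interpret P: prob_space gauss by (rule prob_space_gauss)
  show "integrable gauss (\<lambda>z. \<bar>h 0\<bar> + norm x + norm z)"
    using integrable_gauss_norm by simp
  show "(\<lambda>z. h (interp \<theta> x z)) \<in> borel_measurable gauss"
    unfolding interp_def by measurable
  show "AE z in gauss. norm (h (interp \<theta> x z)) \<le> norm (\<bar>h 0\<bar> + norm x + norm z)"
  proof (intro AE_I2)
    fix z
    have "norm (interp \<theta> x z) \<le> norm (cos \<theta> *\<^sub>R x) + norm (sin \<theta> *\<^sub>R z)"
      unfolding interp_def by (rule norm_triangle_ineq)
    also have "\<dots> \<le> 1 * norm x + 1 * norm z"
      unfolding norm_scaleR by (intro add_mono mult_right_mono) auto
    finally have "\<bar>h (interp \<theta> x z)\<bar> \<le> \<bar>h 0\<bar> + norm x + norm z"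
      using h_lip[of "interp \<theta> x z" 0] by simp
    then show "norm (h (interp \<theta> x z)) \<le> norm (\<bar>h 0\<bar> + norm x + norm z)" by simp
  qed
qed

text \<open>The average over the Gaussian variable with F frozen at x. Integrating it over M
  afterwards models an independent pair without a product space, and the \<theta>-derivative is
  taken in the same two stages.\<close>

definition inner_mean :: "real \<Rightarrow> complex ^ 'n \<Rightarrow> real" where
  "inner_mean \<theta> x = (\<integral>z. h (interp \<theta> x z) \<partial>gauss)"

definition inner_slope :: "real \<Rightarrow> complex ^ 'n \<Rightarrow> real" where
  "inner_slope \<theta> x = (\<integral>z. h' (interp \<theta> x z) (velocity \<theta> x z) \<partial>gauss)"

lemma h_interp_has_derivative:
  "((\<lambda>\<theta>. h (interp \<theta> x z)) has_derivative (\<lambda>t. t * h' (interp \<theta> x z) (velocity \<theta> x z))) (at \<theta>)"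
proof -
  have "((\<lambda>\<theta>. interp \<theta> x z) has_derivative (\<lambda>t. t *\<^sub>R velocity \<theta> x z)) (at \<theta>)"
    unfolding interp_def velocity_def by (auto intro!: derivative_eq_intros simp: algebra_simps)
  from has_derivative_compose[OF this h_deriv]
  show ?thesis by (simp add: linear_cmul[OF h'_linear])
qed

lemma inner_mean_has_derivative:
  shows "integrable gauss (\<lambda>z. h' (interp \<theta> x z) (velocity \<theta> x z))"
    and "((\<lambda>\<theta>. inner_mean \<theta> x) has_derivative (\<lambda>t. t * inner_slope \<theta> x)) (at \<theta>)"
proof -
  interpret P: prob_space gauss by (rule prob_space_gauss)
  have lip: "norm (h (interp \<tau> x z) - h (interp \<theta> x z)) \<le> norm (\<tau> - \<theta>) * (norm x + norm z)" for \<tau> z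
    using order_trans[OF h_lip interp_lip] by simp
  have w: "integrable gauss (\<lambda>z. norm x + norm z)"
    using integrable_gauss_norm by simp
  note d = has_derivative_integral_dominated[where f="\<lambda>\<theta> z. h (interp \<theta> x z)" and M=gauss,
      OF h_interp_integrable h_interp_has_derivative lip w]
  show "integrable gauss (\<lambda>z. h' (interp \<theta> x z) (velocity \<theta> x z))"
    using d(1)[where v=1] by simp
  show "((\<lambda>\<theta>. inner_mean \<theta> x) has_derivative (\<lambda>t. t * inner_slope \<theta> x)) (at \<theta>)"
    using d(2) unfolding inner_mean_def inner_slope_def by simp
qed

lemma inner_mean_lip:
  "\<bar>inner_mean \<theta> x - inner_mean \<tau> y\<bar> \<le> (\<integral>z. norm (interp \<theta> x z - interp \<tau> y z) \<partial>gauss)"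
  if "integrable gauss (\<lambda>z. norm (interp \<theta> x z - interp \<tau> y z))"
proof -
  have "inner_mean \<theta> x - inner_mean \<tau> y = (\<integral>z. h (interp \<theta> x z) - h (interp \<tau> y z) \<partial>gauss)"
    unfolding inner_mean_def using h_interp_integrable by simp
  also have "\<bar>\<dots>\<bar> \<le> (\<integral>z. \<bar>h (interp \<theta> x z) - h (interp \<tau> y z)\<bar> \<partial>gauss)"
    by (rule integral_abs_bound)
  also have "\<dots> \<le> (\<integral>z. norm (interp \<theta> x z - interp \<tau> y z) \<partial>gauss)"
    using h_interp_integrable that h_lip by (intro integral_mono) auto
  finally show ?thesis .
qed

text \<open>Serves twice: as the domination for differentiating \<open>outer_mean\<close>, and, by
  comparison with the angle \<pi>/2, for the integrability of \<open>inner_mean\<close>.\<close>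

lemma inner_mean_lip_angle:
  "\<bar>inner_mean \<theta> x - inner_mean \<tau> x\<bar> \<le> \<bar>\<theta> - \<tau>\<bar> * (norm x + (\<integral>z. norm z \<partial>gauss))"
proof -
  interpret P: prob_space gauss by (rule prob_space_gauss)
  have w: "integrable gauss (\<lambda>z. \<bar>\<theta> - \<tau>\<bar> * (norm x + norm z))"
    using integrable_gauss_norm by simp
  have i: "integrable gauss (\<lambda>z. norm (interp \<theta> x z - interp \<tau> x z))"
    by (rule Bochner_Integration.integrable_bound[OF w]) (use interp_lip in \<open>auto simp: interp_def intro!: AE_I2\<close>)
  have "\<bar>inner_mean \<theta> x - inner_mean \<tau> x\<bar> \<le> (\<integral>z. norm (interp \<theta> x z - interp \<tau> x z) \<partial>gauss)"
    by (rule inner_mean_lip[OF i])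
  also have "\<dots> \<le> (\<integral>z. \<bar>\<theta> - \<tau>\<bar> * (norm x + norm z) \<partial>gauss)"
    using i w interp_lip by (intro integral_mono) auto
  also have "\<dots> = \<bar>\<theta> - \<tau>\<bar> * (norm x + (\<integral>z. norm z \<partial>gauss))"
    using integrable_gauss_norm P.prob_space by simp
  finally show ?thesis .
qed

lemma inner_mean_cont: "continuous_on UNIV (inner_mean \<theta>)"
proof -
  interpret P: prob_space gauss by (rule prob_space_gauss)
  have eq: "norm (interp \<theta> x z - interp \<theta> y z) = \<bar>cos \<theta>\<bar> * norm (x - y)" for x y z
    by (simp add: interp_def flip: scaleR_diff_right)
  have "1-lipschitz_on UNIV (inner_mean \<theta>)"
  proof (rule lipschitz_onI)
    fix x y :: "complex ^ 'n"
    have "\<bar>inner_mean \<theta> x - inner_mean \<theta> y\<bar> \<le> \<bar>cos \<theta>\<bar> * norm (x - y)"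
      using inner_mean_lip[of \<theta> x \<theta> y] P.prob_space by (simp add: eq)
    also have "\<dots> \<le> 1 * norm (x - y)" by (intro mult_right_mono) auto
    finally show "dist (inner_mean \<theta> x) (inner_mean \<theta> y) \<le> 1 * dist x y"
      by (simp add: dist_norm)
  qed simp
  then show ?thesis by (rule lipschitz_on_continuous_on)
qed

lemma inner_mean_integrable: "integrable M (\<lambda>x. inner_mean \<theta> (X x))"
proof (rule Bochner_Integration.integrable_bound)
  interpret P: prob_space gauss by (rule prob_space_gauss)
  let ?b = "\<lambda>x. \<bar>inner_mean (pi / 2) 0\<bar> + \<bar>\<theta> - pi / 2\<bar> * (norm (X x) + (\<integral>z. norm z \<partial>gauss))"
  show "integrable M ?b" using X_integrable by simp
  show "(\<lambda>x. inner_mean \<theta> (X x)) \<in> borel_measurable M"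
    using inner_mean_cont X_measurable by (rule borel_measurable_continuous_on)
  show "AE x in M. norm (inner_mean \<theta> (X x)) \<le> norm (?b x)"
  proof (intro AE_I2)
    fix x
    \<comment> \<open>At \<pi>/2 the path has forgotten x, so the comparison value is a
      constant.\<close>
    have "inner_mean (pi / 2) (X x) = inner_mean (pi / 2) 0"
      by (simp add: inner_mean_def interp_def)
    then have "\<bar>inner_mean \<theta> (X x)\<bar> \<le> ?b x"
      using inner_mean_lip_angle[of \<theta> "X x" "pi / 2"] by linarith
    then show "norm (inner_mean \<theta> (X x)) \<le> norm (?b x)" by simp
  qed
qed

definition outer_mean :: "real \<Rightarrow> real" where
  "outer_mean \<theta> = (\<integral>x. inner_mean \<theta> (X x) \<partial>M)"

lemma outer_mean_has_derivative:
  shows "integrable M (\<lambda>x. inner_slope \<theta> (X x))"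
    and "(outer_mean has_real_derivative (\<integral>x. inner_slope \<theta> (X x) \<partial>M)) (at \<theta>)"
proof -
  have lip: "norm (inner_mean \<tau> (X x) - inner_mean \<theta> (X x)) \<le> norm (\<tau> - \<theta>) * (norm (X x) + (\<integral>z. norm z \<partial>gauss))"
    for \<tau> x
    using inner_mean_lip_angle by simp
  have w: "integrable M (\<lambda>x. norm (X x) + (\<integral>z. norm z \<partial>gauss))"
    using X_integrable by simp
  note d = has_derivative_integral_dominated[where f="\<lambda>\<theta> x. inner_mean \<theta> (X x)" and M=M,
      OF inner_mean_integrable inner_mean_has_derivative(2) lip w]
  show "integrable M (\<lambda>x. inner_slope \<theta> (X x))"
    using d(1)[where v=1] by simp
  show "(outer_mean has_real_derivative (\<integral>x. inner_slope \<theta> (X x) \<partial>M)) (at \<theta>)"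
    unfolding outer_mean_def[abs_def]
    by (rule has_derivative_imp_has_field_derivative[OF d(2)]) simp
qed

section \<open>The complex gradient and its Gaussian averages\<close>

definition grad :: "'n \<Rightarrow> complex ^ 'n \<Rightarrow> complex" where
  "grad k y = Complex (h' y (axis k 1)) (h' y (axis k \<i>))"

text \<open>\<open>grad\<close> packs the two real partial derivatives in one complex coordinate
  into a single number, twice the derivative of h in the conjugate variable. Real directional
  derivatives thereby become real parts of Hermitian pairings, the form in which \<Gamma> and
  \<Sigma> act.\<close>

lemma h'_grad: "h' y v = Re (\<Sum>k\<in>UNIV. grad k y * cnj (v $ k))"
proof -
  have "v = (\<Sum>k\<in>UNIV. Re (v $ k) *\<^sub>R axis k 1 + Im (v $ k) *\<^sub>R axis k \<i>)"
  proof (rule vec_eq_iff[THEN iffD2], rule allI)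
    fix i
    have "(\<Sum>k\<in>UNIV. Re (v $ k) *\<^sub>R axis k 1 + Im (v $ k) *\<^sub>R axis k \<i>) $ i =
      (\<Sum>k\<in>UNIV. if k = i then Re (v $ k) *\<^sub>R 1 + Im (v $ k) *\<^sub>R \<i> else 0)"
      unfolding sum_component by (rule sum.cong[OF refl]) (simp add: axis_def)
    also have "\<dots> = v $ i" by (simp add: complex_eq_iff)
    finally show "v $ i = (\<Sum>k\<in>UNIV. Re (v $ k) *\<^sub>R axis k 1 + Im (v $ k) *\<^sub>R axis k \<i>) $ i" by simp
  qed
  then have "h' y v = h' y (\<Sum>k\<in>UNIV. Re (v $ k) *\<^sub>R axis k 1 + Im (v $ k) *\<^sub>R axis k \<i>)" by simp
  also have "\<dots> = (\<Sum>k\<in>UNIV. Re (v $ k) * h' y (axis k 1) + Im (v $ k) * h' y (axis k \<i>))"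
    by (simp add: linear_sum[OF h'_linear] linear_add[OF h'_linear] linear_cmul[OF h'_linear])
  finally show ?thesis by (simp add: grad_def mult_ac)
qed

lemma grad_cont: "continuous_on UNIV (grad k)"
  unfolding grad_def[abs_def] Complex_eq by (intro continuous_intros h'_cont)

text \<open>A crude bound, for integrability and smoothing only; the final constant rests on
  \<open>h'_bound\<close>.\<close>

lemma grad_bounded: "cmod (grad k y) \<le> 2"
proof -
  have "cmod (grad k y) \<le> \<bar>h' y (axis k 1)\<bar> + \<bar>h' y (axis k \<i>)\<bar>"
    using cmod_le[of "grad k y"] by (simp add: grad_def)
  also have "\<dots> \<le> norm (axis k 1 :: complex ^ 'n) + norm (axis k \<i> :: complex ^ 'n)"
    by (intro add_mono h'_bound)
  finally show ?thesis by simp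
qed

lemma measurable_grad [measurable]: "grad k \<in> borel_measurable borel"
  using grad_cont by (rule borel_measurable_continuous_onI)

lemma grad_mult_integrable:
  assumes "integrable gauss g"
  shows "integrable gauss (\<lambda>z. grad k (interp \<theta> x z) * g z)"
proof (rule bounded_mult_integrable[of "\<lambda>z. grad k (interp \<theta> x z)" "\<lambda>z. z"])
  show "continuous_on UNIV (\<lambda>z. grad k (interp \<theta> x z))"
    unfolding interp_def by (intro continuous_on_compose2[OF grad_cont] continuous_intros) auto
  show "bounded (range (\<lambda>z. grad k (interp \<theta> x z)))"
    using grad_bounded by (auto simp: bounded_iff)
qed (use assms in auto)

lemma component_integrable:
  "integrable gauss (\<lambda>z. z $ j)" "integrable gauss (\<lambda>z. A z $ j)"
proof -
  have "z $ j = of_real (z \<bullet> axis j 1) + \<i> * of_real (z \<bullet> axis j \<i>)" for z :: "complex ^ 'n"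
    by (simp add: inner_axis complex_eq_iff)
  then show "integrable gauss (\<lambda>z. z $ j)"
    using integrable_gauss_inner by simp
  have "A z $ j = of_real (z \<bullet> A (axis j 1)) + \<i> * of_real (z \<bullet> A (axis j \<i>))" for z
    by (simp add: inner_axis complex_eq_iff flip: symm)
  then show "integrable gauss (\<lambda>z. A z $ j)"
    using integrable_gauss_inner by simp
qed

definition grad_mean :: "'n \<Rightarrow> real \<Rightarrow> complex ^ 'n \<Rightarrow> complex" where
  "grad_mean k \<theta> x = (\<integral>z. grad k (interp \<theta> x z) \<partial>gauss)"

text \<open>The weights are the components of \<zeta> = A z. The suffix of
  \<open>grad_moment_bar\<close> refers to the derivative \<open>wirtinger_bar\<close>: the
  conjugated weight belongs to \<open>grad_moment\<close>, the plain one to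
  \<open>grad_moment_bar\<close>.\<close>

definition grad_moment :: "'n \<Rightarrow> 'n \<Rightarrow> real \<Rightarrow> complex ^ 'n \<Rightarrow> complex" where
  "grad_moment j k \<theta> x = (\<integral>z. grad k (interp \<theta> x z) * cnj (A z $ j) \<partial>gauss)"

definition grad_moment_bar :: "'n \<Rightarrow> 'n \<Rightarrow> real \<Rightarrow> complex ^ 'n \<Rightarrow> complex" where
  "grad_moment_bar j k \<theta> x = (\<integral>z. grad k (interp \<theta> x z) * A z $ j \<partial>gauss)"

lemma smooth_bounded_grad_mean:
  assumes "sin \<theta> \<noteq> 0"
  shows "smooth_bounded (grad_mean k \<theta>)"
proof -
  have "grad_mean k \<theta> = conv (\<lambda>w. grad k (sin \<theta> *\<^sub>R w)) (cos \<theta> / sin \<theta>) (\<lambda>_. 1)"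
    unfolding grad_mean_def[abs_def] interp_def by (rule mean_eq_conv[OF measurable_grad assms])
  moreover have "smooth_bounded (conv (\<lambda>w. grad k (sin \<theta> *\<^sub>R w)) (cos \<theta> / sin \<theta>) (\<lambda>_. 1))"
    using grad_bounded
    by (intro smooth_bounded_conv gaussian_density_axioms real_polynomial_function.intros(2))
      (auto simp: bounded_iff)
  ultimately show ?thesis by simp
qed

text \<open>The logarithmic gradient of the density contributes 2 \<zeta>, whose 2 cancels the 1/2
  of the Wirtinger derivatives; the combinations Re \<zeta>_j \<mp> \<i> Im \<zeta>_j are the two
  weights. The factor sin \<theta> stays on the left to meet the one in the slope.\<close>

lemma wirtinger_grad_mean:
  assumes s: "sin \<theta> \<noteq> 0"
  shows "of_real (sin \<theta>) * wirtinger j (grad_mean k \<theta>) x = of_real (cos \<theta>) * grad_moment j k \<theta> x"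
    and "of_real (sin \<theta>) * wirtinger_bar j (grad_mean k \<theta>) x = of_real (cos \<theta>) * grad_moment_bar j k \<theta> x"
proof -
  let ?r = "cos \<theta> / sin \<theta>"
  have "(grad_mean k \<theta> has_derivative
      (\<lambda>v. \<integral>z. (2 * cos \<theta> / sin \<theta> * (A z \<bullet> v)) *\<^sub>R grad k (interp \<theta> x z) \<partial>gauss)) (at x)"
    unfolding grad_mean_def[abs_def] interp_def
    by (rule mean_has_derivative[OF measurable_grad grad_bounded s])
  note fr = frechet_derivative_at[OF this, symmetric]
  define R where "R = (\<integral>z. grad k (interp \<theta> x z) * of_real (Re (A z $ j)) \<partial>gauss)"
  define I where "I = (\<integral>z. grad k (interp \<theta> x z) * of_real (Im (A z $ j)) \<partial>gauss)"
  have int: "integrable gauss (\<lambda>z. grad k (interp \<theta> x z) * of_real (Re (A z $ j)))"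
    "integrable gauss (\<lambda>z. grad k (interp \<theta> x z) * of_real (Im (A z $ j)))"
    using component_integrable(2)[of j] by (auto intro!: grad_mult_integrable)
  have "frechet_derivative (grad_mean k \<theta>) (at x) (axis j 1) =
      (\<integral>z. of_real (2 * ?r) * (grad k (interp \<theta> x z) * of_real (Re (A z $ j))) \<partial>gauss)"
    unfolding fr by (rule Bochner_Integration.integral_cong[OF refl])
      (simp add: inner_axis scaleR_conv_of_real)
  then have 1: "frechet_derivative (grad_mean k \<theta>) (at x) (axis j 1) = of_real (2 * ?r) * R"
    unfolding R_def integral_mult_right_zero .
  have "frechet_derivative (grad_mean k \<theta>) (at x) (axis j \<i>) =
      (\<integral>z. of_real (2 * ?r) * (grad k (interp \<theta> x z) * of_real (Im (A z $ j))) \<partial>gauss)"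
    unfolding fr by (rule Bochner_Integration.integral_cong[OF refl])
      (simp add: inner_axis scaleR_conv_of_real)
  then have 2: "frechet_derivative (grad_mean k \<theta>) (at x) (axis j \<i>) = of_real (2 * ?r) * I"
    unfolding I_def integral_mult_right_zero .
  have cnj: "cnj a = of_real (Re a) - \<i> * of_real (Im a)" and id: "a = of_real (Re a) + \<i> * of_real (Im a)" for a
    by (simp_all add: complex_eq_iff)
  have "grad_moment j k \<theta> x = (\<integral>z. grad k (interp \<theta> x z) * of_real (Re (A z $ j))
      - \<i> * (grad k (interp \<theta> x z) * of_real (Im (A z $ j))) \<partial>gauss)"
    unfolding grad_moment_def by (subst cnj) (simp add: algebra_simps)
  then have 3: "grad_moment j k \<theta> x = R - \<i> * I"
    unfolding R_def I_def using int by simp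
  have "grad_moment_bar j k \<theta> x = (\<integral>z. grad k (interp \<theta> x z) * of_real (Re (A z $ j))
      + \<i> * (grad k (interp \<theta> x z) * of_real (Im (A z $ j))) \<partial>gauss)"
    unfolding grad_moment_bar_def
  proof (rule Bochner_Integration.integral_cong[OF refl])
    fix z
    show "grad k (interp \<theta> x z) * A z $ j = grad k (interp \<theta> x z) * of_real (Re (A z $ j))
      + \<i> * (grad k (interp \<theta> x z) * of_real (Im (A z $ j)))"
      by (subst id[of "A z $ j"]) (simp only: algebra_simps)
  qed
  then have 4: "grad_moment_bar j k \<theta> x = R + \<i> * I"
    unfolding R_def I_def using int by simp
  show "of_real (sin \<theta>) * wirtinger j (grad_mean k \<theta>) x = of_real (cos \<theta>) * grad_moment j k \<theta> x"
    "of_real (sin \<theta>) * wirtinger_bar j (grad_mean k \<theta>) x = of_real (cos \<theta>) * grad_moment_bar j k \<theta> x"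
    unfolding wirtinger_def wirtinger_bar_def 1 2 3 4 using s by (simp_all add: field_simps)
qed

text \<open>Away from cos \<theta> = 0 the moments are multiples of Wirtinger derivatives of a
  smooth bounded function, so continuity and boundedness carry over.\<close>

lemma grad_moment_cont:
  assumes "sin \<theta> \<noteq> 0" "cos \<theta> \<noteq> 0"
  shows "continuous_on UNIV (grad_moment j k \<theta>)" "bounded (range (grad_moment j k \<theta>))"
    and "continuous_on UNIV (grad_moment_bar j k \<theta>)" "bounded (range (grad_moment_bar j k \<theta>))"
proof -
  note w = smooth_bounded_wirtinger[OF smooth_bounded_grad_mean[OF assms(1)]]
  have 1: "grad_moment j k \<theta> = (\<lambda>x. of_real (sin \<theta> / cos \<theta>) * wirtinger j (grad_mean k \<theta>) x)"
    and 2: "grad_moment_bar j k \<theta> = (\<lambda>x. of_real (sin \<theta> / cos \<theta>) * wirtinger_bar j (grad_mean k \<theta>) x)"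
    using wirtinger_grad_mean[OF assms(1), of j k] assms(2) by (auto simp: fun_eq_iff field_simps)
  show "continuous_on UNIV (grad_moment j k \<theta>)" "continuous_on UNIV (grad_moment_bar j k \<theta>)"
    unfolding 1 2 by (intro continuous_intros w)+
  show "bounded (range (grad_moment j k \<theta>))"
    using bounded_linear_image[OF w(2) bounded_linear_mult_right[of "of_real (sin \<theta> / cos \<theta>)"]]
    unfolding 1 image_image .
  show "bounded (range (grad_moment_bar j k \<theta>))"
    using bounded_linear_image[OF w(4) bounded_linear_mult_right[of "of_real (sin \<theta> / cos \<theta>)"]]
    unfolding 2 image_image .
qed

section \<open>Splitting and bounding the slope\<close>

definition gauss_pairing :: "real \<Rightarrow> complex ^ 'n \<Rightarrow> real" where
  "gauss_pairing \<theta> x = Re (\<Sum>k\<in>UNIV. \<integral>z. grad k (interp \<theta> x z) * cnj (z $ k) \<partial>gauss)"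

definition mean_pairing :: "real \<Rightarrow> complex ^ 'n \<Rightarrow> real" where
  "mean_pairing \<theta> x = Re (\<Sum>k\<in>UNIV. grad_mean k \<theta> x * cnj (x $ k))"

text \<open>What integration by parts makes of \<open>mean_pairing\<close> under the integral over
  M, up to the factor cos \<theta> / sin \<theta>.\<close>

definition moment_pairing :: "real \<Rightarrow> 'a \<Rightarrow> real" where
  "moment_pairing \<theta> x = Re (\<Sum>k\<in>UNIV. \<Sum>j\<in>UNIV.
     grad_moment j k \<theta> (X x) * G x $ j $ k + grad_moment_bar j k \<theta> (X x) * G' x $ j $ k)"

lemma cnj_integrable: "integrable gauss g \<Longrightarrow> integrable gauss (\<lambda>z. cnj (g z))" for g :: "_ \<Rightarrow> complex"
  by simp

lemma grad_integrable: "integrable gauss (\<lambda>z. grad k (interp \<theta> x z))"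
proof -
  interpret P: prob_space gauss by (rule prob_space_gauss)
  show ?thesis using grad_mult_integrable[of "\<lambda>_. 1"] by simp
qed

lemma inner_slope_eq: "inner_slope \<theta> x = cos \<theta> * gauss_pairing \<theta> x - sin \<theta> * mean_pairing \<theta> x"
proof -
  let ?g = "\<lambda>k z. grad k (interp \<theta> x z)"
  have int: "integrable gauss (\<lambda>z. ?g k z * cnj (z $ k))" "integrable gauss (\<lambda>z. ?g k z * cnj (x $ k))" for k
    using grad_integrable by (auto intro!: grad_mult_integrable cnj_integrable component_integrable)
  have "h' (interp \<theta> x z) (velocity \<theta> x z) =
    Re (of_real (cos \<theta>) * (\<Sum>k\<in>UNIV. ?g k z * cnj (z $ k)) - of_real (sin \<theta>) * (\<Sum>k\<in>UNIV. ?g k z * cnj (x $ k)))" for z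
  proof -
    have "?g k z * cnj (velocity \<theta> x z $ k) =
        of_real (cos \<theta>) * (?g k z * cnj (z $ k)) - of_real (sin \<theta>) * (?g k z * cnj (x $ k))" for k
      unfolding velocity_def vector_minus_component vector_scaleR_component
      by (simp add: scaleR_conv_of_real right_diff_distrib mult.left_commute)
    then have "(\<Sum>k\<in>UNIV. ?g k z * cnj (velocity \<theta> x z $ k)) =
        of_real (cos \<theta>) * (\<Sum>k\<in>UNIV. ?g k z * cnj (z $ k)) - of_real (sin \<theta>) * (\<Sum>k\<in>UNIV. ?g k z * cnj (x $ k))"
      by (simp add: sum_subtractf sum_distrib_left)
    then show ?thesis
      by (subst h'_grad) (rule arg_cong[where f=Re])
  qed
  then have "inner_slope \<theta> x = Re (\<integral>z. of_real (cos \<theta>) * (\<Sum>k\<in>UNIV. ?g k z * cnj (z $ k))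
      - of_real (sin \<theta>) * (\<Sum>k\<in>UNIV. ?g k z * cnj (x $ k)) \<partial>gauss)"
    unfolding inner_slope_def
  proof (subst integral_Re[symmetric])
    show "integrable gauss (\<lambda>z. of_real (cos \<theta>) * (\<Sum>k\<in>UNIV. ?g k z * cnj (z $ k))
      - of_real (sin \<theta>) * (\<Sum>k\<in>UNIV. ?g k z * cnj (x $ k)))"
      by (intro Bochner_Integration.integrable_diff integrable_mult_right Bochner_Integration.integrable_sum int)
  qed (rule Bochner_Integration.integral_cong[OF refl])
  also have "(\<integral>z. of_real (cos \<theta>) * (\<Sum>k\<in>UNIV. ?g k z * cnj (z $ k))
      - of_real (sin \<theta>) * (\<Sum>k\<in>UNIV. ?g k z * cnj (x $ k)) \<partial>gauss) =
    of_real (cos \<theta>) * (\<Sum>k\<in>UNIV. \<integral>z. ?g k z * cnj (z $ k) \<partial>gauss)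
      - of_real (sin \<theta>) * (\<Sum>k\<in>UNIV. grad_mean k \<theta> x * cnj (x $ k))"
    using int by (simp add: grad_mean_def)
  finally show ?thesis
    unfolding gauss_pairing_def mean_pairing_def by simp
qed

text \<open>Written through \<zeta> by \<open>cnj_component\<close>, the Gaussian term is a pairing
  with cnj \<zeta> and coefficient matrix S, so G subtracts from S directly while G' remains with
  \<zeta>. Everything is recombined into one directional derivative, because estimating entry by
  entry would bring in the dimension.\<close>

lemma pairing_difference:
  "gauss_pairing \<theta> (X x) - moment_pairing \<theta> x =
    (\<integral>z. h' (interp \<theta> (X x) z) (\<chi> k. cnj (stein_vec (S - G x) (G' x) z $ k)) \<partial>gauss)"
proof -
  let ?g = "\<lambda>k z. grad k (interp \<theta> (X x) z)"
  have int: "integrable gauss (\<lambda>z. ?g k z * cnj (z $ k))" "integrable gauss (\<lambda>z. ?g k z * cnj (A z $ j))"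
     "integrable gauss (\<lambda>z. ?g k z * A z $ j)" for j k
    by (auto intro!: grad_mult_integrable cnj_integrable component_integrable)
  have vec: "?g k z * stein_vec (S - G x) (G' x) z $ k = ?g k z * cnj (z $ k)
      - (\<Sum>j\<in>UNIV. (?g k z * cnj (A z $ j)) * G x $ j $ k + (?g k z * A z $ j) * G' x $ j $ k)" for k z
    unfolding stein_vec_def cnj_component[of z k]
    by (simp add: sum_distrib_left sum_subtractf sum.distrib algebra_simps)
  have "(\<integral>z. h' (interp \<theta> (X x) z) (\<chi> k. cnj (stein_vec (S - G x) (G' x) z $ k)) \<partial>gauss) =
    (\<integral>z. Re (\<Sum>k\<in>UNIV. ?g k z * cnj (z $ k)
      - (\<Sum>j\<in>UNIV. (?g k z * cnj (A z $ j)) * G x $ j $ k + (?g k z * A z $ j) * G' x $ j $ k)) \<partial>gauss)"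
  proof (rule Bochner_Integration.integral_cong[OF refl])
    fix z
    have "h' (interp \<theta> (X x) z) (\<chi> k. cnj (stein_vec (S - G x) (G' x) z $ k)) =
        Re (\<Sum>k\<in>UNIV. ?g k z * stein_vec (S - G x) (G' x) z $ k)"
      by (subst h'_grad) simp
    then show "h' (interp \<theta> (X x) z) (\<chi> k. cnj (stein_vec (S - G x) (G' x) z $ k)) =
      Re (\<Sum>k\<in>UNIV. ?g k z * cnj (z $ k)
      - (\<Sum>j\<in>UNIV. (?g k z * cnj (A z $ j)) * G x $ j $ k + (?g k z * A z $ j) * G' x $ j $ k))"
      unfolding vec .
  qed
  also have "\<dots> = Re (\<integral>z. (\<Sum>k\<in>UNIV. ?g k z * cnj (z $ k)
      - (\<Sum>j\<in>UNIV. (?g k z * cnj (A z $ j)) * G x $ j $ k + (?g k z * A z $ j) * G' x $ j $ k)) \<partial>gauss)"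
    by (intro integral_Re Bochner_Integration.integrable_sum Bochner_Integration.integrable_diff
        Bochner_Integration.integrable_add integrable_mult_left int)
  also have "(\<integral>z. (\<Sum>k\<in>UNIV. ?g k z * cnj (z $ k)
      - (\<Sum>j\<in>UNIV. (?g k z * cnj (A z $ j)) * G x $ j $ k + (?g k z * A z $ j) * G' x $ j $ k)) \<partial>gauss) =
    (\<Sum>k\<in>UNIV. (\<integral>z. ?g k z * cnj (z $ k) \<partial>gauss)
      - (\<Sum>j\<in>UNIV. grad_moment j k \<theta> (X x) * G x $ j $ k + grad_moment_bar j k \<theta> (X x) * G' x $ j $ k))"
    using int unfolding grad_moment_def grad_moment_bar_def by simp
  finally show ?thesis
    by (simp add: gauss_pairing_def moment_pairing_def sum_subtractf)
qed

lemma moment_pairing_integrable: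
  assumes "sin \<theta> \<noteq> 0" "cos \<theta> \<noteq> 0"
  shows "integrable M (moment_pairing \<theta>)"
  unfolding moment_pairing_def[abs_def]
  by (intro integrable_Re Bochner_Integration.integrable_sum Bochner_Integration.integrable_add
      bounded_mult_integrable X_measurable G_integrable grad_moment_cont assms)

text \<open>The factor \<open>sin \<theta>\<close> of \<open>mean_pairing\<close> in the slope cancels the singularity of the smoothed derivative at
  \<open>\<theta> = 0\<close>, see \<open>wirtinger_grad_mean\<close>.\<close>

lemma mean_pairing_integral:
  assumes s: "sin \<theta> \<noteq> 0" and c: "cos \<theta> \<noteq> 0"
  shows "integrable M (\<lambda>x. mean_pairing \<theta> (X x))"
    and "sin \<theta> * (\<integral>x. mean_pairing \<theta> (X x) \<partial>M) = cos \<theta> * (\<integral>x. moment_pairing \<theta> x \<partial>M)"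
proof -
  note sb = smooth_bounded_grad_mean[OF s]
  have Xk: "integrable M (\<lambda>x. X x $ k)" for k
  proof (rule Bochner_Integration.integrable_bound[OF X_integrable])
    show "(\<lambda>x. X x $ k) \<in> borel_measurable M" by measurable
    show "AE x in M. cmod (X x $ k) \<le> norm (norm (X x))"
      by (intro AE_I2) (simp add: Finite_Cartesian_Product.norm_nth_le)
  qed
  have int: "integrable M (\<lambda>x. grad_mean k \<theta> (X x) * cnj (X x $ k))" for k
    using Xk by (intro bounded_mult_integrable smooth_bounded_imp_continuous_bounded sb X_measurable) simp
  then show "integrable M (\<lambda>x. mean_pairing \<theta> (X x))"
    unfolding mean_pairing_def by (intro integrable_Re Bochner_Integration.integrable_sum)
  let ?m = "\<lambda>k x. \<Sum>j\<in>UNIV. grad_moment j k \<theta> (X x) * G x $ j $ k + grad_moment_bar j k \<theta> (X x) * G' x $ j $ k"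
  have int_m: "integrable M (?m k)" for k
    by (intro Bochner_Integration.integrable_sum Bochner_Integration.integrable_add
      bounded_mult_integrable X_measurable G_integrable grad_moment_cont assms)
  have "of_real (sin \<theta>) * (\<integral>x. grad_mean k \<theta> (X x) * cnj (X x $ k) \<partial>M) = of_real (cos \<theta>) * (\<integral>x. ?m k x \<partial>M)" for k
  proof -
    have "of_real (sin \<theta>) * (\<integral>x. grad_mean k \<theta> (X x) * cnj (X x $ k) \<partial>M) =
      (\<integral>x. of_real (sin \<theta>) * (\<Sum>j\<in>UNIV. wirtinger j (grad_mean k \<theta>) (X x) * G x $ j $ k
        + wirtinger_bar j (grad_mean k \<theta>) (X x) * G' x $ j $ k) \<partial>M)"
      unfolding by_parts[OF sb] by (rule integral_mult_right_zero[symmetric])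
    also have "\<dots> = (\<integral>x. of_real (cos \<theta>) * ?m k x \<partial>M)"
      by (rule Bochner_Integration.integral_cong[OF refl])
        (simp only: sum_distrib_left distrib_left mult.assoc[symmetric] wirtinger_grad_mean[OF s])
    also have "\<dots> = of_real (cos \<theta>) * (\<integral>x. ?m k x \<partial>M)"
      by (rule integral_mult_right_zero)
    finally show ?thesis .
  qed
  then have "of_real (sin \<theta>) * (\<Sum>k\<in>UNIV. \<integral>x. grad_mean k \<theta> (X x) * cnj (X x $ k) \<partial>M) =
      of_real (cos \<theta>) * (\<Sum>k\<in>UNIV. \<integral>x. ?m k x \<partial>M)"
    by (simp add: sum_distrib_left)
  from arg_cong[OF this, of Re]
  have eq: "sin \<theta> * Re (\<Sum>k\<in>UNIV. \<integral>x. grad_mean k \<theta> (X x) * cnj (X x $ k) \<partial>M) =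
      cos \<theta> * Re (\<Sum>k\<in>UNIV. \<integral>x. ?m k x \<partial>M)" by simp
  have "(\<integral>x. mean_pairing \<theta> (X x) \<partial>M) = Re (\<integral>x. (\<Sum>k\<in>UNIV. grad_mean k \<theta> (X x) * cnj (X x $ k)) \<partial>M)"
    unfolding mean_pairing_def by (rule integral_Re, rule Bochner_Integration.integrable_sum) (rule int)
  then have 1: "(\<integral>x. mean_pairing \<theta> (X x) \<partial>M) = Re (\<Sum>k\<in>UNIV. \<integral>x. grad_mean k \<theta> (X x) * cnj (X x $ k) \<partial>M)"
    using int by (simp only: Bochner_Integration.integral_sum)
  have "(\<integral>x. moment_pairing \<theta> x \<partial>M) = Re (\<integral>x. (\<Sum>k\<in>UNIV. ?m k x) \<partial>M)"
    unfolding moment_pairing_def by (rule integral_Re, rule Bochner_Integration.integrable_sum) (rule int_m)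
  then have 2: "(\<integral>x. moment_pairing \<theta> x \<partial>M) = Re (\<Sum>k\<in>UNIV. \<integral>x. ?m k x \<partial>M)"
    using int_m by (simp only: Bochner_Integration.integral_sum)
  show "sin \<theta> * (\<integral>x. mean_pairing \<theta> (X x) \<partial>M) = cos \<theta> * (\<integral>x. moment_pairing \<theta> x \<partial>M)"
    unfolding 1 2 by (rule eq)
qed

lemma pairing_difference_bound:
  "\<bar>gauss_pairing \<theta> (X x) - moment_pairing \<theta> x\<bar> \<le> sqrt (2 * K) * sqrt (discrepancy x)"
proof -
  let ?w = "stein_vec (S - G x) (G' x)"
  have "\<bar>gauss_pairing \<theta> (X x) - moment_pairing \<theta> x\<bar> \<le>
      (\<integral>z. \<bar>h' (interp \<theta> (X x) z) (\<chi> k. cnj (?w z $ k))\<bar> \<partial>gauss)"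
    unfolding pairing_difference by (rule integral_abs_bound)
  also have "\<dots> \<le> (\<integral>z. norm (?w z) \<partial>gauss)"
  proof (rule integral_mono')
    show "integrable gauss (\<lambda>z. norm (?w z))" by (rule stein_vec_moment)
    show "\<bar>h' (interp \<theta> (X x) z) (\<chi> k. cnj (?w z $ k))\<bar> \<le> norm (?w z)" for z
      using h'_bound[of "interp \<theta> (X x) z" "\<chi> k. cnj (?w z $ k)"] by (simp add: norm_vec_def)
  qed simp
  also have "\<dots> \<le> sqrt (2 * K) * sqrt ((hs_norm (G' x))\<^sup>2 + (hs_norm (S - G x))\<^sup>2)"
    by (rule stein_vec_moment)
  also have "(hs_norm (S - G x))\<^sup>2 = (hs_norm (G x - S))\<^sup>2"
    by (simp add: hs_norm_power2 norm_minus_commute)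
  finally show ?thesis by (simp add: discrepancy_def)
qed

lemma outer_slope_bound:
  assumes s: "sin \<theta> \<noteq> 0" and c: "cos \<theta> > 0" and T: "integrable M discrepancy"
  shows "\<bar>\<integral>x. inner_slope \<theta> (X x) \<partial>M\<bar> \<le> cos \<theta> * (sqrt (2 * K) * sqrt (\<integral>x. discrepancy x \<partial>M))"
proof -
  have c0: "cos \<theta> \<noteq> 0" using c by simp
  note mp = mean_pairing_integral[OF s c0] and mo = moment_pairing_integrable[OF s c0]
  let ?r = "\<lambda>x. gauss_pairing \<theta> (X x) - moment_pairing \<theta> x"
  \<comment> \<open>The two terms besides the slope have equal integrals over M by
    \<open>mean_pairing_integral\<close>, so passing to cos \<theta> times \<open>?r\<close> leaves
    the integral of the slope unchanged.\<close>
  have r: "cos \<theta> * ?r x = inner_slope \<theta> (X x) + sin \<theta> * mean_pairing \<theta> (X x) - cos \<theta> * moment_pairing \<theta> x" for x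
    unfolding inner_slope_eq by (simp add: algebra_simps)
  have int_cr: "integrable M (\<lambda>x. cos \<theta> * ?r x)"
    unfolding r using outer_mean_has_derivative(1) mp(1) mo by simp
  then have int_r: "integrable M ?r"
    using c0 by simp
  have "(\<integral>x. inner_slope \<theta> (X x) \<partial>M) = (\<integral>x. cos \<theta> * ?r x \<partial>M)"
    unfolding r using outer_mean_has_derivative(1) mp mo by simp
  also have "\<dots> = cos \<theta> * (\<integral>x. ?r x \<partial>M)"
    by (rule integral_mult_right_zero)
  finally have "\<bar>\<integral>x. inner_slope \<theta> (X x) \<partial>M\<bar> = cos \<theta> * \<bar>\<integral>x. ?r x \<partial>M\<bar>"
    using c by (simp add: abs_mult)
  also have "\<bar>\<integral>x. ?r x \<partial>M\<bar> \<le> (\<integral>x. \<bar>?r x\<bar> \<partial>M)"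
    by (rule integral_abs_bound)
  also have "\<dots> \<le> (\<integral>x. sqrt (2 * K) * sqrt (discrepancy x) \<partial>M)"
  proof (rule integral_mono)
    show "integrable M (\<lambda>x. sqrt (2 * K) * sqrt (discrepancy x))"
      using integral_sqrt_le(1)[OF T] by (simp add: discrepancy_def)
  qed (use int_r pairing_difference_bound in auto)
  also have "\<dots> = sqrt (2 * K) * (\<integral>x. sqrt (discrepancy x) \<partial>M)" by simp
  also have "\<dots> \<le> sqrt (2 * K) * sqrt (\<integral>x. discrepancy x \<partial>M)"
    using integral_sqrt_le(2)[OF T] K_nonneg by (intro mult_left_mono) (auto simp: discrepancy_def)
  finally show ?thesis using c by (simp add: mult_left_mono)
qed

lemma stein_estimate:
  assumes T: "integrable M discrepancy"
  shows "\<bar>(\<integral>x. h (X x) \<partial>M) - (\<integral>z. h z \<partial>gauss)\<bar> \<le> sqrt (2 * K) * sqrt (\<integral>x. discrepancy x \<partial>M)"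
proof -
  interpret P: prob_space gauss by (rule prob_space_gauss)
  let ?C = "sqrt (2 * K) * sqrt (\<integral>x. discrepancy x \<partial>M)"
  have bound: "\<bar>\<integral>x. inner_slope \<theta> (X x) \<partial>M\<bar> \<le> cos \<theta> * ?C" if "0 < \<theta>" "\<theta> < pi / 2" for \<theta>
    using that sin_gt_zero[of \<theta>] cos_gt_zero[of \<theta>] by (intro outer_slope_bound T) auto
  have cont: "continuous_on {0..pi / 2} outer_mean"
    using outer_mean_has_derivative(2) by (meson DERIV_isCont continuous_at_imp_continuous_on)
  have "?C * sin 0 + outer_mean 0 \<le> ?C * sin (pi / 2) + outer_mean (pi / 2)"
  proof (rule DERIV_nonneg_imp_increasing_open[where f="\<lambda>\<theta>. ?C * sin \<theta> + outer_mean \<theta>"])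
    fix \<theta> :: real assume "0 < \<theta>" "\<theta> < pi / 2"
    then have "\<bar>\<integral>x. inner_slope \<theta> (X x) \<partial>M\<bar> \<le> ?C * cos \<theta>"
      using bound[of \<theta>] by (simp only: mult.commute)
    then have "0 \<le> ?C * cos \<theta> + (\<integral>x. inner_slope \<theta> (X x) \<partial>M)" by linarith
    moreover have "((\<lambda>\<theta>. ?C * sin \<theta> + outer_mean \<theta>) has_real_derivative
        ?C * cos \<theta> + (\<integral>x. inner_slope \<theta> (X x) \<partial>M)) (at \<theta>)"
      by (rule DERIV_add[OF DERIV_cmult[OF DERIV_sin] outer_mean_has_derivative(2)])
    ultimately show "\<exists>y. ((\<lambda>\<theta>. ?C * sin \<theta> + outer_mean \<theta>) has_real_derivative y) (at \<theta>) \<and> 0 \<le> y"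
      by blast
  qed (auto intro!: continuous_intros cont)
  moreover have "?C * sin 0 - outer_mean 0 \<le> ?C * sin (pi / 2) - outer_mean (pi / 2)"
  proof (rule DERIV_nonneg_imp_increasing_open[where f="\<lambda>\<theta>. ?C * sin \<theta> - outer_mean \<theta>"])
    fix \<theta> :: real assume "0 < \<theta>" "\<theta> < pi / 2"
    then have "\<bar>\<integral>x. inner_slope \<theta> (X x) \<partial>M\<bar> \<le> ?C * cos \<theta>"
      using bound[of \<theta>] by (simp only: mult.commute)
    then have "0 \<le> ?C * cos \<theta> - (\<integral>x. inner_slope \<theta> (X x) \<partial>M)" by linarith
    moreover have "((\<lambda>\<theta>. ?C * sin \<theta> - outer_mean \<theta>) has_real_derivative
        ?C * cos \<theta> - (\<integral>x. inner_slope \<theta> (X x) \<partial>M)) (at \<theta>)"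
      by (rule DERIV_diff[OF DERIV_cmult[OF DERIV_sin] outer_mean_has_derivative(2)])
    ultimately show "\<exists>y. ((\<lambda>\<theta>. ?C * sin \<theta> - outer_mean \<theta>) has_real_derivative y) (at \<theta>) \<and> 0 \<le> y"
      by blast
  qed (auto intro!: continuous_intros cont)
  ultimately have "\<bar>outer_mean 0 - outer_mean (pi / 2)\<bar> \<le> ?C" by simp
  moreover have "outer_mean 0 = (\<integral>x. h (X x) \<partial>M)"
    by (simp add: outer_mean_def inner_mean_def interp_def P.prob_space[simplified])
  moreover have "outer_mean (pi / 2) = (\<integral>z. h z \<partial>gauss)"
    by (simp add: outer_mean_def inner_mean_def interp_def prob_space)
  ultimately show ?thesis by simp
qed

end

section \<open>Lipschitz test functions\<close>

context stein_setting begin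

text \<open>The convolution calculus applies to bounded functions. Averaging h over shifts by
  \<epsilon> z keeps its Lipschitz constant and moves its values by at most \<epsilon> times the
  mean Gaussian norm.\<close>

lemma stein_estimate_bounded_lipschitz:
  fixes h :: "complex ^ 'n \<Rightarrow> real"
  assumes T: "integrable M discrepancy"
    and lip: "\<And>y z. \<bar>h y - h z\<bar> \<le> norm (y - z)" and B: "\<And>y. \<bar>h y\<bar> \<le> B"
  shows "\<bar>(\<integral>x. h (X x) \<partial>M) - (\<integral>z. h z \<partial>gauss)\<bar> \<le> sqrt (2 * K) * sqrt (\<integral>x. discrepancy x \<partial>M)"
proof -
  interpret P: prob_space gauss by (rule prob_space_gauss)
  let ?C = "sqrt (2 * K) * sqrt (\<integral>x. discrepancy x \<partial>M)"
  let ?m = "\<integral>z. norm z \<partial>gauss"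
  have "1-lipschitz_on UNIV h"
    using lip by (intro lipschitz_onI) (auto simp: dist_norm)
  then have [measurable]: "h \<in> borel_measurable borel"
    using lipschitz_on_continuous_on borel_measurable_continuous_onI by blast
  \<comment> \<open>The error occurs twice, once under the law of X and once under the
    Gaussian.\<close>
  have le: "\<bar>(\<integral>x. h (X x) \<partial>M) - (\<integral>z. h z \<partial>gauss)\<bar> \<le> ?C + 2 * (\<epsilon> * ?m)" if \<epsilon>: "\<epsilon> > 0" for \<epsilon>
  proof -
    define H where "H y = (\<integral>z. h (1 *\<^sub>R y + \<epsilon> *\<^sub>R z) \<partial>gauss)" for y
    let ?\<phi> = "\<lambda>w. h (\<epsilon> *\<^sub>R w)"
    have int: "integrable gauss (\<lambda>z. h (1 *\<^sub>R y + \<epsilon> *\<^sub>R z))" for y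
      using B by (intro P.integrable_const_bound[where B=B]) auto
    have \<phi>: "?\<phi> \<in> borel_measurable borel" "bounded (range ?\<phi>)"
      using B by (auto simp: bounded_iff)
    obtain q where q: "\<And>v. real_polynomial_function (q v)"
      "\<And>x. (conv ?\<phi> (1 / \<epsilon>) (\<lambda>_. 1) has_derivative (\<lambda>v. conv ?\<phi> (1 / \<epsilon>) (q v) x)) (at x)"
      using conv_kernel_derivative[OF \<phi> real_polynomial_function.intros(2)] by metis
    have H_eq: "H = conv ?\<phi> (1 / \<epsilon>) (\<lambda>_. 1)"
      unfolding H_def[abs_def] using \<epsilon> by (intro mean_eq_conv) auto
    have H_lip: "\<bar>H y - H z\<bar> \<le> norm (y - z)" for y z
    proof -
      have "H y - H z = (\<integral>w. h (1 *\<^sub>R y + \<epsilon> *\<^sub>R w) - h (1 *\<^sub>R z + \<epsilon> *\<^sub>R w) \<partial>gauss)"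
        unfolding H_def by (rule Bochner_Integration.integral_diff[OF int int, symmetric])
      also have "\<bar>\<dots>\<bar> \<le> (\<integral>w. \<bar>h (1 *\<^sub>R y + \<epsilon> *\<^sub>R w) - h (1 *\<^sub>R z + \<epsilon> *\<^sub>R w)\<bar> \<partial>gauss)"
        by (rule integral_abs_bound)
      also have "\<dots> \<le> (\<integral>w. norm (y - z) \<partial>gauss)"
      proof (rule integral_mono')
        show "\<bar>h (1 *\<^sub>R y + \<epsilon> *\<^sub>R w) - h (1 *\<^sub>R z + \<epsilon> *\<^sub>R w)\<bar> \<le> norm (y - z)" for w
          using lip[of "1 *\<^sub>R y + \<epsilon> *\<^sub>R w" "1 *\<^sub>R z + \<epsilon> *\<^sub>R w"] by simp
      qed auto
      finally show ?thesis using P.prob_space by simp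
    qed
    have close: "\<bar>H y - h y\<bar> \<le> \<epsilon> * ?m" for y
    proof -
      have "H y - h y = (\<integral>w. h (1 *\<^sub>R y + \<epsilon> *\<^sub>R w) - h y \<partial>gauss)"
        unfolding H_def using int[of y] P.prob_space by simp
      also have "\<bar>\<dots>\<bar> \<le> (\<integral>w. \<bar>h (1 *\<^sub>R y + \<epsilon> *\<^sub>R w) - h y\<bar> \<partial>gauss)"
        by (rule integral_abs_bound)
      also have "\<dots> \<le> (\<integral>w. \<epsilon> * norm w \<partial>gauss)"
      proof (rule integral_mono')
        show "integrable gauss (\<lambda>w. \<epsilon> * norm w)" using integrable_gauss_norm by simp
        show "\<bar>h (1 *\<^sub>R y + \<epsilon> *\<^sub>R w) - h y\<bar> \<le> \<epsilon> * norm w" for w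
          using lip[of "1 *\<^sub>R y + \<epsilon> *\<^sub>R w" y] \<epsilon> by simp
      qed (use \<epsilon> in auto)
      finally show ?thesis by simp
    qed
    interpret stein_test A \<kappa> K M X S G G' H "\<lambda>y v. conv ?\<phi> (1 / \<epsilon>) (q v) y"
    proof
      show "(H has_derivative (\<lambda>v. conv ?\<phi> (1 / \<epsilon>) (q v) y)) (at y)" for y
        unfolding H_eq by (rule q)
      show "continuous_on UNIV (\<lambda>y. conv ?\<phi> (1 / \<epsilon>) (q v) y)" for v
        by (rule continuous_on_conv[OF \<phi> q(1)])
    qed (rule H_lip)
    have HB: "\<bar>H y\<bar> \<le> B + \<epsilon> * ?m" for y
      using close[of y] B[of y] by linarith
    have iM: "integrable M (\<lambda>x. h (X x))" "integrable M (\<lambda>x. H (X x))"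
      by (rule integrable_const_bound[where B=B], use B in \<open>auto\<close>)
        (rule integrable_const_bound[where B="B + \<epsilon> * ?m"], use HB in \<open>auto\<close>)
    have iG: "integrable gauss h" "integrable gauss H"
      by (rule P.integrable_const_bound[where B=B], use B in \<open>auto\<close>)
        (rule P.integrable_const_bound[where B="B + \<epsilon> * ?m"], use HB in \<open>auto\<close>)
    have "\<bar>(\<integral>x. H (X x) \<partial>M) - (\<integral>x. h (X x) \<partial>M)\<bar> \<le> \<epsilon> * ?m"
    proof -
      have "(\<integral>x. H (X x) \<partial>M) - (\<integral>x. h (X x) \<partial>M) = (\<integral>x. H (X x) - h (X x) \<partial>M)"
        using iM by simp
      also have "\<bar>\<dots>\<bar> \<le> (\<integral>x. \<bar>H (X x) - h (X x)\<bar> \<partial>M)" by (rule integral_abs_bound)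
      also have "\<dots> \<le> (\<integral>x. \<epsilon> * ?m \<partial>M)"
        using iM close by (intro integral_mono) auto
      finally show ?thesis using prob_space by simp
    qed
    moreover have "\<bar>(\<integral>z. H z \<partial>gauss) - (\<integral>z. h z \<partial>gauss)\<bar> \<le> \<epsilon> * ?m"
    proof -
      have "(\<integral>z. H z \<partial>gauss) - (\<integral>z. h z \<partial>gauss) = (\<integral>z. H z - h z \<partial>gauss)"
        using iG by simp
      also have "\<bar>\<dots>\<bar> \<le> (\<integral>z. \<bar>H z - h z\<bar> \<partial>gauss)" by (rule integral_abs_bound)
      also have "\<dots> \<le> (\<integral>z. \<epsilon> * ?m \<partial>gauss)"
        using iG close by (intro integral_mono) auto
      finally show ?thesis using P.prob_space by simp
    qed
    moreover have "\<bar>(\<integral>x. H (X x) \<partial>M) - (\<integral>z. H z \<partial>gauss)\<bar> \<le> ?C"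
      by (rule stein_estimate[OF T])
    ultimately show ?thesis by linarith
  qed
  have "((\<lambda>\<epsilon>. ?C + 2 * (\<epsilon> * ?m)) \<longlongrightarrow> ?C + 2 * (0 * ?m)) (at_right 0)"
    by (intro tendsto_intros)
  moreover have "\<forall>\<^sub>F \<epsilon> in at_right 0. \<bar>(\<integral>x. h (X x) \<partial>M) - (\<integral>z. h z \<partial>gauss)\<bar> \<le> ?C + 2 * (\<epsilon> * ?m)"
    using eventually_at_right_less[of "0::real"] by eventually_elim (rule le)
  ultimately have "\<bar>(\<integral>x. h (X x) \<partial>M) - (\<integral>z. h z \<partial>gauss)\<bar> \<le> ?C + 2 * (0 * ?m)"
    by (rule tendsto_lowerbound) simp
  then show ?thesis by simp
qed

lemma stein_estimate_lipschitz:
  fixes h :: "complex ^ 'n \<Rightarrow> real"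
  assumes T: "integrable M discrepancy"
    and lip: "\<And>y z. \<bar>h y - h z\<bar> \<le> norm (y - z)"
  shows "\<bar>(\<integral>x. h (X x) \<partial>M) - (\<integral>z. h z \<partial>gauss)\<bar> \<le> sqrt (2 * K) * sqrt (\<integral>x. discrepancy x \<partial>M)"
proof -
  interpret P: prob_space gauss by (rule prob_space_gauss)
  have "1-lipschitz_on UNIV h"
    using lip by (intro lipschitz_onI) (auto simp: dist_norm)
  then have [measurable]: "h \<in> borel_measurable borel"
    using lipschitz_on_continuous_on borel_measurable_continuous_onI by blast
  \<comment> \<open>Clamping to [-n, n] is 1-Lipschitz, so no constant is lost. At each point the
    clamped values eventually equal those of h, and all are dominated by |h 0| + |y|.\<close>
  define t where "t n y = max (- real n) (min (real n) (h y))" for n y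
  have t_lim: "(\<lambda>n. t n y) \<longlonglongrightarrow> h y" for y
  proof (rule tendsto_eventually)
    obtain n0 where n0: "\<bar>h y\<bar> \<le> real n0" using real_arch_simple by blast
    show "\<forall>\<^sub>F n in sequentially. t n y = h y"
      using n0 by (intro eventually_sequentiallyI[of n0]) (auto simp: t_def)
  qed
  have t_le: "\<bar>t n y\<bar> \<le> \<bar>h 0\<bar> + norm y" for n y
    using lip[of y 0] by (auto simp: t_def)
  have [measurable]: "t n \<in> borel_measurable borel" for n
    unfolding t_def[abs_def] by measurable
  have "(\<lambda>n. \<integral>x. t n (X x) \<partial>M) \<longlonglongrightarrow> (\<integral>x. h (X x) \<partial>M)"
    using X_integrable t_lim t_le
    by (intro integral_dominated_convergence[where w="\<lambda>x. \<bar>h 0\<bar> + norm (X x)"]) auto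
  moreover have "(\<lambda>n. \<integral>z. t n z \<partial>gauss) \<longlonglongrightarrow> (\<integral>z. h z \<partial>gauss)"
    using integrable_gauss_norm t_lim t_le
    by (intro integral_dominated_convergence[where w="\<lambda>z. \<bar>h 0\<bar> + norm z"]) auto
  ultimately have "(\<lambda>n. \<bar>(\<integral>x. t n (X x) \<partial>M) - (\<integral>z. t n z \<partial>gauss)\<bar>) \<longlonglongrightarrow> \<bar>(\<integral>x. h (X x) \<partial>M) - (\<integral>z. h z \<partial>gauss)\<bar>"
    by (intro tendsto_intros)
  moreover have "\<bar>(\<integral>x. t n (X x) \<partial>M) - (\<integral>z. t n z \<partial>gauss)\<bar> \<le> sqrt (2 * K) * sqrt (\<integral>x. discrepancy x \<partial>M)" for n
  proof (rule stein_estimate_bounded_lipschitz[OF T])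
    show "\<bar>t n y - t n z\<bar> \<le> norm (y - z)" for y z
      using lip[of y z] by (auto simp: t_def max_def min_def)
    show "\<bar>t n y\<bar> \<le> real n" for y
      by (auto simp: t_def)
  qed
  ultimately show ?thesis
    by (intro LIMSEQ_le_const2) auto
qed

text \<open>A rotation makes the difference of the two integrals real and nonnegative, and the real
  part of the rotated h is still 1-Lipschitz. Treating real and imaginary part separately would lose
  a factor sqrt 2.\<close>

lemma stein_estimate_complex:
  fixes h :: "complex ^ 'n \<Rightarrow> complex"
  assumes T: "integrable M discrepancy" and lip: "1-lipschitz_on UNIV h"
  shows "cmod ((\<integral>x. h (X x) \<partial>M) - (\<integral>z. h z \<partial>gauss)) \<le> sqrt (2 * K) * sqrt (\<integral>x. discrepancy x \<partial>M)"
proof -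
  interpret P: prob_space gauss by (rule prob_space_gauss)
  have [measurable]: "h \<in> borel_measurable borel"
    using lip lipschitz_on_continuous_on borel_measurable_continuous_onI by blast
  have h_le: "cmod (h y) \<le> cmod (h 0) + norm y" for y
    using lipschitz_onD[OF lip, of y 0] norm_triangle_sub[of "h y" "h 0"] by (simp add: dist_norm)
  have iM: "integrable M (\<lambda>x. h (X x))"
  proof (rule Bochner_Integration.integrable_bound)
    show "integrable M (\<lambda>x. cmod (h 0) + norm (X x))" using X_integrable by simp
  qed (use h_le in \<open>auto intro!: AE_I2\<close>)
  have iG: "integrable gauss h"
  proof (rule Bochner_Integration.integrable_bound)
    show "integrable gauss (\<lambda>z. cmod (h 0) + norm z)" using integrable_gauss_norm by simp
  qed (use h_le in \<open>auto intro!: AE_I2\<close>)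
  define I where "I = (\<integral>x. h (X x) \<partial>M) - (\<integral>z. h z \<partial>gauss)"
  define u where "u = cnj (sgn I)"
  \<comment> \<open>Only an inequality, since sgn 0 = 0.\<close>
  have u: "cmod u \<le> 1" by (simp add: u_def norm_sgn)
  have "u * I = of_real (cmod I)"
  proof -
    have "u * I = I * cnj I / of_real (cmod I)"
      by (simp add: u_def sgn_eq)
    then show ?thesis
      by (simp add: complex_norm_square[symmetric] power2_eq_square)
  qed
  then have "cmod I = Re (u * I)" by simp
  also have "\<dots> = (\<integral>x. Re (u * h (X x)) \<partial>M) - (\<integral>z. Re (u * h z) \<partial>gauss)"
    using iM iG by (subst (1 2) integral_Re) (simp_all add: I_def right_diff_distrib)
  also have "\<dots> \<le> \<bar>(\<integral>x. Re (u * h (X x)) \<partial>M) - (\<integral>z. Re (u * h z) \<partial>gauss)\<bar>"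
    by (rule abs_ge_self)
  also have "\<dots> \<le> sqrt (2 * K) * sqrt (\<integral>x. discrepancy x \<partial>M)"
  proof (rule stein_estimate_lipschitz[OF T])
    fix y z
    have "\<bar>Re (u * h y) - Re (u * h z)\<bar> = \<bar>Re (u * (h y - h z))\<bar>"
      by (simp add: right_diff_distrib)
    also have "\<dots> \<le> cmod u * cmod (h y - h z)"
      using abs_Re_le_cmod[of "u * (h y - h z)"] by (simp add: norm_mult)
    also have "\<dots> \<le> 1 * norm (y - z)"
      using u lipschitz_onD[OF lip, of y z] by (intro mult_mono) (auto simp: dist_norm)
    finally show "\<bar>Re (u * h y) - Re (u * h z)\<bar> \<le> norm (y - z)" by simp
  qed
  finally show ?thesis by (simp add: I_def)
qed

end

section \<open>Hermitian covariance matrices\<close>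

lemma Re_sesq_form: "Re (sesq_form A z) = z \<bullet> (A *v z)"
  by (simp add: sesq_form_def inner_vec_def inner_complex_def)

text \<open>The real inner product is the real part of the Hermitian one, so conjugate symmetry of
  the matrix becomes symmetry of a real linear map.\<close>

lemma hermitian_inner:
  fixes A :: "complex ^ 'n ^ 'n"
  assumes "conj_transpose A = A"
  shows "(A *v x) \<bullet> y = x \<bullet> (A *v y)"
proof -
  have A: "cnj (A $ j $ i) = A $ i $ j" for i j
    using assms by (metis (no_types) conj_transpose_def vec_lambda_beta)
  have form: "v \<bullet> w = Re (\<Sum>i\<in>UNIV. v $ i * cnj (w $ i))" for v w :: "complex ^ 'n"
    by (simp add: inner_vec_def inner_complex_def)
  have "(\<Sum>i\<in>UNIV. (A *v x) $ i * cnj (y $ i)) = (\<Sum>i\<in>UNIV. \<Sum>j\<in>UNIV. A $ i $ j * x $ j * cnj (y $ i))"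
    by (simp add: matrix_vector_mult_def sum_distrib_right)
  also have "\<dots> = (\<Sum>j\<in>UNIV. \<Sum>i\<in>UNIV. A $ i $ j * x $ j * cnj (y $ i))"
    by (rule sum.swap)
  also have "\<dots> = (\<Sum>j\<in>UNIV. x $ j * cnj ((A *v y) $ j))"
    by (simp add: matrix_vector_mult_def sum_distrib_left A mult_ac)
  finally show ?thesis unfolding form by simp
qed

lemma hermitian_pos_def_invertible:
  fixes \<Sigma> :: "complex ^ 'n ^ 'n"
  assumes "hermitian_pos_def \<Sigma>"
  shows "invertible \<Sigma>"
proof -
  have "x = 0" if "\<Sigma> *v x = 0" for x
    using assms that by (auto simp: hermitian_pos_def_def Re_sesq_form)
  then show ?thesis
    unfolding invertible_left_inverse matrix_left_invertible_ker by blast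
qed

lemma matrix_inv_inverse:
  fixes \<Sigma> :: "complex ^ 'n ^ 'n"
  assumes "invertible \<Sigma>"
  shows "\<Sigma> *v (matrix_inv \<Sigma> *v z) = z" "matrix_inv \<Sigma> *v (\<Sigma> *v z) = z"
proof -
  have "\<Sigma> ** matrix_inv \<Sigma> = mat 1 \<and> matrix_inv \<Sigma> ** \<Sigma> = mat 1"
    using assms unfolding invertible_def matrix_inv_def by (rule someI_ex)
  then show "\<Sigma> *v (matrix_inv \<Sigma> *v z) = z" "matrix_inv \<Sigma> *v (\<Sigma> *v z) = z"
    by (simp_all add: matrix_vector_mul_assoc)
qed

lemma norm_matrix_vector_le: "norm (A *v z) \<le> op_norm A * norm z" for A :: "complex ^ 'n ^ 'n"
  unfolding op_norm_def by (intro onorm matrix_vector_mul_bounded_linear)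

text \<open>Apply \<Sigma> after its inverse to a unit vector.\<close>

lemma op_norm_inverse:
  fixes \<Sigma> :: "complex ^ 'n ^ 'n"
  assumes "invertible \<Sigma>"
  shows "1 \<le> op_norm (matrix_inv \<Sigma>) * op_norm \<Sigma>"
proof -
  let ?e = "axis undefined 1 :: complex ^ 'n"
  have "op_norm \<Sigma> \<ge> 0"
    unfolding op_norm_def by (intro onorm_pos_le matrix_vector_mul_bounded_linear)
  then have "norm (\<Sigma> *v (matrix_inv \<Sigma> *v ?e)) \<le> op_norm \<Sigma> * (op_norm (matrix_inv \<Sigma>) * norm ?e)"
    by (intro order_trans[OF norm_matrix_vector_le] mult_left_mono norm_matrix_vector_le)
  then show ?thesis
    by (simp add: matrix_inv_inverse[OF assms] mult.commute)
qed

text \<open>Since Z lives on a probability space and has this density, the density integrates to 1;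
  this replaces the evaluation of the Gaussian integral by a determinant. Symmetry and positivity of
  the inverse follow from those of \<Sigma> at the vectors \<Sigma>^{-1} x.\<close>

lemma complex_gaussian_matrix_inv:
  fixes \<Sigma> :: "complex ^ 'n ^ 'n"
  assumes \<Sigma>: "hermitian_pos_def \<Sigma>" and N: "prob_space N" and Z: "complex_normal N Z \<Sigma>"
  defines "\<kappa> \<equiv> 1 / (pi ^ CARD('n) * cmod (det \<Sigma>))"
  shows "complex_gaussian (\<lambda>v. matrix_inv \<Sigma> *v v) \<kappa> (op_norm (matrix_inv \<Sigma>))"
    and "distr N lborel Z = density lborel (\<lambda>z. ennreal (\<kappa> * exp (- (z \<bullet> (matrix_inv \<Sigma> *v z)))))"
proof -
  let ?Q = "matrix_inv \<Sigma>"
  have inv: "invertible \<Sigma>" by (rule hermitian_pos_def_invertible[OF \<Sigma>])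
  note Q = matrix_inv_inverse[OF inv]
  have herm: "conj_transpose \<Sigma> = \<Sigma>" using \<Sigma> by (simp add: hermitian_pos_def_def)
  have dens: "complex_normal_density \<Sigma> = (\<lambda>z. \<kappa> * exp (- (z \<bullet> (?Q *v z))))"
    by (simp add: complex_normal_density_def \<kappa>_def Re_sesq_form fun_eq_iff)
  have \<kappa>: "\<kappa> > 0" using inv by (simp add: \<kappa>_def invertible_det_nz)
  show distr: "distr N lborel Z = density lborel (\<lambda>z. ennreal (\<kappa> * exp (- (z \<bullet> (?Q *v z)))))"
    using Z distributed_distr_eq_density unfolding complex_normal_def dens by blast
  have meas: "(\<lambda>z. \<kappa> * exp (- (z \<bullet> (?Q *v z)))) \<in> borel_measurable lborel"
    by (intro borel_measurable_continuous_onI[THEN borel_measurable_subalgebra[rotated 2]] continuous_intros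
        bounded_linear.continuous_on[OF matrix_vector_mul_bounded_linear]) auto
  have Zm: "Z \<in> measurable N lborel"
    using Z distributed_measurable unfolding complex_normal_def by blast
  have "prob_space (distr N lborel Z)"
    using N Zm by (rule prob_space.prob_space_distr)
  then have "emeasure (density lborel (\<lambda>z. ennreal (\<kappa> * exp (- (z \<bullet> (?Q *v z)))))) UNIV = 1"
    using prob_space.emeasure_space_1[of "distr N lborel Z"] by (simp add: distr)
  then have "(\<integral>\<^sup>+z. ennreal (\<kappa> * exp (- (z \<bullet> (?Q *v z)))) \<partial>lborel) = ennreal 1"
    using meas by (simp add: emeasure_density)
  then have total: "has_bochner_integral lborel (\<lambda>z. \<kappa> * exp (- (z \<bullet> (?Q *v z)))) 1"
    using meas \<kappa> by (intro has_bochner_integral_nn_integral AE_I2) auto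
  have symm: "(?Q *v x) \<bullet> y = x \<bullet> (?Q *v y)" for x y
    using hermitian_inner[OF herm, of "?Q *v x" "?Q *v y"] by (simp add: Q)
  have pos: "x \<bullet> (?Q *v x) > 0" if "x \<noteq> 0" for x
  proof -
    have "?Q *v x \<noteq> 0" using that Q(1)[of x] by auto
    then have "0 < (?Q *v x) \<bullet> (\<Sigma> *v (?Q *v x))"
      using \<Sigma> by (simp add: hermitian_pos_def_def Re_sesq_form)
    then show ?thesis by (simp add: Q inner_commute)
  qed
  show "complex_gaussian (\<lambda>v. ?Q *v v) \<kappa> (op_norm ?Q)"
  proof (intro complex_gaussian.intro gaussian_density.intro complex_gaussian_axioms.intro)
    show "linear (\<lambda>v. ?Q *v v)"
      by (rule bounded_linear.linear) simp
    show "v \<bullet> (?Q *v v) \<le> op_norm ?Q * (norm v)\<^sup>2" for v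
    proof -
      have "v \<bullet> (?Q *v v) \<le> norm v * norm (?Q *v v)" by (rule norm_cauchy_schwarz)
      also have "\<dots> \<le> norm v * (op_norm ?Q * norm v)"
        by (intro mult_left_mono norm_matrix_vector_le) simp
      finally show ?thesis by (simp add: power2_eq_square mult_ac)
    qed
  qed (use symm pos \<kappa> total in auto)
qed

text \<open>Conjugating z = \<Sigma> \<zeta> transposes \<Sigma>, which brings the indices into the
  order used for \<Gamma>.\<close>

lemma cnj_matrix_inv_component:
  fixes \<Sigma> :: "complex ^ 'n ^ 'n"
  assumes "hermitian_pos_def \<Sigma>"
  shows "cnj (z $ k) = (\<Sum>j\<in>UNIV. cnj ((matrix_inv \<Sigma> *v z) $ j) * \<Sigma> $ j $ k)"
proof -
  have A: "cnj (\<Sigma> $ j $ i) = \<Sigma> $ i $ j" for i j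
    using assms unfolding hermitian_pos_def_def by (metis (no_types) conj_transpose_def vec_lambda_beta)
  have "z $ k = (\<Sigma> *v (matrix_inv \<Sigma> *v z)) $ k"
    by (simp add: matrix_inv_inverse hermitian_pos_def_invertible assms)
  also have "\<dots> = (\<Sum>j\<in>UNIV. \<Sigma> $ k $ j * (matrix_inv \<Sigma> *v z) $ j)"
    by (simp add: matrix_vector_mult_def)
  finally show ?thesis
    by (simp add: A mult.commute)
qed

theorem theorem4p4:
  fixes M :: "'a measure" and N :: "'b measure"
    and D A0 :: "('a \<Rightarrow> complex) set"
    and L :: "('a \<Rightarrow> complex) \<Rightarrow> 'a \<Rightarrow> complex"
    and ev :: "nat \<Rightarrow> real"
    and \<Sigma> :: "complex ^ 'n ^ 'n"
    and Z :: "'b \<Rightarrow> complex ^ 'n"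
    and F :: "'n \<Rightarrow> 'a \<Rightarrow> complex"
  assumes generator: "complex_markov_diffusion TYPE('n::finite) M D L ev A0"
    and Sigma: "hermitian_pos_def \<Sigma>"
    and Z: "prob_space N" "complex_normal N Z \<Sigma>"
    and F: "\<And>j. F j \<in> A0"
    and F_inverse: "\<And>j. F j \<in> op_inv_dom M D L" "\<And>j. op_inv M D L (F j) \<in> A0"
  shows "wasserstein M (rvec F) N Z \<le>
    ennreal (2 * op_norm (matrix_inv \<Sigma>) * sqrt (op_norm \<Sigma>)) *
    ennsqrt ((\<integral>\<^sup>+x. ennreal ((hs_norm (Gamma_inv M D L (\<lambda>j. cconj (F j)) F x))\<^sup>2) \<partial>M)
           + (\<integral>\<^sup>+x. ennreal ((hs_norm (Gamma_inv M D L F F x - \<Sigma>))\<^sup>2) \<partial>M))"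
proof -
  interpret complex_markov_diffusion M "TYPE('n)" D L ev A0 by (fact generator)
  let ?G = "Gamma_inv M D L F F" and ?G' = "Gamma_inv M D L (\<lambda>j. cconj (F j)) F"
  let ?Q = "matrix_inv \<Sigma>"
  define \<kappa> where "\<kappa> = 1 / (pi ^ CARD('n) * cmod (det \<Sigma>))"
  note gaussian = complex_gaussian_matrix_inv[OF Sigma Z, folded \<kappa>_def]
  have rvec_meas: "rvec F \<in> borel_measurable M" by (intro measurable_rvec A0_measurable F)
  have rvec_norm: "integrable M (\<lambda>x. norm (rvec F x))"
  proof (rule Bochner_Integration.integrable_bound)
    show "integrable M (\<lambda>x. \<Sum>j\<in>UNIV. cmod (F j x))"
      by (intro Bochner_Integration.integrable_sum integrable_norm L2_integrable D_L2 A0_D F)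
    show "(\<lambda>x. norm (rvec F x)) \<in> borel_measurable M"
      using rvec_meas by simp
    show "AE x in M. norm (norm (rvec F x)) \<le> norm (\<Sum>j\<in>UNIV. cmod (F j x))"
    proof (intro AE_I2)
      fix x
      have "norm (rvec F x) \<le> (\<Sum>j\<in>UNIV. cmod (F j x))"
        unfolding norm_vec_def rvec_def using L2_set_le_sum[of UNIV "\<lambda>j. cmod (F j x)"] by simp
      then show "norm (norm (rvec F x)) \<le> norm (\<Sum>j\<in>UNIV. cmod (F j x))" by simp
    qed
  qed
  interpret complex_gaussian "\<lambda>v. ?Q *v v" \<kappa> "op_norm ?Q" by (rule gaussian(1))
  interpret stein_setting "\<lambda>v. ?Q *v v" \<kappa> "op_norm ?Q" M "rvec F" \<Sigma> ?G ?G'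
  proof unfold_locales
    show "rvec F \<in> borel_measurable M" by (rule rvec_meas)
    show "integrable M (\<lambda>x. norm (rvec F x))" by (rule rvec_norm)
    show "integrable M (\<lambda>x. ?G x $ j $ k)" "integrable M (\<lambda>x. ?G' x $ j $ k)" for j k
      by (intro Gamma_inv_integrable F A0_cnj F_inverse)+
    show "(\<integral>x. \<phi> (rvec F x) * cnj (rvec F x $ k) \<partial>M) =
      (\<integral>x. (\<Sum>j\<in>UNIV. wirtinger j \<phi> (rvec F x) * ?G x $ j $ k + wirtinger_bar j \<phi> (rvec F x) * ?G' x $ j $ k) \<partial>M)"
      if "smooth_bounded \<phi>" for \<phi> k
      using integration_by_parts[where F=F and k=k, OF that F F_inverse] by (simp add: rvec_def)
    show "cnj (z $ k) = (\<Sum>j\<in>UNIV. cnj ((?Q *v z) $ j) * \<Sigma> $ j $ k)" for z k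
      by (rule cnj_matrix_inv_component[OF Sigma])
  qed
  have distr: "distr N lborel Z = gauss"
    unfolding gauss_def dens_def by (rule gaussian(2))
  have Z_measurable: "Z \<in> measurable N lborel"
    using Z(2) distributed_measurable unfolding complex_normal_def by blast
  have ops: "1 \<le> op_norm ?Q * op_norm \<Sigma>"
    by (rule op_norm_inverse[OF hermitian_pos_def_invertible[OF Sigma]])
  have Q_pos: "op_norm ?Q > 0" and \<Sigma>_pos: "op_norm \<Sigma> > 0"
    using ops K_nonneg by (auto simp: zero_less_mult_iff dest!: order.strict_trans2[OF zero_less_one])
  define c where "c = 2 * op_norm ?Q * sqrt (op_norm \<Sigma>)"
  have c: "c > 0" using Q_pos \<Sigma>_pos by (simp add: c_def)
  have sqrt_le: "sqrt (2 * op_norm ?Q) \<le> c"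
  proof (rule real_le_lsqrt)
    \<comment> \<open>Here 1 \<le> ||\<Sigma>^{-1}|| ||\<Sigma>|| turns 2 ||\<Sigma>^{-1}|| into at
      most 4 ||\<Sigma>^{-1}||^2 ||\<Sigma>||, the square of the stated constant.\<close>
    have "2 * op_norm ?Q * 1 \<le> 2 * op_norm ?Q * (2 * (op_norm ?Q * op_norm \<Sigma>))"
      using Q_pos ops by (intro mult_left_mono) auto
    also have "\<dots> = c\<^sup>2"
      using \<Sigma>_pos by (simp add: c_def power2_eq_square)
    finally show "2 * op_norm ?Q \<le> c\<^sup>2" by simp
  qed (use c in auto)
  have G_meas: "(\<lambda>x. (hs_norm (?G' x))\<^sup>2) \<in> borel_measurable M" "(\<lambda>x. (hs_norm (?G x - \<Sigma>))\<^sup>2) \<in> borel_measurable M"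
    unfolding hs_norm_power2 using G_integrable by (auto intro!: borel_measurable_sum)
  have nn: "(\<integral>\<^sup>+x. ennreal ((hs_norm (?G' x))\<^sup>2) \<partial>M) + (\<integral>\<^sup>+x. ennreal ((hs_norm (?G x - \<Sigma>))\<^sup>2) \<partial>M)
      = (\<integral>\<^sup>+x. ennreal (discrepancy x) \<partial>M)"
    unfolding discrepancy_def using G_meas by (subst nn_integral_add[symmetric]) auto
  have discrepancy_nonneg: "0 \<le> discrepancy x" for x by (simp add: discrepancy_def)
  have "wasserstein M (rvec F) N Z \<le> ennreal c * ennsqrt (\<integral>\<^sup>+x. ennreal (discrepancy x) \<partial>M)"
  \<comment> \<open>An infinite discrepancy makes the right-hand side infinite because c > 0; a
    finite one is a Bochner integral, to which the estimate applies.\<close>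
  proof (cases "(\<integral>\<^sup>+x. ennreal (discrepancy x) \<partial>M) = \<infinity>")
    case True
    then show ?thesis using c by (simp add: ennsqrt_def ennreal_mult_top)
  next
    case False
    have T: "integrable M discrepancy"
      using False G_meas discrepancy_nonneg
      by (intro integrableI_nonneg) (auto simp: discrepancy_def[abs_def] top.not_eq_extremum)
    let ?t = "\<integral>x. discrepancy x \<partial>M"
    have t: "(\<integral>\<^sup>+x. ennreal (discrepancy x) \<partial>M) = ennreal ?t" "?t \<ge> 0"
      using T discrepancy_nonneg by (auto intro!: nn_integral_eq_integral integral_nonneg_AE)
    have "ennreal (cmod ((\<integral>x. h (rvec F x) \<partial>M) - (\<integral>y. h (Z y) \<partial>N))) \<le> ennreal (c * sqrt ?t)"
      if h: "1-lipschitz_on UNIV h" for h :: "complex ^ 'n \<Rightarrow> complex"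
    proof (rule ennreal_leI)
      have "h \<in> borel_measurable borel"
        using lipschitz_on_continuous_on[OF h] by (rule borel_measurable_continuous_onI)
      then have "(\<integral>y. h (Z y) \<partial>N) = (\<integral>z. h z \<partial>gauss)"
        using integral_distr[OF Z_measurable, of h] by (simp add: distr)
      then have "cmod ((\<integral>x. h (rvec F x) \<partial>M) - (\<integral>y. h (Z y) \<partial>N)) \<le> sqrt (2 * op_norm ?Q) * sqrt ?t"
        using stein_estimate_complex[OF T h] by simp
      also have "\<dots> \<le> c * sqrt ?t"
        using sqrt_le t(2) by (intro mult_right_mono) auto
      finally show "cmod ((\<integral>x. h (rvec F x) \<partial>M) - (\<integral>y. h (Z y) \<partial>N)) \<le> c * sqrt ?t" .
    qed
    then have "wasserstein M (rvec F) N Z \<le> ennreal (c * sqrt ?t)"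
      unfolding wasserstein_def by (intro SUP_least) auto
    also have "\<dots> = ennreal c * ennsqrt (\<integral>\<^sup>+x. ennreal (discrepancy x) \<partial>M)"
      using c t by (simp add: ennsqrt_def ennreal_mult)
    finally show ?thesis .
  qed
  then show ?thesis unfolding nn c_def .
qed

end
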